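(* Let $k,l\in\mathbb N$ and let $I$ be an ideal of $\mathcal R^k_{[l]}(\mathbb R^2)$. Then $\sqrt[R]{I}=\mathcal I(\mathcal Z(I))$. In particular, if $I$ is a real ideal then $\sqrt{I}=\mathcal I(\mathcal Z(I))$.
   Context: For $k\in\mathbb N\cup\{\infty\}$, $\mathcal R^k(\mathbb R^2)$ denotes the ring of functions $f:\mathbb R^2\to\mathbb R$ of class $C^k$ that coincide with $p/q$ ($p,q$ polynomials, $q$ nonvanishing there) on some nonempty Zariski open set. For $l\in\mathbb N$: consider compositions $\pi:M\to\mathbb R^2$ of successive blowings-up $M_i\to M_{i-1}$ ($M_0=\mathbb R^2$), each centred at points. An infinitely near point of order $j$ is a sequence $a_0\in M_0,\dots,a_j\in M_j$ where $M_i$ is the blowing-up of $M_{i-1}$ at $a_{i-1}$ and $a_i$ maps to $a_{i-1}$; the number of stages of $\pi$ is the maximal order of infinitely near points in $M$. $\mathcal R^k_{[l]}(\mathbb R^2)$ is the set of $f\in\mathcal R^k(\mathbb R^2)$ for which there is such a $\pi$ with at most $l$ stages such that $f\circ\pi$ is regular on $M$. For an ideal $I$ of a commutative ring $A$, the real radical is $\sqrt[R]{I}=\{a\in A:\exists m\in\mathbb N,\ \exists b_1,\dots,b_p\in A,\ a^{2m}+b_1^2+\dots+b_p^2\in I\}$; $I$ is real if $\sum_i a_i^2\in I$ implies each $a_i\in I$. $\mathcal Z(I)=\{x\in\mathbb R^2: g(x)=0\ \forall g\in I\}$ and for $Z\subseteq\mathbb R^2$, $\mathcal I(Z)=\{g\in\mathcal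 R^k_{[l]}(\mathbb R^2): g|_Z=0\}$. *)

theory Defs
  imports "HOL-Analysis.Analysis" "HOL-Algebra.Ideal"
begin

definition poly2 :: "(real \<times> real \<Rightarrow> real) \<Rightarrow> bool" where
  "poly2 p \<longleftrightarrow> (\<exists>N::nat. \<exists>c::nat \<Rightarrow> nat \<Rightarrow> real.
      \<forall>x y. p (x, y) = (\<Sum>i\<le>N. \<Sum>j\<le>N. c i j * x ^ i * y ^ j))"

definition zariski_open :: "(real \<times> real) set \<Rightarrow> bool" where
  "zariski_open U \<longleftrightarrow> (\<exists>S. (\<forall>p\<in>S. poly2 p) \<and>
      U = - {x. \<forall>p\<in>S. p x = 0})"

fun Ck :: "nat \<Rightarrow> (real \<times> real \<Rightarrow> real) \<Rightarrow> bool" where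
  "Ck 0 f = continuous_on UNIV f"
| "Ck (Suc k) f = ((\<forall>x. f differentiable (at x)) \<and>
      Ck k (\<lambda>x. frechet_derivative f (at x) (1, 0)) \<and>
      Ck k (\<lambda>x. frechet_derivative f (at x) (0, 1)))"

definition rational2 :: "(real \<times> real \<Rightarrow> real) \<Rightarrow> bool" where
  "rational2 f \<longleftrightarrow> (\<exists>p q U. poly2 p \<and> poly2 q \<and> zariski_open U \<and> U \<noteq> {} \<and>
      (\<forall>x\<in>U. q x \<noteq> 0 \<and> f x = p x / q x))"

definition regulous :: "nat \<Rightarrow> (real \<times> real \<Rightarrow> real) \<Rightarrow> bool" where
  "regulous k f \<longleftrightarrow> Ck k f \<and> rational2 f"

definition regular_at :: "(real \<times> real \<Rightarrow> real) \<Rightarrow> real \<times> real \<Rightarrow> bool" where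
  "regular_at g x \<longleftrightarrow> (\<exists>p q U. poly2 p \<and> poly2 q \<and> zariski_open U \<and> x \<in> U \<and>
      (\<forall>y\<in>U. q y \<noteq> 0 \<and> g y = p y / q y))"

text \<open>The two standard affine charts of the blowing-up of the plane at c;
  the exceptional divisor is u = 0 in the first chart and v = 0 in the second,
  and it is covered by the points (0,v) of chart 1 together with (0,0) of chart 2.\<close>
definition bl1 :: "real \<times> real \<Rightarrow> real \<times> real \<Rightarrow> real \<times> real" where
  "bl1 c = (\<lambda>(u, v). (fst c + u, snd c + u * v))"

definition bl2 :: "real \<times> real \<Rightarrow> real \<times> real \<Rightarrow> real \<times> real" where
  "bl2 c = (\<lambda>(u, v). (fst c + u * v, snd c + v))"

text \<open>resolved l g x: g (a function on an affine chart) becomes regular at every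
  point lying over x after a finite sequence of point blowings-up over x with at
  most l stages.  Either g is already regular at x, or one blows up x
  (needs l \<ge> 1) and then every point of the exceptional divisor is resolved with
  at most l-1 stages, only finitely many of them requiring further blowings-up.\<close>
fun resolved :: "nat \<Rightarrow> (real \<times> real \<Rightarrow> real) \<Rightarrow> real \<times> real \<Rightarrow> bool" where
  "resolved 0 g x = regular_at g x"
| "resolved (Suc l) g x = (regular_at g x \<or>
      (finite {v. \<not> regular_at (g \<circ> bl1 x) (0, v)} \<and>
       (\<forall>v. resolved l (g \<circ> bl1 x) (0, v)) \<and>
       resolved l (g \<circ> bl2 x) (0, 0)))"

text \<open>R^k_[l](R^2): regulous C^k functions f such that f \<circ> \<pi> is regular for some
  composition \<pi> of point blowings-up with at most l stages (finitely many centres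
  in R^2, each resolved with at most l stages).\<close>
definition Rkl :: "nat \<Rightarrow> nat \<Rightarrow> (real \<times> real \<Rightarrow> real) set" where
  "Rkl k l = {f. regulous k f \<and> finite {x. \<not> regular_at f x} \<and> (\<forall>x. resolved l f x)}"

definition Rkl_ring :: "nat \<Rightarrow> nat \<Rightarrow> (real \<times> real \<Rightarrow> real) ring" where
  "Rkl_ring k l = \<lparr>carrier = Rkl k l, mult = (\<lambda>f g x. f x * g x), one = (\<lambda>x. 1),
      zero = (\<lambda>x. 0), add = (\<lambda>f g x. f x + g x)\<rparr>"

definition ring_radical :: "('a, 'b) ring_scheme \<Rightarrow> 'a set \<Rightarrow> 'a set" where
  "ring_radical A I = {a \<in> carrier A. \<exists>n::nat. a [^]\<^bsub>A\<^esub> n \<in> I}"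

definition real_radical :: "('a, 'b) ring_scheme \<Rightarrow> 'a set \<Rightarrow> 'a set" where
  "real_radical A I = {a \<in> carrier A. \<exists>(m::nat) (p::nat) (b::nat \<Rightarrow> 'a).
      (\<forall>i<p. b i \<in> carrier A) \<and>
      a [^]\<^bsub>A\<^esub> (2 * m) \<oplus>\<^bsub>A\<^esub> (\<Oplus>\<^bsub>A\<^esub>i\<in>{..<p}. b i \<otimes>\<^bsub>A\<^esub> b i) \<in> I}"

definition real_ideal :: "('a, 'b) ring_scheme \<Rightarrow> 'a set \<Rightarrow> bool" where
  "real_ideal A I \<longleftrightarrow> (\<forall>(p::nat) (a::nat \<Rightarrow> 'a). (\<forall>i<p. a i \<in> carrier A) \<longrightarrow>
      (\<Oplus>\<^bsub>A\<^esub>i\<in>{..<p}. a i \<otimes>\<^bsub>A\<^esub> a i) \<in> I \<longrightarrow> (\<forall>i<p. a i \<in> I))"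

definition zero_set :: "(real \<times> real \<Rightarrow> real) set \<Rightarrow> (real \<times> real) set" where
  "zero_set I = {x. \<forall>g\<in>I. g x = 0}"

definition vanishing_ideal :: "nat \<Rightarrow> nat \<Rightarrow> (real \<times> real) set \<Rightarrow> (real \<times> real \<Rightarrow> real) set" where
  "vanishing_ideal k l Z = {g \<in> Rkl k l. \<forall>x\<in>Z. g x = 0}"

end

theory Submission
  imports Defs "HOL-Computational_Algebra.Polynomial_Factorial" "HOL-Computational_Algebra.Field_as_Ring"
    "HOL-Library.Function_Algebras"
begin

text \<open>
  If \<open>f\<close> is not in the real radical of \<open>I\<close>, Zorn's lemma yields an ordering of a residue domain
  \<open>A / P\<close> with \<open>I \<subseteq> P\<close> and \<open>f \<notin> P\<close>. The prime \<open>P\<^sub>0 = P \<inter> \<real>[x,y]\<close> is nonzero if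
  \<open>I\<close> is, and by a Newton-Puiseux descent inside its ordered residue field it is either the
  maximal ideal of a point or generated by an irreducible \<open>D\<close> with uncountably many real zeros.
  In the curve case the elements of \<open>I\<close> vanish at all non-isolated zeros of \<open>D\<close> by continuity, hence
  so does \<open>f\<close>, and clearing a denominator of \<open>f\<close> shows \<open>f \<in> P\<close>. In the case of a point \<open>c\<close>, every
  \<open>g\<close> vanishing at \<open>c\<close> lies in \<open>P\<close>, because \<open>g^N / |z - c|\<^sup>2\<close> is again in the ring for large
  \<open>N\<close> unless \<open>g\<close> is already regular at \<open>c\<close>; so \<open>c\<close> is a zero of \<open>I\<close> and again \<open>f \<in> P\<close>.
\<close>

text \<open>The ordering supplies a zero over an ordered field, not over the reals, and the descent
  brings it back by hand, without real closures or a transfer principle. At an infinitesimal zero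
  two monomials must have comparable size; this Newton edge gives a monomial chart, and after
  finitely many charts a simple root is left, where a sign change produces real zeros. Charts with
  integer exponents are used because \<open>v ^ q / u ^ p\<close> exists in any field, whereas roots
  of \<open>u\<close> need not. Uncountably many zeros are carried along, instead of infinitely
  many, because a subset of the plane has only countably many isolated points and an element of the
  ring only finitely many non-regular ones; enough limit points of the curve then remain. In the
  point case \<open>N\<close> has to beat two effects: each of the at most \<open>l\<close> stages
  can double the exponents of the denominator, and each of the \<open>k\<close> derivatives costs up
  to two powers. This is where finiteness of \<open>k\<close> and \<open>l\<close> enters. If
  \<open>I\<close> is the zero ideal, the prime of polynomials may be zero as well; but then
  \<open>f\<close> vanishes on the whole plane.\<close>

hide_const (open) Coset.order

section \<open>Polynomials in two variables\<close>

text \<open>A bare predicate, so that one evaluation \<open>ev\<close> serves the identity of the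
  reals, the embedding of constants into polynomials and the embedding into an ordered
  extension.\<close>

definition rhom :: "('a::comm_ring_1 \<Rightarrow> 'b::comm_ring_1) \<Rightarrow> bool" where
  "rhom h \<longleftrightarrow> h 1 = 1 \<and> (\<forall>a b. h (a + b) = h a + h b) \<and> (\<forall>a b. h (a * b) = h a * h b)"

lemma rhomD:
  assumes "rhom h"
  shows "h 0 = 0" "h 1 = 1" "h (a + b) = h a + h b" "h (a * b) = h a * h b"
    "h (- a) = - h a" "h (a - b) = h a - h b" "h (a ^ n) = h a ^ n"
proof -
  have add: "\<And>a b. h (a + b) = h a + h b" and mult: "\<And>a b. h (a * b) = h a * h b" and one: "h 1 = 1"
    using assms by (auto simp: rhom_def)
  show "h 1 = 1" "h (a + b) = h a + h b" "h (a * b) = h a * h b" by (fact add mult one)+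
  show z: "h 0 = 0" using add[of 0 0] by simp
  have neg: "\<And>a. h (- a) = - h a" using add[of _ "- _"] z by (metis add_eq_0_iff2 add.right_inverse)
  show "h (- a) = - h a" by (fact neg)
  show "h (a - b) = h a - h b" using add[of a "- b"] neg by simp
  show "h (a ^ n) = h a ^ n" by (induction n) (auto simp: one mult)
qed

lemma rhom_sum: "rhom h \<Longrightarrow> h (sum f A) = (\<Sum>x\<in>A. h (f x))"
  by (induction A rule: infinite_finite_induct) (auto simp: rhomD)

lemma rhom_of_nat: "rhom h \<Longrightarrow> h (of_nat n) = of_nat n"
  by (induction n) (auto simp: rhomD)

lemma rhom_comp: "rhom h \<Longrightarrow> rhom g \<Longrightarrow> rhom (\<lambda>x. h (g x))"
  by (simp add: rhom_def)

lemma rhom_id: "rhom (\<lambda>x. x)" by (simp add: rhom_def)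

lemma rhom_const_poly: "rhom (\<lambda>r. [:r:])" by (simp add: rhom_def)

lemma rhom_poly: "rhom (\<lambda>p. poly p x)" by (simp add: rhom_def)

lemma rhom_map_poly:
  assumes "rhom h" shows "rhom (map_poly h)"
  unfolding rhom_def
proof (intro conjI allI)
  note [simp] = rhomD[OF assms]
  show "map_poly h 1 = 1" by (simp add: one_pCons map_poly_pCons)
  show "map_poly h (p + q) = map_poly h p + map_poly h q" for p q
    by (rule poly_eqI) (simp add: coeff_map_poly)
  show "map_poly h (p * q) = map_poly h p * map_poly h q" for p q
    by (rule poly_eqI) (simp add: coeff_map_poly coeff_mult rhom_sum[OF assms])
qed

lemma rhom_heval:
  assumes "rhom h" shows "rhom (\<lambda>p. poly (map_poly h p) v)"
  by (rule rhom_comp[OF rhom_poly rhom_map_poly[OF assms]])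

text \<open>A polynomial in two variables is a polynomial in the second variable whose coefficients are
  polynomials in the first one.\<close>

definition ev :: "(real \<Rightarrow> 'b::comm_ring_1) \<Rightarrow> real poly poly \<Rightarrow> 'b \<Rightarrow> 'b \<Rightarrow> 'b" where
  "ev h D u v = poly (map_poly (\<lambda>c. poly (map_poly h c) u) D) v"

lemma rhom_ev: "rhom h \<Longrightarrow> rhom (\<lambda>D. ev h D u v)"
  unfolding ev_def by (intro rhom_heval)

lemmas ev_simps = rhomD[OF rhom_ev]

lemma ev_pCons: "rhom h \<Longrightarrow> ev h (pCons c D) u v = poly (map_poly h c) u + v * ev h D u v"
  by (simp add: ev_def map_poly_pCons rhomD)

lemma ev_zero: "rhom h \<Longrightarrow> ev h 0 u v = 0" by (simp add: ev_def)

lemma ev_const: "rhom h \<Longrightarrow> ev h [:[:r:]:] u v = h r"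
  by (simp add: ev_pCons ev_zero map_poly_pCons rhomD)

lemma ev_X: "rhom h \<Longrightarrow> ev h [:[:0, 1:]:] u v = u"
  by (simp add: ev_pCons ev_zero map_poly_pCons rhomD)

lemma ev_Y: "rhom h \<Longrightarrow> ev h [:0, 1:] u v = v"
  by (simp add: ev_pCons ev_zero map_poly_pCons rhomD one_pCons)

lemma ev_inner: "rhom h \<Longrightarrow> ev h [:c:] u v = poly (map_poly h c) u"
  by (simp add: ev_pCons ev_zero)

lemma map_poly_monom_rhom: "rhom h \<Longrightarrow> map_poly h (monom c n) = monom (h c) n"
  by (simp add: map_poly_monom rhomD)

lemma ev_monom: "rhom h \<Longrightarrow> ev h (monom (monom c i) j) u v = h c * u ^ i * v ^ j"
  by (simp add: ev_def map_poly_monom_rhom rhom_heval poly_monom rhomD)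

lemma poly_map_poly_rhom:
  assumes "rhom \<phi>" "rhom g"
  shows "\<phi> (poly (map_poly g c) A) = poly (map_poly (\<lambda>x. \<phi> (g x)) c) (\<phi> A)"
  using assms by (induction c) (auto simp: map_poly_pCons rhomD rhom_comp)

lemma rhom_ev_comp:
  assumes "rhom \<phi>" "rhom g"
  shows "\<phi> (ev g D A B) = ev (\<lambda>x. \<phi> (g x)) D (\<phi> A) (\<phi> B)"
proof (induction D)
  case 0 then show ?case by (simp add: ev_zero assms rhom_comp rhomD)
next
  case (pCons c D)
  then show ?case
    by (simp add: ev_pCons assms rhom_comp rhomD[OF assms(1)] poly_map_poly_rhom[OF assms])
qed

definition subst2 :: "real poly poly \<Rightarrow> real poly poly \<Rightarrow> real poly poly \<Rightarrow> real poly poly" where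
  "subst2 D A B = ev (\<lambda>r. [:[:r:]:]) D A B"

lemma ev_subst2:
  assumes "rhom h" shows "ev h (subst2 D A B) u v = ev h D (ev h A u v) (ev h B u v)"
  unfolding subst2_def
  using rhom_ev_comp[OF rhom_ev[OF assms] rhom_comp[OF rhom_const_poly rhom_const_poly]]
  by (simp add: ev_const[OF assms])

abbreviation pe :: "real poly poly \<Rightarrow> real \<Rightarrow> real \<Rightarrow> real" where
  "pe \<equiv> ev (\<lambda>x. x)"

definition slice :: "real \<Rightarrow> real poly poly \<Rightarrow> real poly" where
  "slice x D = map_poly (\<lambda>c. poly c x) D"

lemma pe_slice: "pe D x y = poly (slice x D) y"
  by (simp add: ev_def slice_def map_poly_idI)

lemma rhom_slice: "rhom (slice x)"
  unfolding slice_def by (intro rhom_map_poly rhom_poly)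

lemma coeff_slice: "coeff (slice x D) n = poly (coeff D n) x"
  by (simp add: slice_def coeff_map_poly)

lemma slice_eq_0_iff: "slice x D = 0 \<longleftrightarrow> [:[:-x, 1:]:] dvd D"
  by (simp add: const_poly_dvd_iff poly_eq_iff coeff_slice poly_eq_0_iff_dvd)

lemma pe_swap: "pe D x y = poly (poly D [:y:]) x"
  by (induction D) (auto simp: ev_zero rhom_id ev_pCons map_poly_idI)

lemma isCont_pe [continuous_intros]:
  assumes "isCont f x" "isCont g x" shows "isCont (\<lambda>z. pe D (f z) (g z)) x"
proof (induction D)
  case 0 then show ?case by (simp add: ev_zero rhom_id)
next
  case (pCons c D)
  then show ?case using assms
    by (simp add: ev_pCons rhom_id map_poly_idI) (intro continuous_intros isCont_o2[OF assms(1)] poly_isCont)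
qed

definition mon_supp :: "real poly poly \<Rightarrow> (nat \<times> nat) set" where
  "mon_supp D = {(i, j). coeff (coeff D j) i \<noteq> 0}"

lemma finite_mon_supp: "finite (mon_supp D)"
proof -
  have "mon_supp D \<subseteq> (\<Union>j\<in>{..degree D}. {..degree (coeff D j)} \<times> {j})"
    by (force simp: mon_supp_def intro: le_degree)
  then show ?thesis by (rule finite_subset) auto
qed

lemma mon_supp_sum:
  "D = (\<Sum>(i, j)\<in>mon_supp D. monom (monom (coeff (coeff D j) i) i) j)"
proof (intro poly_eqI)
  fix m n
  let ?c = "\<lambda>i j. coeff (coeff D j) i"
  have "coeff (coeff (\<Sum>(i, j)\<in>mon_supp D. monom (monom (?c i j) i) j) m) n
     = (\<Sum>z\<in>mon_supp D. if z = (n, m) then ?c n m else 0)"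
    unfolding coeff_sum
    by (rule sum.cong) (auto simp: coeff_monom split: if_splits)
  also have "\<dots> = ?c n m"
    by (subst sum.delta[OF finite_mon_supp]) (auto simp: mon_supp_def)
  finally show "?c n m = coeff (coeff (\<Sum>(i, j)\<in>mon_supp D. monom (monom (?c i j) i) j) m) n" by simp
qed

lemma ev_sum_mon:
  assumes "rhom h"
  shows "ev h D u v = (\<Sum>(i, j)\<in>mon_supp D. h (coeff (coeff D j) i) * u ^ i * v ^ j)"
  by (subst mon_supp_sum) (simp add: rhom_sum[OF rhom_ev[OF assms]] case_prod_unfold ev_monom[OF assms])

section \<open>Ordered extensions of the reals\<close>

text \<open>The field may be non-Archimedean and need not be real closed: roots are never extracted
  in it, and completeness is used only for the reals, as in \<open>near_exists\<close>.\<close>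

locale ordered_real_ext =
  fixes \<iota> :: "real \<Rightarrow> 'a::linordered_field"
  assumes hom: "rhom \<iota>"
begin

lemmas iota = rhomD[OF hom]

text \<open>Positive reals are invertible squares, so a ring homomorphism from the reals into an
  ordered field respects the order automatically.\<close>

lemma iota_pos: assumes "0 < r" shows "0 < \<iota> r"
proof -
  have "\<iota> r = \<iota> (sqrt r) * \<iota> (sqrt r)" using assms by (simp flip: iota(4))
  moreover have "\<iota> r * \<iota> (inverse r) = 1" using assms by (simp flip: iota(4) add: iota(2))
  moreover from this have "\<iota> r \<noteq> 0" by auto
  ultimately show ?thesis by (metis zero_le_square order_le_neq_trans)
qed

lemma iota_less_iff: "\<iota> r < \<iota> s \<longleftrightarrow> r < s"
proof -
  have *: "\<iota> a < \<iota> b" if "a < b" for a b using iota_pos[of "b - a"] that by (simp add: iota)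
  show ?thesis using *[of r s] *[of s r] by (cases r s rule: linorder_cases) auto
qed

lemma iota_le_iff: "\<iota> r \<le> \<iota> s \<longleftrightarrow> r \<le> s"
  using iota_less_iff linorder_not_less by metis

lemma iota_eq_iff: "\<iota> r = \<iota> s \<longleftrightarrow> r = s"
  by (simp add: order_eq_iff iota_le_iff)

lemma iota_abs: "\<bar>\<iota> r\<bar> = \<iota> \<bar>r\<bar>"
  using iota_less_iff[of r 0] by (auto simp: abs_if iota)

lemma iota_inverse: "\<iota> (inverse r) = inverse (\<iota> r)"
proof (cases "r = 0")
  case False
  then have "\<iota> r * \<iota> (inverse r) = 1" by (simp flip: iota(4) add: iota(2))
  then show ?thesis by (metis inverse_unique)
qed (simp add: iota)

text \<open>The standard part relation: \<open>r\<close> is infinitely close to \<open>z\<close>. In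
  particular \<open>near z 0\<close> says that \<open>z\<close> is infinitesimal.\<close>

definition near :: "'a \<Rightarrow> real \<Rightarrow> bool" where
  "near z r \<longleftrightarrow> (\<forall>e>0. \<bar>z - \<iota> r\<bar> < \<iota> e)"

lemma near_iota: "near (\<iota> r) r" by (simp add: near_def iota_pos)

lemma near_0: "near 0 0" using near_iota[of 0] by (simp add: iota)
lemma near_1: "near 1 1" using near_iota[of 1] by (simp add: iota)

lemma near_unique: assumes "near z r" "near z s" shows "r = s"
proof (rule ccontr)
  assume "r \<noteq> s"
  then have "\<bar>r - s\<bar> / 2 > 0" by simp
  then have "\<bar>z - \<iota> r\<bar> < \<iota> (\<bar>r - s\<bar> / 2)" "\<bar>z - \<iota> s\<bar> < \<iota> (\<bar>r - s\<bar> / 2)"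
    using assms unfolding near_def by blast+
  then have "\<bar>\<iota> r - \<iota> s\<bar> < \<iota> (\<bar>r - s\<bar> / 2) + \<iota> (\<bar>r - s\<bar> / 2)" by linarith
  also have "\<dots> = \<bar>\<iota> r - \<iota> s\<bar>" by (simp flip: iota(3) iota(6) add: iota_abs)
  finally show False by simp
qed

lemma near_add: assumes "near z r" "near w s" shows "near (z + w) (r + s)"
  unfolding near_def
proof (intro allI impI)
  fix e :: real assume "0 < e"
  then have "\<bar>z - \<iota> r\<bar> < \<iota> (e/2)" "\<bar>w - \<iota> s\<bar> < \<iota> (e/2)" using assms by (auto simp: near_def)
  moreover have "\<iota> e = \<iota> (e/2) + \<iota> (e/2)" by (simp flip: iota(3))
  ultimately show "\<bar>z + w - \<iota> (r + s)\<bar> < \<iota> e" unfolding iota(3) by linarith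
qed

lemma near_minus: "near z r \<Longrightarrow> near (- z) (- r)"
  unfolding near_def iota(5) minus_diff_minus by (simp add: abs_minus_commute)

lemma near_iff_diff: "near z r \<longleftrightarrow> near (z - \<iota> r) 0"
  by (simp add: near_def iota)

lemma near_bound: assumes "near z r" shows "\<bar>z\<bar> < \<iota> (\<bar>r\<bar> + 1)"
proof -
  have "\<bar>z - \<iota> r\<bar> < \<iota> 1" using assms by (simp add: near_def)
  then show ?thesis unfolding iota(3) iota_abs[symmetric] by linarith
qed

lemma near_0_mult_bounded:
  assumes "near z 0" "\<bar>w\<bar> \<le> \<iota> K" shows "near (z * w) 0"
  unfolding near_def
proof (intro allI impI)
  fix e :: real assume e: "0 < e"
  have K: "0 \<le> K" using assms(2) iota_less_iff[of K 0] by (force simp: iota)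
  have "e / (K + 1) > 0" using e K by simp
  then have "\<bar>z\<bar> < \<iota> (e / (K + 1))" using assms(1) unfolding near_def by (simp add: iota)
  moreover have "\<bar>w\<bar> < \<iota> (K + 1)" using assms(2) iota_less_iff[of K "K+1"] by simp
  ultimately have "\<bar>z\<bar> * \<bar>w\<bar> < \<iota> (e / (K + 1)) * \<iota> (K + 1)"
    using K by (intro mult_strict_mono') auto
  then show "\<bar>z * w - \<iota> 0\<bar> < \<iota> e" using K by (simp add: abs_mult iota(1) flip: iota(4))
qed

lemma near_mult: assumes "near z r" "near w s" shows "near (z * w) (r * s)"
proof -
  have "near ((z - \<iota> r) * w) 0"
    using assms near_bound[OF assms(2)]
    by (intro near_0_mult_bounded[where K = "\<bar>s\<bar> + 1"]) (auto simp: near_iff_diff[symmetric])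
  moreover have "near ((w - \<iota> s) * \<iota> r) 0"
    using assms by (intro near_0_mult_bounded[where K = "\<bar>r\<bar>"]) (auto simp: near_iff_diff[symmetric] iota_abs)
  ultimately have "near ((z - \<iota> r) * w + (w - \<iota> s) * \<iota> r) (0 + 0)" by (rule near_add)
  then show ?thesis by (subst near_iff_diff) (simp add: algebra_simps iota)
qed

lemma near_power: "near z r \<Longrightarrow> near (z ^ n) (r ^ n)"
  by (induction n) (auto simp: near_1 near_mult)

lemma near_sum: "(\<And>x. x \<in> A \<Longrightarrow> near (f x) (g x)) \<Longrightarrow> near (sum f A) (sum g A)"
  by (induction A rule: infinite_finite_induct) (auto simp: near_0 near_add)

lemma near_poly: "near u x \<Longrightarrow> near (poly (map_poly \<iota> c) u) (poly c x)"
  by (induction c) (auto simp: near_0 map_poly_pCons iota intro!: near_add near_mult near_iota)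

lemma near_ev: "near u x \<Longrightarrow> near v y \<Longrightarrow> near (ev \<iota> D u v) (pe D x y)"
  by (induction D) (auto simp: near_0 ev_zero ev_pCons hom rhom_id map_poly_idI
      intro!: near_add near_mult near_poly)

lemma near_lower: assumes "near z r" "s < r" shows "\<iota> s < z"
proof -
  have "\<bar>z - \<iota> r\<bar> < \<iota> (r - s)" using assms unfolding near_def by simp
  then show ?thesis unfolding iota by linarith
qed

lemma near_upper: assumes "near z r" "r < s" shows "z < \<iota> s"
proof -
  have "\<bar>z - \<iota> r\<bar> < \<iota> (s - r)" using assms unfolding near_def by simp
  then show ?thesis unfolding iota by linarith
qed

lemma near_nonneg: assumes "near z r" "0 \<le> z" shows "0 \<le> r"
  using near_upper[OF assms(1), of 0] assms(2) by (force simp: iota)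

lemma near_nonzero: assumes "near z r" "r \<noteq> 0" shows "z \<noteq> 0"
  using near_unique[OF assms(1)] assms(2) near_0 by blast

lemma near_inverse: assumes "near z r" "r \<noteq> 0" shows "near (inverse z) (inverse r)"
proof -
  have z: "z \<noteq> 0" using near_nonzero assms by blast
  have "\<iota> (\<bar>r\<bar>/2) < \<bar>z\<bar>"
  proof (cases "r > 0")
    case True
    then show ?thesis using near_lower[OF assms(1), of "r/2"] by simp
  next
    case False
    then have "z < \<iota> (r/2)" using near_upper[OF assms(1), of "r/2"] assms(2) by simp
    moreover have "\<iota> (\<bar>r\<bar>/2) = - \<iota> (r/2)" using False by (simp flip: iota(5))
    ultimately show ?thesis by linarith
  qed
  then have "inverse \<bar>z\<bar> \<le> inverse (\<iota> (\<bar>r\<bar>/2))" using assms(2) by (intro le_imp_inverse_le iota_pos) auto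
  then have b: "\<bar>inverse z\<bar> \<le> \<iota> (inverse (\<bar>r\<bar>/2))" unfolding iota_inverse by (simp add: abs_inverse)
  have "near ((z - \<iota> r) * inverse z) 0"
    using assms(1) near_0_mult_bounded b near_iff_diff by blast
  then have "near (((z - \<iota> r) * inverse z) * (- \<iota> (inverse r))) (0 * - inverse r)"
    by (intro near_mult near_minus near_iota)
  moreover have "((z - \<iota> r) * inverse z) * (- \<iota> (inverse r)) = inverse z - \<iota> (inverse r)"
    using z assms(2) iota_eq_iff[of r 0] unfolding iota_inverse by (simp add: field_simps iota)
  ultimately show ?thesis by (subst near_iff_diff) simp
qed

text \<open>The standard part is the supremum of the real cut \<open>S\<close> below
  \<open>z\<close>; the bound makes the cut nonempty and bounded above.\<close>

lemma near_exists: assumes "\<bar>z\<bar> \<le> \<iota> K" shows "\<exists>r. near z r"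
proof -
  define S where "S = {r. \<iota> r \<le> z}"
  have le: "\<iota> (- K) \<le> z" "z \<le> \<iota> K" using assms unfolding iota by linarith+
  have ne: "S \<noteq> {}" using le(1) by (auto simp: S_def)
  have bd: "r \<le> K" if "r \<in> S" for r using that le(2) by (metis S_def mem_Collect_eq order_trans iota_le_iff)
  then have bdd: "bdd_above S" by (rule bdd_aboveI)
  have "\<bar>z - \<iota> (Sup S)\<bar> < \<iota> e" if "0 < e" for e
  proof -
    have "Sup S - e / 2 < Sup S" using that by simp
    then obtain r where r: "r \<in> S" "Sup S - e/2 < r" using less_cSup_iff[OF ne bdd] by blast
    have "\<iota> (Sup S - e / 2) < z" using r iota_less_iff[of "Sup S - e/2" r] by (auto simp: S_def)
    moreover have "Sup S + e / 2 \<notin> S" using cSup_upper[OF _ bdd, of "Sup S + e/2"] that by auto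
    then have "z < \<iota> (Sup S + e / 2)" by (auto simp: S_def)
    moreover have "\<iota> (e / 2) < \<iota> e" using that iota_less_iff by simp
    ultimately show ?thesis unfolding iota by linarith
  qed
  then show ?thesis unfolding near_def by blast
qed

lemma near_0_power_iff: assumes "n > 0" shows "near (z ^ n) 0 \<longleftrightarrow> near z 0"
proof
  assume "near z 0" then show "near (z ^ n) 0" using near_power[of z 0 n] assms by (simp add: zero_power)
next
  assume a: "near (z ^ n) 0"
  have "\<bar>z\<bar> < \<iota> e" if "0 < e" for e
  proof -
    have "\<bar>z ^ n - \<iota> 0\<bar> < \<iota> (e ^ n)" using a that unfolding near_def by simp
    then have "\<bar>z\<bar> ^ n < \<iota> e ^ n" by (simp add: iota power_abs)
    then show ?thesis by (rule power_less_imp_less_base) (simp add: iota_pos less_imp_le that)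
  qed
  then show "near z 0" by (simp add: near_def iota)
qed

text \<open>Replaces the extraction of an \<open>n\<close>-th root: \<open>z\<close> is finite
  because \<open>z ^ n\<close> is, and its standard part \<open>s\<close> satisfies
  \<open>s ^ n = r\<close>.\<close>

lemma near_root_exists:
  assumes "near (z ^ n) r" "n > 0" "r > 0" "z > 0"
  shows "\<exists>s>0. near z s"
proof -
  have "z \<le> 1 \<or> z ^ 1 \<le> z ^ n" using assms(2) power_increasing[of 1 n z] by linarith
  then have "\<bar>z\<bar> \<le> \<iota> (\<bar>r\<bar> + 1)"
    using near_bound[OF assms(1)] iota_le_iff[of 1 "\<bar>r\<bar> + 1"] assms(4) by (auto simp: iota)
  then obtain s where s: "near z s" using near_exists by blast
  then have "s ^ n = r" using near_power near_unique assms(1) by blast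
  then have "s \<noteq> 0" using assms by (auto simp: zero_power)
  moreover have "0 \<le> s" using near_nonneg s assms(4) by simp
  ultimately show ?thesis using s by (intro exI[of _ s]) simp
qed

text \<open>Splitting off the power of the variable given by the order at 0 leaves a cofactor whose
  value at 0 is the nonzero \<open>\<gamma>\<close>. So at an infinitesimal \<open>u\<close> a
  polynomial has the size of \<open>u ^ k\<close> up to a finite, non-infinitesimal factor.\<close>

lemma poly_infinitesimal:
  assumes "c \<noteq> 0" shows "\<exists>k w \<gamma>. \<gamma> \<noteq> 0 \<and> (\<forall>u. near u 0 \<longrightarrow> (near (w u) \<gamma> \<and> poly (map_poly \<iota> c) u = w u * u ^ k))"
proof -
  obtain c' where c': "c = [:-0, 1:] ^ order 0 c * c'" "\<not> [:-0, 1:] dvd c'"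
    using order_decomp[OF assms] by blast
  have "poly (map_poly \<iota> c) u = poly (map_poly \<iota> c') u * u ^ order 0 c" for u
    by (subst c'(1)) (simp add: rhomD[OF rhom_heval[OF hom]] map_poly_pCons iota)
  moreover have "poly c' 0 \<noteq> 0" using c'(2) by (simp add: poly_eq_0_iff_dvd)
  ultimately show ?thesis using near_poly[of _ 0 c'] by blast
qed

lemma poly_infinitesimal_nonzero:
  assumes "c \<noteq> 0" "near u 0" "u \<noteq> 0" shows "poly (map_poly \<iota> c) u \<noteq> 0"
  using poly_infinitesimal[OF assms(1)] assms(2,3) near_nonzero by fastforce

end

section \<open>Newton edges and toric charts\<close>

lemma poly_map_poly_sum:
  fixes h :: "'a::zero \<Rightarrow> 'b::comm_semiring_1"
  assumes "h 0 = 0" shows "poly (map_poly h p) v = (\<Sum>j\<le>degree p. h (coeff p j) * v ^ j)"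
  unfolding poly_altdef
proof (rule sum.mono_neutral_cong_left)
  show "\<forall>i\<in>{..degree p} - {..degree (map_poly h p)}. h (coeff p i) * v ^ i = 0"
    using coeff_eq_0[of "map_poly h p"] assms by (auto simp: coeff_map_poly)
qed (auto simp: coeff_map_poly assms intro: order_trans map_poly_degree_leq)

context ordered_real_ext begin

text \<open>In a vanishing sum a monomial of largest size cannot stand alone; another one of the
  same order of magnitude must balance it. Comparing the two gives a slope of the Newton
  polygon.\<close>

lemma newton_tie:
  assumes D: "D \<noteq> 0" "ev \<iota> D u v = 0" and u: "near u 0" "0 < u" and v: "near v 0" "0 < v"
  shows "\<exists>p q r. p > 0 \<and> q > 0 \<and> coprime p q \<and> r > 0 \<and> near (v ^ q / u ^ p) r"
proof -
  define J where "J = {j. coeff D j \<noteq> 0}"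
  have fJ: "finite J" unfolding J_def by (rule finite_subset[of _ "{..degree D}"]) (auto intro: le_degree)
  have neJ: "J \<noteq> {}" using D(1) unfolding J_def by (metis (mono_tags) empty_Collect_eq leading_coeff_0_iff)
  have "\<forall>j. \<exists>k w \<gamma>. j \<in> J \<longrightarrow> \<gamma> \<noteq> 0 \<and> near w \<gamma> \<and> poly (map_poly \<iota> (coeff D j)) u = w * u ^ k"
    using poly_infinitesimal u(1) unfolding J_def mem_Collect_eq by meson
  then obtain k w \<gamma> where kw: "\<And>j. j \<in> J \<Longrightarrow> \<gamma> j \<noteq> (0::real)" "\<And>j. j \<in> J \<Longrightarrow> near (w j) (\<gamma> j)"
     "\<And>j. j \<in> J \<Longrightarrow> poly (map_poly \<iota> (coeff D j)) u = w j * u ^ k j" by metis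
  define m where "m j = u ^ k j * v ^ j" for j
  have m_pos: "0 < m j" for j using u v by (simp add: m_def)
  obtain j0 where j0: "j0 \<in> J" "\<And>j. j \<in> J \<Longrightarrow> m j \<le> m j0"
    using Max_in[of "m ` J"] fJ neJ Max_ge[of "m ` J"] by fastforce
  have "\<bar>m j / m j0\<bar> \<le> \<iota> 1" if "j \<in> J" for j
    using j0(2)[OF that] m_pos[of j] m_pos[of j0] by (simp add: iota)
  then have "\<forall>j. \<exists>r. j \<in> J \<longrightarrow> near (m j / m j0) r" using near_exists by blast
  then obtain \<rho> where \<rho>: "\<And>j. j \<in> J \<Longrightarrow> near (m j / m j0) (\<rho> j)" by metis
  have \<rho>_nn: "0 \<le> \<rho> j" if "j \<in> J" for j
    using near_nonneg[OF \<rho>[OF that]] m_pos by (simp add: less_imp_le)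
  have \<rho>0: "\<rho> j0 = 1" using \<rho>[OF j0(1)] near_1 near_unique m_pos[of j0] by fastforce
  have "ev \<iota> D u v = (\<Sum>j\<in>J. w j * m j)"
  proof -
    let ?h = "\<lambda>c. poly (map_poly \<iota> c) u"
    have h0: "?h 0 = 0" by simp
    have "ev \<iota> D u v = (\<Sum>j\<le>degree D. ?h (coeff D j) * v ^ j)"
      unfolding ev_def by (rule poly_map_poly_sum) simp
    also have "\<dots> = (\<Sum>j\<in>J. ?h (coeff D j) * v ^ j)"
      by (rule sum.mono_neutral_right) (auto simp: J_def intro: le_degree)
    also have "\<dots> = (\<Sum>j\<in>J. w j * m j)"
      by (rule sum.cong) (auto simp: kw(3) m_def)
    finally show ?thesis .
  qed
  then have "(\<Sum>j\<in>J. w j * (m j / m j0)) = 0"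
    using D(2) m_pos[of j0] by (simp flip: sum_divide_distrib)
  moreover have "near (\<Sum>j\<in>J. w j * (m j / m j0)) (\<Sum>j\<in>J. \<gamma> j * \<rho> j)"
    by (intro near_sum near_mult kw \<rho>)
  ultimately have "(\<Sum>j\<in>J. \<gamma> j * \<rho> j) = 0" using near_unique near_0 by metis
  \<comment> \<open>The term of \<open>j0\<close> contributes \<open>\<gamma> j0\<close>, which is
    nonzero, so some other ratio is not infinitesimal.\<close>
  then have "\<exists>j\<in>J. j \<noteq> j0 \<and> \<rho> j \<noteq> 0"
    using kw(1)[OF j0(1)] \<rho>0 sum.remove[OF fJ j0(1), of "\<lambda>j. \<gamma> j * \<rho> j"]
    by (metis (no_types, lifting) DiffE add.right_neutral insertI1 mult.right_neutral mult_not_zero sum.neutral)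
  then obtain j1 where j1: "j1 \<in> J" "j1 \<noteq> j0" "\<rho> j1 \<noteq> 0" by blast
  then have r: "near (m j1 / m j0) (\<rho> j1)" "\<rho> j1 > 0" using \<rho> \<rho>_nn by (auto simp: less_le)
  have key: "\<exists>p q r. p > 0 \<and> q > 0 \<and> coprime p q \<and> r > 0 \<and> near (v ^ q / u ^ p) r"
    if lt: "i < j" and n: "near (m j / m i) r" and r: "r > 0" for i j r
  proof -
    \<comment> \<open>Otherwise the ratio would contain the infinitesimal \<open>v ^ (j - i)\<close>
      with no negative power of \<open>u\<close> to compensate it.\<close>
    have ki: "k j < k i"
    proof (rule ccontr)
      assume "\<not> k j < k i"
      then have "m j / m i = u ^ (k j - k i) * v ^ (j - i)"
        using lt u(2) v(2) by (simp add: m_def power_diff)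
      moreover have "near (v ^ (j - i)) 0" using lt v(1) by (simp add: near_0_power_iff)
      then have "near (u ^ (k j - k i) * v ^ (j - i)) (0 ^ (k j - k i) * 0)"
        using near_power[OF u(1)] near_mult by blast
      ultimately show False using n r near_unique by fastforce
    qed
    define K where "K = k i - k j" define N where "N = j - i"
    have KN: "K > 0" "N > 0" using ki lt by (auto simp: K_def N_def)
    have "u ^ k i = u ^ k j * u ^ K" "v ^ j = v ^ i * v ^ N"
      using lt ki by (simp_all add: K_def N_def flip: power_add)
    then have e: "m j / m i = v ^ N / u ^ K" using u(2) v(2) by (simp add: m_def)
    define g where "g = gcd K N"
    obtain p q where pq: "K = p * g" "N = q * g" "coprime p q"
      using gcd_coprime_exists[of K N] KN unfolding g_def by auto
    have pos: "p > 0" "q > 0" "g > 0" using KN pq(1,2) by (metis gr0I mult_0 mult_0_right)+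
    \<comment> \<open>Only the \<open>g\<close>-th power is known to be near \<open>r\<close>; the
      standard part of the base, with coprime exponents, comes from
      \<open>near_root_exists\<close>.\<close>
    have "(v ^ q / u ^ p) ^ g = m j / m i" by (simp add: e pq power_mult power_divide)
    then have "\<exists>s>0. near (v ^ q / u ^ p) s"
      using n r pos u v by (intro near_root_exists[of "v ^ q / u ^ p" g r]) auto
    then show ?thesis using pos pq by blast
  qed
  show ?thesis
  proof (cases "j0 < j1")
    case True then show ?thesis using key r by blast
  next
    case False
    then have "j1 < j0" using j1 by simp
    moreover have "near (inverse (m j1 / m j0)) (inverse (\<rho> j1))" using near_inverse[OF r(1)] r(2) by simp
    then have "near (m j0 / m j1) (inverse (\<rho> j1))" by (simp only: inverse_divide)
    ultimately show ?thesis using key[of j1 j0 "inverse (\<rho> j1)"] r by simp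
  qed
qed

end

text \<open>The pullback of \<open>D\<close> under \<open>u = s ^ q * t ^ a\<close>,
  \<open>v = \<sigma> * s ^ p * t ^ b\<close>, divided by \<open>s ^ w\<close>. The sign
  \<open>\<sigma>\<close> accounts for negative \<open>v\<close>. The subtraction of
  \<open>w\<close> is exact as long as \<open>w\<close> is at most the weight of
  \<open>D\<close>.\<close>

definition toric :: "real \<Rightarrow> nat \<Rightarrow> nat \<Rightarrow> nat \<Rightarrow> nat \<Rightarrow> nat \<Rightarrow> real poly poly \<Rightarrow> real poly poly" where
  "toric \<sigma> p q a b w D = (\<Sum>(i, j)\<in>mon_supp D.
     monom (monom (\<sigma> ^ j * coeff (coeff D j) i) (q * i + p * j - w)) (a * i + b * j))"

text \<open>The power of \<open>s\<close> split off by the chart: the level of the supporting line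
  of the Newton polygon with normal vector \<open>(q, p)\<close>.\<close>

definition toric_weight :: "nat \<Rightarrow> nat \<Rightarrow> real poly poly \<Rightarrow> nat" where
  "toric_weight p q D = Min ((\<lambda>(i, j). q * i + p * j) ` mon_supp D)"

lemma toric_weight_le: "(i, j) \<in> mon_supp D \<Longrightarrow> toric_weight p q D \<le> q * i + p * j"
  unfolding toric_weight_def by (rule Min_le) (auto simp: finite_mon_supp intro!: image_eqI)

lemma ev_toric:
  assumes "rhom h" "w \<le> toric_weight p q D"
  shows "s ^ w * ev h (toric \<sigma> p q a b w D) s t = ev h D (s ^ q * t ^ a) (h \<sigma> * (s ^ p * t ^ b))"
proof -
  note [simp] = rhomD[OF assms(1)]
  have "s ^ w * ev h (toric \<sigma> p q a b w D) s t = (\<Sum>z\<in>mon_supp D. case z of (i, j) \<Rightarrow>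
        s ^ w * (h \<sigma> ^ j * h (coeff (coeff D j) i) * s ^ (q * i + p * j - w) * t ^ (a * i + b * j)))"
    unfolding toric_def rhom_sum[OF rhom_ev[OF assms(1)]] sum_distrib_left
    by (rule sum.cong) (auto simp: ev_monom[OF assms(1)])
  also have "\<dots> = (\<Sum>(i, j)\<in>mon_supp D. h (coeff (coeff D j) i) * (s ^ q * t ^ a) ^ i * (h \<sigma> * (s ^ p * t ^ b)) ^ j)"
  proof (intro sum.cong refl, clarify)
    fix i j assume "(i, j) \<in> mon_supp D"
    then have "w \<le> q * i + p * j" using toric_weight_le assms(2) order_trans by blast
    then have *: "s ^ w * s ^ (q * i + p * j - w) = s ^ (q * i) * s ^ (p * j)"
      by (simp flip: power_add)
    have "s ^ w * (h \<sigma> ^ j * h (coeff (coeff D j) i) * s ^ (q * i + p * j - w) * t ^ (a * i + b * j))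
      = h \<sigma> ^ j * h (coeff (coeff D j) i) * (s ^ w * s ^ (q * i + p * j - w)) * t ^ (a * i + b * j)"
      by (simp only: mult_ac)
    then show "s ^ w * (h \<sigma> ^ j * h (coeff (coeff D j) i) * s ^ (q * i + p * j - w) * t ^ (a * i + b * j))
      = h (coeff (coeff D j) i) * (s ^ q * t ^ a) ^ i * (h \<sigma> * (s ^ p * t ^ b)) ^ j"
      unfolding * by (simp add: power_mult_distrib power_add mult_ac flip: power_mult)
  qed
  also have "\<dots> = ev h D (s ^ q * t ^ a) (h \<sigma> * (s ^ p * t ^ b))"
    by (simp add: ev_sum_mon[OF assms(1)])
  finally show ?thesis .
qed

lemma pderiv_sum: "pderiv (sum f A) = (\<Sum>x\<in>A. pderiv (f x))"
  by (induction A rule: infinite_finite_induct) (auto simp: pderiv_add)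

lemma of_nat_mult_monom: "of_nat n * monom (c::real) i = monom (of_nat n * c) i"
  by (simp add: of_nat_poly smult_monom)

text \<open>Chain rule in the chart \<open>q = 1\<close>, \<open>a = 0\<close>,
  \<open>b = 1\<close>, where \<open>v\<close> is \<open>\<sigma> * s ^ p * t\<close>. This is the
  chart in which the multiplicity may fail to drop.\<close>

lemma ev_pderiv_toric:
  assumes "rhom h" "w \<le> toric_weight p 1 D"
  shows "s ^ w * ev h (pderiv (toric \<sigma> p 1 0 1 w D)) s t = h \<sigma> * s ^ p * ev h (pderiv D) s (h \<sigma> * (s ^ p * t))"
proof -
  note [simp] = rhomD[OF assms(1)] rhom_of_nat[OF assms(1)]
  have "s ^ w * ev h (pderiv (toric \<sigma> p 1 0 1 w D)) s t = (\<Sum>z\<in>mon_supp D. case z of (i, j) \<Rightarrow>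
        s ^ w * (of_nat j * (h \<sigma> ^ j * h (coeff (coeff D j) i)) * s ^ (i + p * j - w) * t ^ (j - 1)))"
    unfolding toric_def pderiv_sum rhom_sum[OF rhom_ev[OF assms(1)]] sum_distrib_left
    by (rule sum.cong) (auto simp: ev_monom[OF assms(1)] pderiv_monom of_nat_mult_monom)
  also have "\<dots> = (\<Sum>(i, j)\<in>mon_supp D. h \<sigma> * s ^ p * (of_nat j * h (coeff (coeff D j) i) * s ^ i * (h \<sigma> * (s ^ p * t)) ^ (j - 1)))"
  proof (intro sum.cong refl, clarify)
    fix i j assume "(i, j) \<in> mon_supp D"
    then have "w \<le> i + p * j" using toric_weight_le[of i j D p 1] assms(2) by auto
    then have *: "s ^ w * s ^ (i + p * j - w) = s ^ i * s ^ (p * j)"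
      by (simp flip: power_add)
    show "s ^ w * (of_nat j * (h \<sigma> ^ j * h (coeff (coeff D j) i)) * s ^ (i + p * j - w) * t ^ (j - 1))
      = h \<sigma> * s ^ p * (of_nat j * h (coeff (coeff D j) i) * s ^ i * (h \<sigma> * (s ^ p * t)) ^ (j - 1))"
    \<comment> \<open>At \<open>j = 0\<close> the exponent \<open>j - 1\<close> truncates, but the
      factor \<open>of_nat j\<close> makes both sides 0.\<close>
    proof (cases j)
      case (Suc n)
      have "s ^ w * (of_nat j * (h \<sigma> ^ j * h (coeff (coeff D j) i)) * s ^ (i + p * j - w) * t ^ (j - 1))
       = of_nat j * (h \<sigma> ^ j * h (coeff (coeff D j) i)) * (s ^ w * s ^ (i + p * j - w)) * t ^ (j - 1)"
        by (simp only: mult_ac)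
      then show ?thesis unfolding * by (simp add: Suc power_mult_distrib power_add mult_ac flip: power_mult)
    qed simp
  qed
  also have "\<dots> = h \<sigma> * s ^ p * ev h (pderiv D) s (h \<sigma> * (s ^ p * t))"
  proof -
    have "pderiv D = (\<Sum>(i, j)\<in>mon_supp D. pderiv (monom (monom (coeff (coeff D j) i) i) j))"
      by (subst mon_supp_sum) (simp only: pderiv_sum case_prod_unfold)
    then show ?thesis
      by (simp add: rhom_sum[OF rhom_ev[OF assms(1)]] sum_distrib_left
        ev_monom[OF assms(1)] pderiv_monom of_nat_mult_monom case_prod_unfold)
  qed
  finally show ?thesis .
qed

lemma order_0_plus_order_le_degree:
  fixes S :: "real poly" assumes "S \<noteq> 0" "c \<noteq> 0"
  shows "order 0 S + order c S \<le> degree S"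
proof -
  obtain R where R: "S = [:-0, 1:] ^ order 0 S * R" using order_1 by (metis dvdE)
  have R0: "R \<noteq> 0" using R assms by force
  have "order c S = order c ([:-0, 1:] ^ order 0 S) + order c R"
    using R assms(1) order_mult by metis
  also have "order c ([:-0, 1:] ^ order 0 S) = 0"
    using assms(2) by (intro order_0I) simp
  also have "order c R \<le> degree R" using R0 by (rule order_degree)
  moreover have "degree S = order 0 S + degree R"
    using R R0 by (metis degree_linear_power degree_mult_eq mult_zero_left assms(1))
  ultimately show ?thesis by simp
qed

lemma coeff_order_0_nonzero:
  fixes S :: "real poly" assumes "S \<noteq> 0" shows "coeff S (order 0 S) \<noteq> 0"
proof -
  obtain R where R: "S = [:-0, 1:] ^ order 0 S * R" "\<not> [:-0, 1:] dvd R"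
    using order_decomp[OF assms] by blast
  have "[:-0, 1:] ^ order 0 S = monom (1::real) (order 0 S)"
    by (simp add: monom_altdef)
  then have "coeff S (order 0 S) = coeff R 0"
    by (subst R(1)) (simp add: coeff_monom_mult)
  then show ?thesis using R(2) poly_eq_0_iff_dvd[of R 0] by (simp add: poly_0_coeff_0)
qed

text \<open>The exponents occurring in \<open>S\<close> run from its order at 0 to its degree, and a
  nonzero root of multiplicity \<open>m\<close> needs a spread of at least \<open>m\<close>.\<close>

lemma order_nonzero_root_bound:
  fixes S :: "real poly"
  assumes "S \<noteq> 0" "c \<noteq> 0" "\<And>n. coeff S n \<noteq> 0 \<Longrightarrow> A \<le> q * n \<and> q * n \<le> A + \<mu>"
  shows "q * order c S \<le> \<mu>"
proof -
  have "A \<le> q * order 0 S" using assms coeff_order_0_nonzero by blast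
  moreover have "q * degree S \<le> A + \<mu>" using assms(1,3) by simp
  moreover have "q * (order 0 S + order c S) \<le> q * degree S"
    using order_0_plus_order_le_degree assms(1,2) by simp
  ultimately show ?thesis by (simp add: algebra_simps)
qed

text \<open>Along a Newton edge the exponents of the initial form lie in an interval of length
  at most \<open>\<mu> / q\<close>, so a ramified step (\<open>q > 1\<close>) lowers the multiplicity.\<close>

lemma slice_toric:
  fixes D :: "real poly poly"
  assumes bq: "b * q = p * a + 1" and p: "p > 0" and \<sigma>: "\<sigma> \<noteq> 0"
    and D0: "slice 0 D \<noteq> 0"
  defines "\<mu> \<equiv> order 0 (slice 0 D)" and "w \<equiv> toric_weight p q D"
  defines "S \<equiv> slice 0 (toric \<sigma> p q a b w D)"
  shows "S \<noteq> 0" and "\<And>n. coeff S n \<noteq> 0 \<Longrightarrow> a * w \<le> q * n \<and> q * n \<le> a * w + \<mu>"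
    and "\<And>n. coeff S n \<noteq> 0 \<Longrightarrow> \<exists>i j. q * i + p * j = w \<and> n = a * i + b * j"
proof -
  have q: "q > 0" using bq by (intro gr0I) simp
  define T where "T = {(i, j) \<in> mon_supp D. q * i + p * j = w}"
  let ?c = "\<lambda>i j. \<sigma> ^ j * coeff (coeff D j) i"
  have fT: "finite T" unfolding T_def by (rule finite_subset[OF _ finite_mon_supp]) auto
  have "S = (\<Sum>(i, j)\<in>mon_supp D. monom (if q * i + p * j = w then ?c i j else 0) (a * i + b * j))"
    unfolding S_def toric_def rhom_sum[OF rhom_slice]
  proof (intro sum.cong refl, clarify)
    fix i j assume "(i, j) \<in> mon_supp D"
    then have "w \<le> q * i + p * j" unfolding w_def by (rule toric_weight_le)
    then show "slice 0 (monom (monom (?c i j) (q * i + p * j - w)) (a * i + b * j))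
       = monom (if q * i + p * j = w then ?c i j else 0) (a * i + b * j)"
      by (auto simp: slice_def map_poly_monom poly_monom zero_power)
  qed
  also have "\<dots> = (\<Sum>(i, j)\<in>T. monom (?c i j) (a * i + b * j))"
    by (rule sum.mono_neutral_cong_right) (auto simp: finite_mon_supp T_def split: if_splits)
  finally have S: "S = (\<Sum>(i, j)\<in>T. monom (?c i j) (a * i + b * j))" .
  \<comment> \<open>On the edge, \<open>b * q = p * a + 1\<close> turns \<open>q\<close> times the
    exponent of \<open>t\<close> into \<open>a * w + j\<close>. This exponent determines
    \<open>j\<close> and then \<open>i\<close>, so no two edge monomials merge.\<close>
  have qn: "q * (a * i + b * j) = a * w + j" if "(i, j) \<in> T" for i j
  proof -
    have "w = q * i + p * j" using that by (simp add: T_def)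
    moreover have "q * (b * j) = (p * a + 1) * j" using bq by (metis mult.assoc mult.commute)
    ultimately show ?thesis by (simp add: algebra_simps)
  qed
  have inj: "(i, j) = (i', j')" if "(i, j) \<in> T" "(i', j') \<in> T" "a * i + b * j = a * i' + b * j'" for i j i' j'
  proof -
    have "j = j'" using qn[OF that(1)] qn[OF that(2)] that(3) by simp
    moreover have "q * i + p * j = q * i' + p * j'" using that by (simp add: T_def)
    ultimately show ?thesis using q by simp
  qed
  have coeffS: "coeff S (a * i + b * j) = ?c i j" if "(i, j) \<in> T" for i j
  proof -
    have "coeff S (a * i + b * j) = (\<Sum>z\<in>T. if z = (i, j) then ?c i j else 0)"
      unfolding S coeff_sum using inj that
      by (intro sum.cong refl) (auto simp: coeff_monom split: if_splits)
    then show ?thesis using that fT by simp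
  qed
  have ne: "mon_supp D \<noteq> {}"
  proof
    assume "mon_supp D = {}"
    then have "D = 0" using mon_supp_sum[of D] by simp
    then show False using D0 by (simp add: slice_def)
  qed
  then have "w \<in> (\<lambda>(i, j). q * i + p * j) ` mon_supp D"
    unfolding w_def toric_weight_def by (intro Min_in) (auto simp: finite_mon_supp)
  then obtain z where "z \<in> mon_supp D" "w = (case z of (i, j) \<Rightarrow> q * i + p * j)" by blast
  then obtain i j where "(i, j) \<in> mon_supp D" "w = q * i + p * j" by (cases z) simp
  then have ij: "(i, j) \<in> T" by (simp add: T_def)
  then show "S \<noteq> 0" using coeffS[OF ij] \<sigma> by (auto simp: T_def mon_supp_def)
  have ex: "\<exists>i j. (i, j) \<in> T \<and> n = a * i + b * j" if "coeff S n \<noteq> 0" for n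
  proof (rule ccontr)
    assume a: "\<not> ?thesis"
    have "coeff (case z of (i, j) \<Rightarrow> monom (?c i j) (a * i + b * j)) n = 0" if "z \<in> T" for z
      using a that by (cases z) (auto simp only: coeff_monom prod.case split: if_splits)
    then have "coeff S n = 0" unfolding S coeff_sum by (intro sum.neutral) blast
    then show False using that by simp
  qed
  show "\<exists>i j. q * i + p * j = w \<and> n = a * i + b * j" if n: "coeff S n \<noteq> 0" for n
  proof -
    obtain i j where "(i, j) \<in> T" "n = a * i + b * j" using ex[OF n] by blast
    then show ?thesis by (intro exI[of _ i] exI[of _ j]) (simp add: T_def)
  qed
  \<comment> \<open>This support point gives \<open>w \<le> p * \<mu>\<close>, so every edge point
    has \<open>j \<le> \<mu>\<close>.\<close>
  have "(0, \<mu>) \<in> mon_supp D"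
    using coeff_order_0_nonzero[OF D0] by (simp add: mon_supp_def \<mu>_def coeff_slice poly_0_coeff_0)
  then have w: "w \<le> p * \<mu>" using toric_weight_le[of 0 \<mu> D p q] by (simp add: w_def)
  show "a * w \<le> q * n \<and> q * n \<le> a * w + \<mu>" if n: "coeff S n \<noteq> 0" for n
  proof -
    obtain i j where ij: "(i, j) \<in> T" "n = a * i + b * j" using ex[OF n] by blast
    then have "q * i + p * j = w" by (simp add: T_def)
    then have "p * j \<le> p * \<mu>" using w by linarith
    then have "j \<le> \<mu>" using p by simp
    then show ?thesis using qn[OF ij(1)] ij(2) by simp
  qed
qed

section \<open>Branches of plane curves\<close>

text \<open>Bezout's identity over the rational functions in the first variable, with denominators
  cleared: a nonzero combination \<open>e\<close> of least degree divides every combination up to a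
  factor free of the second variable, since a pseudo-remainder is again a combination.\<close>

lemma prime_bezout:
  fixes D p :: "real poly poly"
  assumes D: "prime_elem D" and nd: "\<not> D dvd p"
  shows "\<exists>\<alpha> \<beta> a. a \<noteq> 0 \<and> \<alpha> * p + \<beta> * D = [:a:]"
proof -
  define J where "J = {e. e \<noteq> 0 \<and> (\<exists>\<alpha> \<beta>. e = \<alpha> * p + \<beta> * D)}"
  have D0: "D \<noteq> 0" using D by auto
  have "D = 0 * p + 1 * D" by simp
  then have "D \<in> J" using D0 unfolding J_def by blast
  then obtain e where e: "e \<in> J" and min: "\<And>e'. e' \<in> J \<Longrightarrow> degree e \<le> degree e'"
    using ex_has_least_nat[of "\<lambda>e. e \<in> J" D degree] by blast
  then have e0: "e \<noteq> 0" by (simp add: J_def)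
  obtain \<alpha> \<beta> where \<alpha>\<beta>: "e = \<alpha> * p + \<beta> * D" using e by (auto simp: J_def)
  have div: "\<exists>c Q. c \<noteq> 0 \<and> [:c:] * f = e * Q" if f: "f = \<alpha>' * p + \<beta>' * D" for f \<alpha>' \<beta>'
  proof -
    obtain c Q where c: "c \<noteq> 0" "smult c f = e * Q + pseudo_mod f e" using pseudo_mod(1)[OF e0] by blast
    have "pseudo_mod f e = [:c:] * f - e * Q" using c by simp
    also have "\<dots> = ([:c:] * \<alpha>' - \<alpha> * Q) * p + ([:c:] * \<beta>' - \<beta> * Q) * D"
      unfolding f \<alpha>\<beta> by (simp add: algebra_simps)
    finally have "pseudo_mod f e = 0"
      using min[of "pseudo_mod f e"] pseudo_mod(2)[OF e0, of f] unfolding J_def by fastforce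
    then show ?thesis using c by auto
  qed
  \<comment> \<open>If \<open>e\<close> had positive degree, \<open>[:c:] * D = e * Q\<close> would
    prevent \<open>D\<close> from dividing \<open>Q\<close>. Then \<open>D\<close> divides
    \<open>e\<close>, hence \<open>[:c':]\<close>, so \<open>D\<close> and with it \<open>e\<close>
    would have degree 0.\<close>
  have "degree e = 0"
  proof (rule ccontr)
    assume de: "degree e \<noteq> 0"
    obtain c Q where c: "c \<noteq> 0" "[:c:] * D = e * Q" using div[of D 0 1] by auto
    obtain c' Q' where c': "c' \<noteq> 0" "[:c':] * p = e * Q'" using div[of p 1 0] by auto
    have "\<not> D dvd Q"
    proof
      assume "D dvd Q"
      then obtain R where "Q = D * R" by blast
      then have "D * [:c:] = D * (e * R)" using c(2) by (simp add: mult_ac)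
      then have eR: "[:c:] = e * R" using D0 mult_left_cancel by blast
      then have "R \<noteq> 0" using c(1) by auto
      then have "degree [:c:] = degree e + degree R" using eR e0 degree_mult_eq by metis
      then show False using de by simp
    qed
    moreover have "D dvd e * Q" using c(2) by (metis dvd_triv_right)
    ultimately have "D dvd e" using D prime_elem_dvd_multD by blast
    then have "D dvd [:c':] * p" using c'(2) by simp
    then have "D dvd [:c':]" using D nd prime_elem_dvd_multD by blast
    then have "degree D = 0" using c'(1) dvd_imp_degree_le[of D "[:c':]"] by simp
    then have "degree (e * Q) = 0" using degree_mult_le[of "[:c:]" D] by (simp flip: c(2))
    moreover have "e * Q \<noteq> 0" using c(1) D0 by (simp flip: c(2))
    then have "degree (e * Q) = degree e + degree Q" by (intro degree_mult_eq) auto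
    ultimately show False using de by simp
  qed
  then obtain a where a: "e = [:a:]" using degree_eq_zeroE by blast
  then have "\<alpha> * p + \<beta> * D = [:a:]" "a \<noteq> 0" using \<alpha>\<beta> e0 by auto
  then show ?thesis by blast
qed

text \<open>The Bezout identity confines the first coordinate to the roots of \<open>a\<close>. A
  vertical line carries finitely many common zeros unless both slices vanish; but then
  \<open>D\<close> would be associated to the equation of that line and divide
  \<open>p\<close>.\<close>

lemma finite_common_zeros:
  assumes D: "prime_elem D" and nd: "\<not> D dvd p"
  shows "finite {(x, y). pe D x y = 0 \<and> pe p x y = 0}"
proof -
  obtain \<alpha> \<beta> a where a: "a \<noteq> 0" "\<alpha> * p + \<beta> * D = [:a:]" using prime_bezout[OF assms] by blast
  define Y where "Y x = {y. pe D x y = 0 \<and> pe p x y = 0}" for x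
  have fin: "finite (Y x)" for x
  proof (cases "slice x D = 0 \<and> slice x p = 0")
    case True
    let ?L = "[:[:-x, 1:]:] :: real poly poly"
    have L: "?L dvd D" "?L dvd p" using True slice_eq_0_iff by auto
    have nu: "\<not> is_unit ?L"
      unfolding is_unit_const_poly_iff using dvd_imp_degree_le[of "[:-x, 1:]" 1] by auto
    obtain E where E: "D = ?L * E" using L(1) by blast
    then have "is_unit E" using irreducibleD[OF prime_elem_imp_irreducible[OF D]] nu by blast
    then have "D dvd ?L" unfolding E by (simp only: mult_unit_dvd_iff dvd_refl)
    then show ?thesis using L(2) nd dvd_trans by blast
  next
    case False
    then consider "slice x D \<noteq> 0" | "slice x p \<noteq> 0" by blast
    then show ?thesis
    proof cases
      case 1
      show ?thesis by (rule finite_subset[OF _ poly_roots_finite[OF 1]]) (auto simp: Y_def pe_slice)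
    next
      case 2
      show ?thesis by (rule finite_subset[OF _ poly_roots_finite[OF 2]]) (auto simp: Y_def pe_slice)
    qed
  qed
  have "poly a x = 0" if "pe D x y = 0" "pe p x y = 0" for x y
  proof -
    have "pe (\<alpha> * p + \<beta> * D) x y = 0" using that by (simp add: ev_simps[OF rhom_id])
    then show ?thesis unfolding a(2) by (simp add: ev_inner rhom_id)
  qed
  then have "{(x, y). pe D x y = 0 \<and> pe p x y = 0} \<subseteq> (\<Union>x\<in>{x. poly a x = 0}. {x} \<times> Y x)"
    by (auto simp: Y_def)
  then show ?thesis by (rule finite_subset) (auto intro!: finite_UN_I poly_roots_finite a fin)
qed

definition branch_set :: "real poly poly \<Rightarrow> real \<Rightarrow> (real \<times> real) set" where
  "branch_set D \<delta> = {(a, b). 0 < a \<and> a < \<delta> \<and> \<bar>b\<bar> < \<delta> \<and> pe D a b = 0}"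

text \<open>Uncountability at every scale, instead of a parametrized arc: it passes through
  injective chart maps and survives the removal of countable exceptional sets.\<close>

definition has_branch :: "real poly poly \<Rightarrow> bool" where
  "has_branch D \<longleftrightarrow> (\<forall>\<delta>>0. uncountable (branch_set D \<delta>))"

lemma uncountable_if_interval_image:
  assumes "0 < e" "{0<..<e::real} \<subseteq> f ` S" shows "uncountable S"
proof
  assume "countable S"
  then have "countable {0<..<e}" using countable_subset[OF assms(2)] by simp
  then show False using assms(1) uncountable_open_interval[of 0 e] by simp
qed

lemma has_branch_dvd: assumes "has_branch F" "F dvd D" shows "has_branch D"
proof -
  have "branch_set F \<delta> \<subseteq> branch_set D \<delta>" for \<delta>
    using assms(2) by (auto simp: branch_set_def ev_simps[OF rhom_id] elim!: dvdE)
  then show ?thesis using assms(1) unfolding has_branch_def by (meson countable_subset)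
qed

text \<open>At a simple root the slice over 0 changes sign. The sign change persists on nearby
  vertical lines, and the intermediate value theorem gives a zero on each of them.\<close>

lemma simple_root_has_branch:
  assumes "slice 0 D \<noteq> 0" "order 0 (slice 0 D) = 1"
  shows "has_branch D"
  unfolding has_branch_def
proof (intro allI impI)
  fix \<delta> :: real assume \<delta>: "0 < \<delta>"
  obtain R where R: "slice 0 D = [:-0, 1:] ^ 1 * R" "\<not> [:-0, 1:] dvd R"
    using order_decomp[OF assms(1), of 0] assms(2) by auto
  have R0: "poly R 0 \<noteq> 0" using R(2) poly_eq_0_iff_dvd[of R 0] by simp
  have "isCont (\<lambda>b. poly R b * poly R 0) 0" by simp
  then have "(\<lambda>b. poly R b * poly R 0) \<midarrow>0\<rightarrow> poly R 0 * poly R 0" by (simp only: isCont_def)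
  moreover have "0 < poly R 0 * poly R 0" using R0 by (simp add: zero_less_mult_iff) linarith
  ultimately obtain \<eta> where \<eta>: "\<eta> > 0" "\<And>b. b \<noteq> 0 \<Longrightarrow> \<bar>b\<bar> < \<eta> \<Longrightarrow> 0 < poly R b * poly R 0"
    using LIM_fun_gt_zero[of "\<lambda>b. poly R b * poly R 0" "poly R 0 * poly R 0" 0] by auto
  define b where "b = min \<eta> \<delta> / 2"
  have b: "0 < b" "b < \<eta>" "b < \<delta>" using \<eta> \<delta> by (auto simp: b_def)
  have R1: "0 < poly R b * poly R (- b)"
    using \<eta>(2)[of b] \<eta>(2)[of "- b"] b by (auto simp: zero_less_mult_iff)
  have "pe D 0 b * pe D 0 (- b) = - (b * b * (poly R b * poly R (- b)))" by (simp add: pe_slice R)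
  also have "\<dots> < 0" using b R1 by simp
  finally have neg: "pe D 0 b * pe D 0 (- b) < 0" .
  have "isCont (\<lambda>a. pe D a b * pe D a (- b)) 0" by (intro continuous_intros isCont_pe)
  then have "(\<lambda>a. pe D a b * pe D a (- b)) \<midarrow>0\<rightarrow> pe D 0 b * pe D 0 (- b)" by (simp only: isCont_def)
  from LIM_fun_less_zero[OF this neg] obtain e where
    e: "e > 0" "\<And>a. a \<noteq> 0 \<Longrightarrow> \<bar>a\<bar> < e \<Longrightarrow> pe D a b * pe D a (- b) < 0" by auto
  have "{0<..<min e \<delta>} \<subseteq> fst ` branch_set D \<delta>"
  proof
    fix a assume a: "a \<in> {0<..<min e \<delta>}"
    then have "poly (slice a D) (- b) * poly (slice a D) b < 0"
      using e(2)[of a] by (simp add: pe_slice mult.commute)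
    then obtain y where "- b < y" "y < b" "poly (slice a D) y = 0" using poly_IVT[of "- b" b] b by auto
    then have "(a, y) \<in> branch_set D \<delta>" using a b by (auto simp: branch_set_def pe_slice)
    then show "a \<in> fst ` branch_set D \<delta>" by force
  qed
  then show "uncountable (branch_set D \<delta>)" using uncountable_if_interval_image[of "min e \<delta>"] e \<delta> by simp
qed

definition shift :: "real \<Rightarrow> real poly poly \<Rightarrow> real poly poly" where
  "shift c D = pcompose D [:[:c:], 1:]"

lemma ev_pcompose: "rhom h \<Longrightarrow> ev h (pcompose D q) u v = ev h D u (ev h q u v)"
  by (induction D) (simp_all add: ev_zero pcompose_pCons ev_simps ev_pCons ev_inner)

lemma ev_shift: "rhom h \<Longrightarrow> ev h (shift c D) u v = ev h D u (h c + v)"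
  by (simp add: shift_def ev_pcompose ev_pCons ev_zero map_poly_pCons rhomD)

lemma pderiv_shift: "pderiv (shift c D) = shift c (pderiv D)"
  by (simp add: shift_def pderiv_pcompose pderiv_pCons)

lemma slice_shift: "slice x (shift c D) = pcompose (slice x D) [:c, 1:]"
proof -
  have "poly (slice x (shift c D)) = poly (pcompose (slice x D) [:c, 1:])"
    by (rule ext) (simp add: ev_shift rhom_id poly_pcompose flip: pe_slice)
  then show ?thesis by (simp add: poly_eq_poly_eq_iff)
qed

lemma order_0_pcompose_shift:
  fixes S :: "real poly" assumes "S \<noteq> 0"
  shows "pcompose S [:c, 1:] \<noteq> 0" "order 0 (pcompose S [:c, 1:]) = order c S"
proof -
  show nz: "pcompose S [:c, 1:] \<noteq> 0" using assms by (simp add: pcompose_eq_0_iff)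
  obtain R where R: "S = [:-c, 1:] ^ order c S * R" "\<not> [:-c, 1:] dvd R"
    using order_decomp[OF assms] by blast
  have "poly S (c + y) = y ^ order c S * poly R (c + y)" for y
    using arg_cong[OF R(1), of "\<lambda>p. poly p (c + y)"] by simp
  then have "poly (pcompose S [:c, 1:]) = poly ([:-0, 1:] ^ order c S * pcompose R [:c, 1:])"
    by (intro ext) (simp add: poly_pcompose)
  then have "pcompose S [:c, 1:] = [:-0, 1:] ^ order c S * pcompose R [:c, 1:]"
    by (simp only: poly_eq_poly_eq_iff)
  moreover have "poly (pcompose R [:c, 1:]) 0 \<noteq> 0"
    using R(2) by (simp add: poly_pcompose poly_eq_0_iff_dvd)
  ultimately show "order 0 (pcompose S [:c, 1:]) = order c S"
    using nz order_power_n_n[of "0::real" "order c S"] order_mult[of "[:-0, 1:] ^ order c S" "pcompose R [:c, 1:]" 0]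
    by (simp add: order_power_n_n order_0I)
qed

text \<open>The chart map is injective on positive coordinates because its exponent matrix has
  determinant 1, so uncountably many zeros near \<open>(0, c)\<close> yield uncountably many near
  the origin.\<close>

lemma toric_has_branch:
  assumes bq: "b * q = p * a + 1" and p: "p > 0" and c: "c > 0" and \<sigma>: "\<bar>\<sigma>\<bar> = 1"
    and w: "w \<le> toric_weight p q D" and br: "has_branch (shift c (toric \<sigma> p q a b w D))"
  shows "has_branch D"
  unfolding has_branch_def
proof (intro allI impI)
  fix \<delta> :: real assume \<delta>: "0 < \<delta>"
  have q: "q > 0" using bq by (intro gr0I) simp
  define K where "K = (2 * c + 1) ^ (a + b)"
  have K1: "1 \<le> K" using c by (simp add: K_def)
  \<comment> \<open>\<open>c / 2\<close> keeps \<open>c + t\<close> positive, 1 gives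
    \<open>s ^ k \<le> s\<close> for positive \<open>k\<close>, and \<open>\<delta> / K\<close>
    absorbs the bound \<open>K\<close> for the powers of \<open>c + t\<close>.\<close>
  define \<delta>' where "\<delta>' = min (c / 2) (min 1 (\<delta> / K))"
  have "0 < \<delta>'" using c \<delta> K1 by (simp add: \<delta>'_def)
  moreover have "\<delta>' \<le> c / 2" unfolding \<delta>'_def by (rule min.cobounded1)
  moreover have "\<delta>' \<le> min 1 (\<delta> / K)" unfolding \<delta>'_def by (rule min.cobounded2)
  ultimately have \<delta>': "0 < \<delta>'" "\<delta>' \<le> c / 2" "\<delta>' \<le> 1" "\<delta>' \<le> \<delta> / K" by simp_all
  define W where "W = branch_set (shift c (toric \<sigma> p q a b w D)) \<delta>'"
  define F where "F = (\<lambda>(s, t). (s ^ q * (c + t) ^ a, \<sigma> * (s ^ p * (c + t) ^ b)))"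
  have unc: "uncountable W" using br \<delta>'(1) by (auto simp: has_branch_def W_def)
  have pos: "0 < s" "0 < c + t" if "(s, t) \<in> W" for s t
    using that \<delta>' c by (auto simp: W_def branch_set_def)
  have inj: "inj_on F W"
  proof (rule inj_onI, clarify)
    fix s t s' t' assume W: "(s, t) \<in> W" "(s', t') \<in> W" and eq: "F (s, t) = F (s', t')"
    define T where "T = c + t" define T' where "T' = c + t'"
    define U where "U = s ^ q * T ^ a" define V where "V = s ^ p * T ^ b"
    have P: "0 < s" "0 < T" "0 < s'" "0 < T'" using pos W by (auto simp: T_def T'_def)
    have U': "U = s' ^ q * T' ^ a" and V': "V = s' ^ p * T' ^ b"
      using eq \<sigma> by (auto simp: F_def U_def V_def T_def T'_def)
    have UV: "0 < U" "0 < V" using P by (auto simp: U_def V_def)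
    \<comment> \<open>The inverse of the chart map without division: \<open>T\<close> is recovered
      as \<open>V ^ q / U ^ p\<close> and \<open>s\<close> as \<open>U ^ b / V ^ a\<close>.\<close>
    have A: "(x ^ p * y ^ b) ^ q = (x ^ q * y ^ a) ^ p * y" "(x ^ q * y ^ a) ^ b = (x ^ p * y ^ b) ^ a * x" for x y :: real
    proof -
      have "y ^ (b * q) = y ^ (p * a) * y" "x ^ (b * q) = x ^ (p * a) * x"
        by (simp_all only: bq power_add power_one_right)
      then show "(x ^ p * y ^ b) ^ q = (x ^ q * y ^ a) ^ p * y" "(x ^ q * y ^ a) ^ b = (x ^ p * y ^ b) ^ a * x"
        by (simp_all add: power_mult_distrib mult_ac flip: power_mult)
    qed
    have "V ^ q = U ^ p * T" "U ^ b = V ^ a * s" unfolding U_def V_def by (rule A)+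
    moreover have "V ^ q = U ^ p * T'" "U ^ b = V ^ a * s'" unfolding U' V' by (rule A)+
    ultimately have UT: "U ^ p * T = U ^ p * T'" "V ^ a * s = V ^ a * s'" by metis+
    from UT(1) have "T = T'" using UV by simp
    moreover from UT(2) have "s = s'" using UV by simp
    ultimately show "s = s' \<and> t = t'" by (simp add: T_def T'_def)
  qed
  have "F (s, t) \<in> branch_set D \<delta>" if st: "(s, t) \<in> W" for s t
  proof -
    define T where "T = c + t"
    have P: "0 < s" "0 < T" using pos st by (auto simp: T_def)
    have s1: "s < \<delta>'" and t1: "\<bar>t\<bar> < \<delta>'" and z: "pe (toric \<sigma> p q a b w D) s T = 0"
      using st by (auto simp: W_def branch_set_def ev_shift rhom_id T_def)
    have T2: "T \<le> 2 * c + 1" using t1 \<delta>' c by (auto simp: T_def)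
    have Tk: "T ^ k \<le> K" if "k \<le> a + b" for k
    proof -
      have "T ^ k \<le> (2 * c + 1) ^ k" using T2 P by (intro power_mono) auto
      also have "\<dots> \<le> K" unfolding K_def using that c by (intro power_increasing) auto
      finally show ?thesis .
    qed
    have sk: "s ^ k * T ^ j < \<delta>" if "k > 0" "j \<le> a + b" for k j
    proof -
      have "s ^ k \<le> s ^ 1" using P s1 \<delta>' that by (intro power_decreasing) auto
      then have "s ^ k * T ^ j \<le> s * K" using P Tk[OF that(2)] by (intro mult_mono) auto
      also have "\<dots> < \<delta>' * K" using s1 K1 by simp
      also have "\<dots> \<le> \<delta>" using \<delta>'(4) K1 by (simp add: field_simps)
      finally show ?thesis .
    qed
    have "pe D (s ^ q * T ^ a) (\<sigma> * (s ^ p * T ^ b)) = 0"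
      using ev_toric[OF rhom_id w, of s \<sigma> a b T] z by simp
    moreover have "\<bar>\<sigma> * (s ^ p * T ^ b)\<bar> = s ^ p * T ^ b" using P \<sigma> by (simp add: abs_mult)
    ultimately show ?thesis
      using sk[OF q, of a] sk[OF p, of b] P by (simp add: F_def branch_set_def flip: T_def)
  qed
  then have "F ` W \<subseteq> branch_set D \<delta>" by auto
  then show "uncountable (branch_set D \<delta>)"
    using unc countable_image_inj_on[OF _ inj] countable_subset[of "F ` W"] by auto
qed

lemma pderiv_slice: "slice x (pderiv D) = pderiv (slice x D)"
  by (rule poly_eqI) (simp add: coeff_slice coeff_pderiv)

lemma coeff_less_order_0:
  fixes S :: "real poly"
  assumes "n < order 0 S" shows "coeff S n = 0"
proof -
  have "[:-0, 1:] ^ order 0 S dvd S" by (rule order_1)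
  then have "monom 1 (order 0 S) dvd S" by (simp add: monom_altdef)
  then show ?thesis using assms by (simp add: monom_1_dvd_iff')
qed

section \<open>Newton-Puiseux descent in an ordered extension\<close>

context ordered_real_ext begin

lemma newton_tie_abs:
  assumes D: "D \<noteq> 0" "ev \<iota> D u v = 0" and u: "near u 0" "0 < u" and v: "near v 0" "v \<noteq> 0"
  shows "\<exists>p q r. p > 0 \<and> q > 0 \<and> coprime p q \<and> r > 0 \<and> near (\<bar>v\<bar> ^ q / u ^ p) r"
proof (cases "v > 0")
  case True then show ?thesis using newton_tie[OF D u v(1)] by simp
next
  case False
  have "ev \<iota> (pcompose D [:0, -1:]) u (- v) = 0"
    using D(2) by (simp add: ev_pcompose[OF hom] ev_pCons[OF hom] ev_zero[OF hom] ev_simps[OF hom] iota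
        map_poly_pCons rhomD[OF rhom_map_poly[OF hom]])
  moreover have "pcompose D [:0, -1:] \<noteq> 0" using D(1) by (simp add: pcompose_eq_0_iff)
  moreover have "near (- v) 0" using near_minus[OF v(1)] by simp
  ultimately show ?thesis using newton_tie[of "pcompose D [:0, -1:]" u "- v"] u v(2) False by simp
qed

text \<open>For \<open>q = 1\<close> the choice \<open>a = 0\<close>, \<open>b = 1\<close> is
  prescribed, so that the chart keeps the first coordinate.\<close>

lemma bezout_exponents:
  fixes p q :: nat
  assumes "p > 0" "q > 0" "coprime p q"
  shows "\<exists>a b. b * q = p * a + 1 \<and> (q = 1 \<longrightarrow> a = 0 \<and> b = 1)"
proof (cases "q = 1")
  case False
  obtain x y where "q * x = p * y + gcd q p" using bezout_nat[of q p] assms by auto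
  then have "x * q = p * y + 1" using assms by (simp add: coprime_iff_gcd_eq_1 gcd.commute mult.commute)
  then show ?thesis using False by blast
qed auto

lemma prime_factor_vanishing:
  fixes D :: "real poly poly"
  assumes "D \<noteq> 0" "ev \<iota> D u v = 0"
  shows "\<exists>F. prime_elem F \<and> F dvd D \<and> ev \<iota> F u v = 0"
proof -
  obtain A where A: "\<And>x. x \<in># A \<Longrightarrow> prime_elem x" "normalize (prod_mset A) = normalize D"
    using prime_factorization_exists[OF assms(1)] by blast
  have "D dvd prod_mset A" "prod_mset A dvd D" using A(2) by (metis associatedD1, metis associatedD2)
  then obtain k where "prod_mset A = D * k" by blast
  then have "ev \<iota> (prod_mset A) u v = 0" using assms(2) by (simp add: ev_simps[OF hom])
  moreover have "\<exists>F. F \<in># B \<and> ev \<iota> F u v = 0" if "ev \<iota> (prod_mset B) u v = 0" for B :: "real poly poly multiset"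
    using that by (induction B rule: multiset_induct) (auto simp: ev_simps[OF hom])
  ultimately obtain F where F: "F \<in># A" "ev \<iota> F u v = 0" by blast
  then have "F dvd D" using dvd_prod_mset[of F A] dvd_trans[OF _ \<open>prod_mset A dvd D\<close>] by simp
  then show ?thesis using F A(1) by blast
qed

text \<open>A prime \<open>F\<close> involving the second variable and its derivative satisfy a
  Bezout identity whose right side \<open>a\<close> is free of that variable. At the zero it reads
  \<open>A * z = a(u)\<close> with \<open>A\<close> finite, and \<open>a(u)\<close> has the size of
  some \<open>u ^ k\<close>.\<close>

lemma derivative_lower_bound:
  assumes F: "prime_elem F" "ev \<iota> F u v = 0" and u: "near u 0" "0 < u" and v: "near v r"
  shows "\<exists>E. u ^ E \<le> \<bar>ev \<iota> (pderiv F) u v\<bar>"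
proof -
  have "degree F \<noteq> 0"
  proof
    assume "degree F = 0"
    then obtain f where f: "F = [:f:]" by (rule degree_eq_zeroE)
    then have "f \<noteq> 0" using F(1) by auto
    then show False using F(2) poly_infinitesimal_nonzero[of f u] u by (simp add: f ev_inner[OF hom])
  qed
  then have "pderiv F \<noteq> 0" "degree (pderiv F) < degree F" by (auto simp: pderiv_eq_0_iff degree_pderiv)
  then have "\<not> F dvd pderiv F" using dvd_imp_degree_le by fastforce
  then obtain \<alpha> \<beta> a where a: "a \<noteq> 0" "\<alpha> * pderiv F + \<beta> * F = [:a:]" using prime_bezout[OF F(1)] by blast
  define A where "A = ev \<iota> \<alpha> u v" define z where "z = ev \<iota> (pderiv F) u v"
  have Az: "A * z = poly (map_poly \<iota> a) u"
    using arg_cong[OF a(2), of "\<lambda>p. ev \<iota> p u v"] F(2)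
    by (simp add: ev_simps[OF hom] ev_inner[OF hom] A_def z_def)
  obtain k w \<gamma> where g: "\<gamma> \<noteq> 0" "near w \<gamma>" "poly (map_poly \<iota> a) u = w * u ^ k"
    using poly_infinitesimal[OF a(1)] u(1) by blast
  obtain K where K: "K > 0" "\<bar>A\<bar> \<le> \<iota> K"
    using near_bound[OF near_ev[OF u(1) v], of \<alpha>] unfolding A_def
    by (metis abs_ge_zero add_nonneg_pos less_imp_le zero_less_one)
  \<comment> \<open>One more factor \<open>u\<close> swallows the real constants:
    \<open>\<iota> K * u\<close> is at most \<open>\<bar>w\<bar>\<close>. Hence the exponent
    \<open>Suc k\<close> in the result.\<close>
  have "near (inverse w * (\<iota> K * u)) (inverse \<gamma> * (K * 0))"
    using g u by (intro near_mult near_inverse near_iota)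
  then have "near (inverse w * (\<iota> K * u)) 0" by simp
  then have "\<bar>inverse w * (\<iota> K * u) - \<iota> 0\<bar> < \<iota> 1" unfolding near_def using zero_less_one by blast
  then have "\<bar>inverse w * (\<iota> K * u)\<bar> < \<iota> 1" by (simp add: iota)
  moreover have w0: "w \<noteq> 0" using near_nonzero g by blast
  moreover have "\<bar>\<iota> K * u\<bar> = \<iota> K * u" using iota_pos[OF K(1)] u(2) by simp
  ultimately have "\<iota> K * u \<le> \<bar>w\<bar>" by (simp add: abs_mult abs_inverse iota field_simps)
  then have "\<iota> K * u * u ^ k \<le> \<bar>w\<bar> * u ^ k" using u(2) by (intro mult_right_mono) auto
  also have "\<dots> = \<bar>A\<bar> * \<bar>z\<bar>" using arg_cong[OF trans[OF Az g(3)], of abs] u(2) by (simp add: abs_mult)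
  also have "\<dots> \<le> \<iota> K * \<bar>z\<bar>" using K(2) by (intro mult_right_mono) auto
  finally have "\<iota> K * u ^ Suc k \<le> \<iota> K * \<bar>z\<bar>" by (simp add: mult_ac)
  then have "u ^ Suc k \<le> \<bar>z\<bar>" using iota_pos[OF K(1)] by simp
  then show ?thesis unfolding z_def by blast
qed

text \<open>Newton-Puiseux descent, with the toric charts \<open>u = s^q t^a\<close>, \<open>v = s^p t^b\<close>,
  \<open>b q - p a = 1\<close> in place of roots of \<open>u\<close>: the outer induction is on the multiplicity
  of \<open>D(0, v)\<close>, the inner one on the order of \<open>D_v(u, v)\<close>.\<close>

lemma infinitesimal_zero_has_branch:
  assumes "near u 0" "0 < u" "near v 0" "ev \<iota> D u v = 0" "slice 0 D \<noteq> 0"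
  shows "has_branch D"
  using assms
proof (induction "order 0 (slice 0 D)" arbitrary: u v D rule: less_induct)
  case (less D u v)
  define \<mu> where "\<mu> = order 0 (slice 0 D)"
  have IH: "has_branch D'" if "near u' 0" "0 < u'" "near v' 0" "ev \<iota> D' u' v' = 0" "slice 0 D' \<noteq> 0"
    "order 0 (slice 0 D') < \<mu>" for u' v' D'
    using less.hyps[of D' u' v'] that by (simp add: \<mu>_def)
  have inner: "has_branch D" if u: "near u 0" "0 < u" and v: "near v 0" and D: "ev \<iota> D u v = 0" "slice 0 D \<noteq> 0"
      "order 0 (slice 0 D) = \<mu>" "u ^ E \<le> \<bar>ev \<iota> (pderiv D) u v\<bar>" for E u v D
    using that
  proof (induction E arbitrary: u v D)
    case (0 u v D)
    \<comment> \<open>For \<open>E = 0\<close> the derivative is at least 1 in absolute value, so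
      its standard part, the value at the origin, is nonzero and the root is simple.\<close>
    have "near (ev \<iota> (pderiv D) u v) (pe (pderiv D) 0 0)" using near_ev 0 by blast
    then have "pe (pderiv D) 0 0 \<noteq> 0"
      using 0(7) by (auto simp: near_def iota dest!: spec[of _ 1])
    then have "coeff (slice 0 D) 1 \<noteq> 0"
      by (simp add: pe_slice pderiv_slice poly_0_coeff_0 coeff_pderiv)
    then have "\<mu> \<le> 1" using coeff_less_order_0[of 1 "slice 0 D"] 0(6) by force
    moreover have "pe D 0 0 = 0" using near_ev[OF 0(1,3), of D] 0(4) near_unique near_0 by metis
    then have "\<mu> \<noteq> 0" using 0(5,6) order_root[of "slice 0 D" 0] by (simp add: pe_slice)
    ultimately show ?case using simple_root_has_branch 0(5,6) by simp
  next
    case (Suc E u v D)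
    note u = Suc.prems(1,2) and v = Suc.prems(3) and D = Suc.prems(4-7)
    have "pe D 0 0 = 0" using near_ev[OF u(1) v, of D] D(1) near_unique near_0 by metis
    then have \<mu>0: "\<mu> \<noteq> 0" using D(2,3) order_root[of "slice 0 D" 0] by (simp add: pe_slice)
    consider "\<mu> = 1" | "\<mu> \<ge> 2" "v = 0" | "\<mu> \<ge> 2" "v \<noteq> 0" using \<mu>0 by linarith
    then show ?case
    proof cases
      case 1 then show ?thesis using simple_root_has_branch D by simp
    next
      case 2
      \<comment> \<open>The coefficient of \<open>D\<close> free of the second variable vanishes at
        a positive infinitesimal, so it is the zero polynomial and the axis \<open>v = 0\<close>
        consists of zeros.\<close>
      have "poly (map_poly \<iota> (coeff D 0)) u = 0"
        using D(1) 2 by (cases D) (simp add: ev_pCons[OF hom])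
      then have c0: "coeff D 0 = 0" using poly_infinitesimal_nonzero u by blast
      have "pe D a 0 = 0" for a using c0 by (simp add: pe_slice poly_0_coeff_0 coeff_slice)
      then have "(x, 0) \<in> branch_set D \<delta>" if "0 < x" "x < \<delta>" for x \<delta>
        using that by (simp add: branch_set_def)
      then have "{0<..<\<delta>} \<subseteq> fst ` branch_set D \<delta>" for \<delta> by force
      then have "uncountable (branch_set D \<delta>)" if "\<delta> > 0" for \<delta>
        by (rule uncountable_if_interval_image[OF that])
      then show ?thesis by (simp add: has_branch_def)
    next
      case 3
      have Dnz: "D \<noteq> 0" using D(2) by (auto simp: slice_def)
      obtain p q c where pq: "p > 0" "q > 0" "coprime p q" and c: "c > 0" "near (\<bar>v\<bar> ^ q / u ^ p) c"
        using newton_tie_abs[OF Dnz D(1) u v 3(2)] by blast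
      obtain a b where bq: "b * q = p * a + 1" and q1: "q = 1 \<Longrightarrow> a = 0 \<and> b = 1"
        using bezout_exponents[OF pq] by blast
      define \<sigma> :: real where "\<sigma> = (if v > 0 then 1 else - 1)"
      have \<sigma>: "\<bar>\<sigma>\<bar> = 1" "\<sigma> \<noteq> 0" "\<iota> \<sigma> * \<bar>v\<bar> = v" "\<bar>\<iota> \<sigma>\<bar> = 1" by (auto simp: \<sigma>_def iota)
      define V where "V = \<bar>v\<bar>"
      have V: "V > 0" using 3 by (simp add: V_def)
      \<comment> \<open>\<open>t\<close> and \<open>s\<close> invert the chart at
        \<open>(u, \<bar>v\<bar>)\<close>. By the tie \<open>t\<close> has the nonzero standard part
        \<open>c\<close>, and \<open>s\<close> is infinitesimal because
        \<open>s ^ q * t ^ a = u\<close>.\<close>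
      define t where "t = V ^ q / u ^ p"
      define s where "s = u ^ b / V ^ a"
      have tp: "t > 0" and sp: "s > 0" using u V by (auto simp: t_def s_def)
      have pw: "x ^ (q * b) = x ^ (p * a) * x" for x :: 'a
        by (simp only: mult.commute[of q b] bq power_add power_one_right)
      have eu: "s ^ q * t ^ a = u"
      proof -
        have "s ^ q * t ^ a = u ^ (q * b) / u ^ (p * a)"
          using u V by (simp add: s_def t_def power_divide mult.commute flip: power_mult)
        then show ?thesis using u by (simp add: pw)
      qed
      have ev': "s ^ p * t ^ b = V"
      proof -
        have "s ^ p * t ^ b = V ^ (q * b) / V ^ (p * a)"
          using u V by (simp add: s_def t_def power_divide mult.commute flip: power_mult)
        then show ?thesis using V by (simp add: pw)
      qed
      have nt: "near t c" using c by (simp add: t_def V_def)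
      have "near (s ^ q * t ^ a * inverse (t ^ a)) (0 * inverse (c ^ a))"
        unfolding eu using c nt u by (intro near_mult near_inverse near_power) auto
      moreover have "s ^ q * t ^ a * inverse (t ^ a) = s ^ q" using tp by (simp add: field_simps)
      ultimately have "near (s ^ q) 0" by simp
      then have ns: "near s 0" by (simp only: near_0_power_iff[OF pq(2)])
      define w where "w = toric_weight p q D"
      define d1 where "d1 = toric \<sigma> p q a b w D"
      define d2 where "d2 = shift c d1"
      note st = slice_toric[OF bq pq(1) \<sigma>(2) D(2), folded w_def, folded d1_def, unfolded D(3)]
      have "s ^ w * ev \<iota> d1 s t = ev \<iota> D u v"
        using ev_toric[OF hom, of w p q D s \<sigma> a b t] \<sigma>(3) by (simp add: d1_def w_def eu ev' V_def)
      then have "ev \<iota> d1 s t = 0" using D(1) sp by simp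
      then have z2: "ev \<iota> d2 s (t - \<iota> c) = 0" by (simp add: d2_def ev_shift[OF hom])
      have n2: "near (t - \<iota> c) 0" using nt by (simp only: near_iff_diff[of t c])
      have nz2: "slice 0 d2 \<noteq> 0" and o2: "order 0 (slice 0 d2) = order c (slice 0 d1)"
        using order_0_pcompose_shift[OF st(1)] by (auto simp: d2_def slice_shift)
      have q\<nu>: "q * order 0 (slice 0 d2) \<le> \<mu>"
        unfolding o2 using c by (intro order_nonzero_root_bound[OF st(1) _ st(2)]) auto
      have "has_branch d2"
      proof (cases "order 0 (slice 0 d2) < \<mu>")
        case True
        then show ?thesis by (rule IH[OF ns sp n2 z2 nz2])
      next
        case False
        then have "q * \<mu> \<le> q * order 0 (slice 0 d2)" by simp
        from order_trans[OF this q\<nu>] have "q * \<mu> \<le> 1 * \<mu>" by (simp only: mult_1)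
        then have "q = 1" using \<mu>0 pq(2) by simp
        then have o\<mu>: "order 0 (slice 0 d2) = \<mu>" using False q\<nu> by simp
        have ab: "a = 0" "b = 1" using q1 \<open>q = 1\<close> by auto
        have su: "s = u" using eu \<open>q = 1\<close> ab by simp
        \<comment> \<open>The degree of the initial form is at least \<open>\<mu>\<close>, so the
          edge has a point with \<open>j \<ge> \<mu> \<ge> 2\<close>, whence
          \<open>w \<ge> 2 * p\<close>. By the chain rule the derivative loses the factor
          \<open>u ^ (w - p)\<close> with \<open>w - p \<ge> 1\<close>, and \<open>E\<close>
          drops.\<close>
        have "\<mu> \<le> degree (slice 0 d1)" using order_degree[OF st(1), of c] o\<mu> o2 by simp
        moreover obtain i j where "q * i + p * j = w" "degree (slice 0 d1) = a * i + b * j"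
          using st(3)[of "degree (slice 0 d1)"] st(1) by auto
        ultimately have "\<mu> \<le> j" "i + p * j = w" using ab \<open>q = 1\<close> by auto
        then have "p * \<mu> \<le> w" using mult_le_mono2[of \<mu> j p] by linarith
        then have "p * 2 \<le> w" using mult_le_mono2[OF 3(1), of p] by linarith
        then have wp: "w = p + (w - p)" "w - p \<ge> 1" using pq(1) by auto
        define z where "z = ev \<iota> (pderiv d1) s t"
        have "s ^ w * z = \<iota> \<sigma> * s ^ p * ev \<iota> (pderiv D) s (\<iota> \<sigma> * (s ^ p * t))"
          using ev_pderiv_toric[OF hom, of w p D s \<sigma> t] ab \<open>q = 1\<close> by (simp add: z_def d1_def w_def)
        also have "\<iota> \<sigma> * (s ^ p * t) = v" using ev' ab \<sigma>(3) by (simp add: V_def)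
        finally have "u ^ w * z = \<iota> \<sigma> * u ^ p * ev \<iota> (pderiv D) u v" unfolding su .
        then have "\<bar>u ^ w * z\<bar> = \<bar>\<iota> \<sigma> * u ^ p * ev \<iota> (pderiv D) u v\<bar>" by simp
        then have "u ^ w * \<bar>z\<bar> = u ^ p * \<bar>ev \<iota> (pderiv D) u v\<bar>"
          using u(2) \<sigma>(4) by (simp add: abs_mult)
        moreover have "u ^ w = u ^ p * u ^ (w - p)" by (subst wp(1)) (simp only: power_add)
        ultimately have "u ^ (w - p) * \<bar>z\<bar> = \<bar>ev \<iota> (pderiv D) u v\<bar>" using u(2) by simp
        then have "u ^ Suc E \<le> u ^ (w - p) * \<bar>z\<bar>" using D(4) by simp
        also have "\<dots> \<le> u ^ 1 * \<bar>z\<bar>"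
        proof -
          have "u < 1" using near_upper[OF u(1), of 1] by (simp add: iota)
          then show ?thesis using u(2) wp(2) by (intro mult_right_mono power_decreasing) auto
        qed
        finally have "u ^ E \<le> \<bar>z\<bar>" using u(2) by simp
        moreover have "ev \<iota> (pderiv d2) s (t - \<iota> c) = z"
          by (simp add: d2_def pderiv_shift ev_shift[OF hom] z_def)
        ultimately show ?thesis using Suc.IH[OF ns sp n2 z2 nz2 o\<mu>] by (simp add: su)
      qed
      then show ?thesis using toric_has_branch[OF bq pq(1) c(1) \<sigma>(1), of w D]
        by (simp add: d2_def d1_def w_def)
    qed
  qed
  \<comment> \<open>The lower bound for the derivative requires a prime, so \<open>D\<close> is
    replaced by a prime factor vanishing at the same point. Its multiplicity is at most
    \<open>\<mu>\<close>; if it is smaller, the outer hypothesis applies at once.\<close>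
  have D0: "D \<noteq> 0" using less.prems(5) by (auto simp: slice_def)
  obtain F where F: "prime_elem F" "F dvd D" "ev \<iota> F u v = 0"
    using prime_factor_vanishing[OF D0 less.prems(4)] by blast
  obtain k where k: "D = F * k" using F(2) by blast
  have sl: "slice 0 D = slice 0 F * slice 0 k" by (simp add: k rhomD[OF rhom_slice])
  then have Fnz: "slice 0 F \<noteq> 0" using less.prems(5) by auto
  have "order 0 (slice 0 F) \<le> \<mu>"
    using order_mult[of "slice 0 F" "slice 0 k" 0] less.prems(5) by (simp add: \<mu>_def sl)
  moreover obtain E where "u ^ E \<le> \<bar>ev \<iota> (pderiv F) u v\<bar>"
    using derivative_lower_bound[OF F(1,3) less.prems(1,2,3)] by blast
  ultimately have "has_branch F"
    using IH[OF less.prems(1,2,3) F(3) Fnz] inner[OF less.prems(1,2,3) F(3) Fnz] by fastforce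
  then show ?case using F(2) has_branch_dvd by blast
qed

end

section \<open>Zeros of polynomials in ordered extensions\<close>

lemma poly_map_poly_sum_le:
  fixes h :: "'a::zero \<Rightarrow> 'b::comm_semiring_1"
  assumes "h 0 = 0" "degree p \<le> n" shows "poly (map_poly h p) v = (\<Sum>j\<le>n. h (coeff p j) * v ^ j)"
  unfolding poly_map_poly_sum[of h p v, OF assms(1)]
  using assms by (intro sum.mono_neutral_left) (auto simp: coeff_eq_0)

lemma poly_map_poly_reflect:
  fixes h :: "'a::zero \<Rightarrow> 'b::field"
  assumes "h 0 = 0" "v \<noteq> 0"
  shows "poly (map_poly h (reflect_poly p)) v = v ^ degree p * poly (map_poly h p) (inverse v)"
proof -
  let ?n = "degree p"
  have "poly (map_poly h (reflect_poly p)) v = (\<Sum>j\<le>?n. h (coeff (reflect_poly p) j) * v ^ j)"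
    using assms by (intro poly_map_poly_sum_le degree_reflect_poly_le) auto
  also have "\<dots> = (\<Sum>j\<le>?n. h (coeff p j) * v ^ (?n - j))"
    by (rule sum.reindex_bij_witness[where i = "\<lambda>j. ?n - j" and j = "\<lambda>j. ?n - j"])
      (auto simp: coeff_reflect_poly)
  also have "\<dots> = (\<Sum>j\<le>?n. v ^ ?n * (h (coeff p j) * inverse v ^ j))"
    using assms(2) by (intro sum.cong refl) (auto simp: power_diff field_simps)
  finally show ?thesis by (simp add: poly_map_poly_sum[where h = h, OF assms(1)] sum_distrib_left)
qed

lemma poly_map_poly_pcompose:
  assumes "rhom h" shows "poly (map_poly h (pcompose c q)) u = poly (map_poly h c) (poly (map_poly h q) u)"
  using assms by (induction c)
    (simp_all add: pcompose_pCons rhomD[OF rhom_map_poly] map_poly_pCons rhomD)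

lemma ev_map_poly:
  fixes h :: "real \<Rightarrow> 'b::comm_ring_1" and g :: "real poly \<Rightarrow> real poly"
  assumes "rhom h" "g 0 = 0"
    and "\<And>j. poly (map_poly h (g (coeff D j))) u = \<kappa> * poly (map_poly h (coeff D j)) z"
  shows "ev h (map_poly g D) u y = \<kappa> * ev h D z y"
proof -
  let ?h = "\<lambda>u c. poly (map_poly h c) u"
  have h0: "?h u 0 = 0" for u by simp
  have "ev h (map_poly g D) u y = (\<Sum>j\<le>degree D. ?h u (coeff (map_poly g D) j) * y ^ j)"
    unfolding ev_def by (intro poly_map_poly_sum_le map_poly_degree_leq h0)
  also have "\<dots> = (\<Sum>j\<le>degree D. \<kappa> * (?h z (coeff D j) * y ^ j))"
    by (intro sum.cong refl) (simp add: coeff_map_poly assms mult_ac)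
  also have "\<dots> = \<kappa> * ev h D z y"
    unfolding ev_def by (subst poly_map_poly_sum[where h = "?h z", OF h0]) (simp add: sum_distrib_left)
  finally show ?thesis .
qed

lemma map_poly_nonzero:
  assumes "D \<noteq> 0" "g 0 = 0" "\<And>c. c \<noteq> 0 \<Longrightarrow> g c \<noteq> 0" shows "map_poly g D \<noteq> 0"
proof -
  have "coeff (map_poly g D) (degree D) \<noteq> 0" using assms by (simp add: coeff_map_poly)
  then show ?thesis by auto
qed

context ordered_real_ext begin

lemma infinite_inverse_near_0: assumes "\<And>K. \<not> \<bar>z\<bar> \<le> \<iota> K" shows "near (inverse z) 0" "z \<noteq> 0"
proof -
  show z: "z \<noteq> 0" using assms[of 0] by (auto simp: iota)
  have "\<bar>inverse z\<bar> < \<iota> e" if "0 < e" for e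
  proof -
    have "\<iota> (inverse e) < \<bar>z\<bar>" using assms by (simp add: not_le)
    then have "inverse \<bar>z\<bar> < inverse (\<iota> (inverse e))" using that by (intro less_imp_inverse_less iota_pos) auto
    then show ?thesis by (simp add: iota_inverse abs_inverse)
  qed
  then show "near (inverse z) 0" by (simp add: near_def iota)
qed

text \<open>A coordinate change \<open>z = \<phi>(u)\<close> recorded by its effect on polynomials,
  so that translations and inversions, which need denominators cleared, are treated alike. Zeros
  over the field pass from \<open>D\<close> to \<open>G\<close>, real zeros back from
  \<open>G\<close> to \<open>D\<close>.\<close>

definition inner_chart :: "'a \<Rightarrow> 'a \<Rightarrow> (real \<Rightarrow> real) \<Rightarrow> bool" where
  "inner_chart z u \<phi> \<longleftrightarrow> (\<forall>D. D \<noteq> 0 \<longrightarrow> (\<exists>G. G \<noteq> 0 \<and>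
    (\<forall>y. ev \<iota> D z y = 0 \<longrightarrow> ev \<iota> G u y = 0) \<and> (\<forall>u0>0. \<forall>v0. pe G u0 v0 = 0 \<longrightarrow> pe D (\<phi> u0) v0 = 0)))"

text \<open>\<open>S\<close> is the domain of the real coordinate change: the whole line for a
  translation, its nonzero part for an inversion.\<close>

definition outer_chart :: "'a \<Rightarrow> 'a \<Rightarrow> (real \<Rightarrow> real) \<Rightarrow> real set \<Rightarrow> bool" where
  "outer_chart y v \<psi> S \<longleftrightarrow> (\<forall>D. D \<noteq> 0 \<longrightarrow> (\<exists>G. G \<noteq> 0 \<and>
    (\<forall>u. ev \<iota> D u y = 0 \<longrightarrow> ev \<iota> G u v = 0) \<and> (\<forall>u0. \<forall>v0\<in>S. pe G u0 v0 = 0 \<longrightarrow> pe D u0 (\<psi> v0) = 0)))"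

text \<open>A non-real \<open>z\<close> is either finite, and differs from its standard part by a
  nonzero infinitesimal, or infinite, and has an infinitesimal inverse. The sign \<open>e\<close>
  makes the parameter positive.\<close>

lemma inner_parameter:
  assumes "\<nexists>r. z = \<iota> r"
  shows "\<exists>u \<phi>. near u 0 \<and> 0 < u \<and> inj_on \<phi> {0<..} \<and> inner_chart z u \<phi>"
proof (cases "\<exists>K. \<bar>z\<bar> \<le> \<iota> K")
  case True
  then obtain r where r: "near z r" using near_exists by blast
  define e :: real where "e = (if z > \<iota> r then 1 else - 1)"
  have e0: "e \<noteq> 0" by (simp add: e_def)
  define u where "u = \<bar>z - \<iota> r\<bar>"
  have u: "0 < u" using assms by (auto simp: u_def)
  have zu: "z = \<iota> r + u * \<iota> e" by (auto simp: u_def e_def iota)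
  have nu: "near u 0" using r unfolding u_def near_def by (auto simp: iota)
  define \<phi> where "\<phi> u0 = r + u0 * e" for u0
  have "\<exists>G. G \<noteq> 0 \<and> (\<forall>y. ev \<iota> D z y = 0 \<longrightarrow> ev \<iota> G u y = 0) \<and>
      (\<forall>u0>0. \<forall>v0. pe G u0 v0 = 0 \<longrightarrow> pe D (\<phi> u0) v0 = 0)" if "D \<noteq> 0" for D
  proof (intro exI[of _ "map_poly (\<lambda>c. pcompose c [:r, e:]) D"] conjI allI impI)
    show "map_poly (\<lambda>c. pcompose c [:r, e:]) D \<noteq> 0"
      by (rule map_poly_nonzero[OF that]) (use e0 in \<open>auto simp: pcompose_eq_0_iff\<close>)
    have "ev \<iota> (map_poly (\<lambda>c. pcompose c [:r, e:]) D) u y = 1 * ev \<iota> D z y" for y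
      by (rule ev_map_poly[OF hom]) (simp_all add: poly_map_poly_pcompose[OF hom] map_poly_pCons iota zu)
    then show "ev \<iota> (map_poly (\<lambda>c. pcompose c [:r, e:]) D) u y = 0" if "ev \<iota> D z y = 0" for y
      using that by simp
    have "pe (map_poly (\<lambda>c. pcompose c [:r, e:]) D) u0 v0 = 1 * pe D (\<phi> u0) v0" for u0 v0
      by (rule ev_map_poly[OF rhom_id]) (simp_all add: poly_pcompose \<phi>_def)
    then show "pe D (\<phi> u0) v0 = 0" if "pe (map_poly (\<lambda>c. pcompose c [:r, e:]) D) u0 v0 = 0" for u0 v0
      using that by simp
  qed
  then have "inner_chart z u \<phi>" by (simp add: inner_chart_def)
  moreover have "inj_on \<phi> {0<..}" using e0 by (auto simp: inj_on_def \<phi>_def)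
  ultimately show ?thesis using u nu by blast
next
  case False
  then have z: "near (inverse z) 0" "z \<noteq> 0" using infinite_inverse_near_0[of z] by blast+
  define e :: real where "e = (if z > 0 then 1 else - 1)"
  have e0: "e \<noteq> 0" "e * e = 1" by (auto simp: e_def)
  define u where "u = \<bar>inverse z\<bar>"
  have u: "0 < u" using z by (simp add: u_def)
  have zu: "z = inverse u * \<iota> e" using z(2) by (auto simp: u_def e_def iota abs_inverse)
  have nu: "near u 0" using z(1) unfolding u_def near_def by (auto simp: iota)
  define \<phi> where "\<phi> u0 = inverse u0 * e" for u0
  have "\<exists>G. G \<noteq> 0 \<and> (\<forall>y. ev \<iota> D z y = 0 \<longrightarrow> ev \<iota> G u y = 0) \<and>
      (\<forall>u0>0. \<forall>v0. pe G u0 v0 = 0 \<longrightarrow> pe D (\<phi> u0) v0 = 0)" if D0: "D \<noteq> 0" for D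
  proof -
    \<comment> \<open>A common degree bound, so that the single factor \<open>u ^ N\<close> clears
      the denominators of all coefficients; those of smaller degree are padded by a monomial in
      \<open>g\<close>.\<close>
    define N where "N = Max ((\<lambda>j. degree (coeff D j)) ` {..degree D})"
    have N: "degree (coeff D j) \<le> N" for j
    proof (cases "j \<le> degree D")
      case True then show ?thesis unfolding N_def by (intro Max_ge) auto
    qed (simp add: coeff_eq_0)
    define g :: "real poly \<Rightarrow> real poly" where "g c = monom 1 (N - degree c) * reflect_poly (pcompose c [:0, e:])" for c
    have dg: "degree (pcompose c [:0, e:]) = degree c" for c :: "real poly" using e0 by (simp add: degree_pcompose)
    have g0: "g 0 = 0" by (simp add: g_def)
    have gne: "g c \<noteq> 0" if "c \<noteq> 0" for c using that e0 by (simp add: g_def pcompose_eq_0_iff)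
    have gen: "poly (map_poly h (g (coeff D j))) a = a ^ N * poly (map_poly h (coeff D j)) (inverse a * h e)"
      if "rhom h" "a \<noteq> 0" for h :: "real \<Rightarrow> 'f::field" and a j
    proof -
      have "poly (map_poly h (g (coeff D j))) a
        = a ^ (N - degree (coeff D j)) * a ^ degree (coeff D j) * poly (map_poly h (coeff D j)) (inverse a * h e)"
        using that by (simp add: g_def rhomD[OF rhom_map_poly] map_poly_monom rhomD poly_monom
          poly_map_poly_reflect dg poly_map_poly_pcompose map_poly_pCons)
      also have "a ^ (N - degree (coeff D j)) * a ^ degree (coeff D j) = a ^ N"
        using N[of j] by (simp flip: power_add)
      finally show ?thesis .
    qed
    have E: "ev \<iota> (map_poly g D) u y = u ^ N * ev \<iota> D z y" for y
      using gen[OF hom, of u] u zu by (intro ev_map_poly[where g = g, OF hom g0]) simp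
    have R: "pe (map_poly g D) u0 v0 = u0 ^ N * pe D (\<phi> u0) v0" if "u0 > 0" for u0 v0
      using gen[OF rhom_id, of u0] that by (intro ev_map_poly[where g = g, OF rhom_id g0]) (simp add: \<phi>_def)
    show ?thesis
      by (rule exI[of _ "map_poly g D"]) (use map_poly_nonzero[where g = g, OF D0 g0 gne] E R in auto)
  qed
  then have "inner_chart z u \<phi>" by (simp add: inner_chart_def)
  moreover have "inj_on \<phi> {0<..}" using e0 by (auto simp: inj_on_def \<phi>_def)
  ultimately show ?thesis using u nu by blast
qed

lemma outer_parameter:
  "\<exists>v \<psi> S. near v 0 \<and> (S = UNIV \<or> S = - {0} \<and> v \<noteq> 0) \<and> inj_on \<psi> S \<and> outer_chart y v \<psi> S"
proof (cases "\<exists>K. \<bar>y\<bar> \<le> \<iota> K")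
  case True
  then obtain r where r: "near y r" using near_exists by blast
  have "near (y - \<iota> r) 0" using r by (simp only: near_iff_diff[of y r])
  moreover have "shift r D \<noteq> 0" if "D \<noteq> 0" for D using that by (simp add: shift_def pcompose_eq_0_iff)
  then have "\<exists>G. G \<noteq> 0 \<and>
    (\<forall>u. ev \<iota> D u y = 0 \<longrightarrow> ev \<iota> G u (y - \<iota> r) = 0) \<and> (\<forall>u0. \<forall>v0\<in>UNIV. pe G u0 v0 = 0 \<longrightarrow> pe D u0 (r + v0) = 0)"
    if "D \<noteq> 0" for D
    using that by (intro exI[of _ "shift r D"]) (auto simp: ev_shift[OF hom] ev_shift[OF rhom_id])
  then have "outer_chart y (y - \<iota> r) (\<lambda>v. r + v) UNIV" by (simp add: outer_chart_def)
  moreover have "inj_on (\<lambda>v. r + v) UNIV" by (simp add: inj_on_def)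
  ultimately show ?thesis by blast
next
  case False
  then have y: "near (inverse y) 0" "y \<noteq> 0" using infinite_inverse_near_0[of y] by blast+
  have "\<exists>G. G \<noteq> 0 \<and>
    (\<forall>u. ev \<iota> D u y = 0 \<longrightarrow> ev \<iota> G u (inverse y) = 0) \<and> (\<forall>u0. \<forall>v0\<in>-{0}. pe G u0 v0 = 0 \<longrightarrow> pe D u0 (inverse v0) = 0)"
    if "D \<noteq> 0" for D
    using that y(2) by (intro exI[of _ "reflect_poly D"]) (auto simp: ev_def poly_map_poly_reflect)
  then have "outer_chart y (inverse y) inverse (- {0})" by (simp add: outer_chart_def)
  moreover have "inj_on inverse (- {0::real})" by (simp add: inj_on_def)
  moreover have "inverse y \<noteq> 0" using y by simp
  ultimately show ?thesis using y(1) by blast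
qed

text \<open>Both coordinates are moved to infinitesimals, a branch is found there, and its points
  are carried back injectively.\<close>

lemma uncountable_zeros:
  assumes x: "\<nexists>r. x = \<iota> r" and D: "D \<noteq> 0" "ev \<iota> D x y = 0"
  shows "uncountable {(x0, y0). pe D x0 y0 = 0}"
proof
  assume cnt: "countable {(x0, y0). pe D x0 y0 = 0}"
  obtain u \<phi> where u: "near u 0" "0 < u" "inj_on \<phi> {0<..}" and ex: "inner_chart x u \<phi>"
    using inner_parameter[OF x] by blast
  obtain v \<psi> S where v: "near v 0" "S = UNIV \<or> S = - {0} \<and> v \<noteq> 0" "inj_on \<psi> S" and ey: "outer_chart y v \<psi> S"
    using outer_parameter[of y] by blast
  obtain G where G: "G \<noteq> 0" "ev \<iota> G u y = 0" "\<And>u0 v0. u0 > 0 \<Longrightarrow> pe G u0 v0 = 0 \<Longrightarrow> pe D (\<phi> u0) v0 = 0"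
    using ex[unfolded inner_chart_def, rule_format, OF D(1)] D(2) by blast
  obtain H where H: "H \<noteq> 0" "ev \<iota> H u v = 0" "\<And>u0 v0. v0 \<in> S \<Longrightarrow> pe H u0 v0 = 0 \<Longrightarrow> pe G u0 (\<psi> v0) = 0"
    using ey[unfolded outer_chart_def, rule_format, OF G(1)] G(2) by blast
  obtain F where F: "prime_elem F" "F dvd H" "ev \<iota> F u v = 0" using prime_factor_vanishing[OF H(1,2)] by blast
  have nF: "\<not> F dvd K" if "ev \<iota> K u v \<noteq> 0" for K
    using that F(3) by (auto simp: ev_simps[OF hom] elim!: dvdE)
  \<comment> \<open>Otherwise \<open>F\<close> would be associated to the first coordinate, whose
    value \<open>u\<close> is nonzero.\<close>
  have "slice 0 F \<noteq> 0"
  proof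
    assume "slice 0 F = 0"
    then obtain k where k: "F = [:[:-0, 1:]:] * k" using slice_eq_0_iff by blast
    have "\<not> is_unit ([:[:0, 1:]:] :: real poly poly)"
      unfolding is_unit_const_poly_iff using dvd_imp_degree_le[of "[:0, 1:] :: real poly" 1] by auto
    then have "is_unit k" using irreducibleD[OF prime_elem_imp_irreducible[OF F(1)] k] by simp
    then have "F dvd [:[:-0, 1:]:]" unfolding k by (simp only: mult_unit_dvd_iff dvd_refl)
    then show False using nF[of "[:[:-0, 1:]:]"] u(2) by (simp add: ev_X[OF hom])
  qed
  then have "has_branch F" using infinitesimal_zero_has_branch[OF u(1,2) v(1) F(3)] by blast
  then have "uncountable (branch_set F 1)" by (simp add: has_branch_def)
  moreover have "branch_set F 1 \<subseteq> {(a, b). a > 0 \<and> b \<in> S \<and> pe F a b = 0} \<union> {(a, b). pe F a b = 0 \<and> b \<notin> S}"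
    by (auto simp: branch_set_def)
  \<comment> \<open>Points with \<open>b = 0\<close> lie outside the domain of the inversion. They
    are finitely many because \<open>F\<close> does not divide the second coordinate, whose value
    \<open>v\<close> is nonzero.\<close>
  moreover have "countable {(a, b). pe F a b = 0 \<and> b \<notin> S}"
  proof (cases "S = UNIV")
    case False
    then have S: "S = - {0}" "v \<noteq> 0" using v(2) by auto
    then have "\<not> F dvd [:0, 1:]" using nF by (simp add: ev_Y[OF hom])
    from finite_common_zeros[OF F(1) this] have "finite {(a, b). pe F a b = 0 \<and> b = 0}"
      by (simp add: ev_Y[OF rhom_id])
    then show ?thesis using S by (simp add: countable_finite)
  qed simp
  moreover have "countable {(a, b). a > 0 \<and> b \<in> S \<and> pe F a b = 0}"
  proof (rule countable_image_inj_on[where f = "\<lambda>(a, b). (\<phi> a, \<psi> b)"])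
    show "inj_on (\<lambda>(a, b). (\<phi> a, \<psi> b)) {(a, b). a > 0 \<and> b \<in> S \<and> pe F a b = 0}"
      using u(3) v(3) by (auto simp: inj_on_def)
    have "pe D (\<phi> a) (\<psi> b) = 0" if "a > 0" "b \<in> S" "pe F a b = 0" for a b
    proof -
      have "pe H a b = 0" using F(2) that(3) by (auto simp: ev_simps[OF rhom_id] elim!: dvdE)
      then show ?thesis using G(3) H(3) that by blast
    qed
    then show "countable ((\<lambda>(a, b). (\<phi> a, \<psi> b)) ` {(a, b). a > 0 \<and> b \<in> S \<and> pe F a b = 0})"
      by (intro countable_subset[OF _ cnt]) auto
  qed
  ultimately show False using countable_subset countable_Un_iff by meson
qed

text \<open>The reals are algebraically closed in every ordered extension: a non-real root could be
  moved to a positive infinitesimal, where no nonzero polynomial vanishes.\<close>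

lemma algebraic_imp_real:
  assumes "c \<noteq> 0" "poly (map_poly \<iota> c) z = 0" shows "\<exists>r. z = \<iota> r"
proof (rule ccontr)
  assume n: "\<nexists>r. z = \<iota> r"
  have "[:c:] \<noteq> 0" using assms by simp
  moreover have e: "ev \<iota> [:c:] z y = 0" for y using assms by (simp add: ev_inner[OF hom])
  moreover obtain u \<phi> where u: "near u 0" "0 < u" and ex: "inner_chart z u \<phi>"
    using inner_parameter[OF n] by blast
  ultimately obtain G where G: "G \<noteq> 0" "\<And>y. ev \<iota> G u y = 0" unfolding inner_chart_def by meson
  \<comment> \<open>\<open>[:c:]\<close> does not involve the second variable, so its transform
    vanishes at \<open>u\<close> for every \<open>y\<close>; hence so does each of its
    coefficients.\<close>
  let ?G = "map_poly (\<lambda>c. poly (map_poly \<iota> c) u) G"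
  have "\<forall>y. poly ?G y = 0" using G(2) by (auto simp: ev_def)
  then have "?G = 0" by (simp only: poly_all_0_iff_0)
  then have "coeff ?G (degree G) = 0" by simp
  then have "poly (map_poly \<iota> (coeff G (degree G))) u = 0" by (subst (asm) coeff_map_poly) simp_all
  then show False using poly_infinitesimal_nonzero[OF _ u(1)] u(2) G(1) by simp
qed

text \<open>If \<open>x\<close> is not real, it is transcendental over the reals, and a Bezout
  identity shows that a prime in the kernel of evaluation divides the whole kernel. If only
  \<open>y\<close> is not real, the kernel is generated by the equation of a vertical line.\<close>

theorem kernel_dichotomy:
  assumes "p \<noteq> 0" "ev \<iota> p x y = 0"
  shows "(\<exists>a b. x = \<iota> a \<and> y = \<iota> b) \<or> (\<exists>D. prime_elem D \<and> (\<forall>f. ev \<iota> f x y = 0 \<longleftrightarrow> D dvd f) \<and>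
    uncountable {(x0, y0). pe D x0 y0 = 0})"
proof (cases "\<exists>r. x = \<iota> r")
  case False
  obtain D where D: "prime_elem D" "ev \<iota> D x y = 0" using prime_factor_vanishing[OF assms] by blast
  have "D dvd f" if "ev \<iota> f x y = 0" for f
  proof (rule ccontr)
    assume "\<not> D dvd f"
    then obtain \<alpha> \<beta> a where a: "a \<noteq> 0" "\<alpha> * f + \<beta> * D = [:a:]" using prime_bezout[OF D(1)] by blast
    have "poly (map_poly \<iota> a) x = 0"
      using arg_cong[OF a(2), of "\<lambda>p. ev \<iota> p x y"] that D(2) by (simp add: ev_simps[OF hom] ev_inner[OF hom])
    then show False using algebraic_imp_real[OF a(1)] False by blast
  qed
  moreover have "ev \<iota> f x y = 0" if "D dvd f" for f
    using that D(2) by (auto simp: ev_simps[OF hom] elim!: dvdE)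
  moreover have "uncountable {(x0, y0). pe D x0 y0 = 0}"
    using uncountable_zeros[OF False _ D(2)] D(1) by auto
  ultimately show ?thesis using D(1) by blast
next
  case True
  then obtain r where r: "x = \<iota> r" by blast
  show ?thesis
  proof (cases "\<exists>b. y = \<iota> b")
    case False
    let ?D = "[:[:-r, 1:]:] :: real poly poly"
    have D: "prime_elem ?D" by (simp add: prime_elem_const_poly_iff prime_elem_linear_field_poly)
    have "ev \<iota> f x y = 0 \<longleftrightarrow> ?D dvd f" for f
    proof -
      have "ev \<iota> f x y = poly (map_poly \<iota> (slice r f)) y"
        unfolding ev_def slice_def r
        by (subst map_poly_map_poly) (simp_all add: iota o_def flip: poly_map_poly_rhom[OF hom rhom_id])
      then have "ev \<iota> f x y = 0 \<longleftrightarrow> slice r f = 0" using algebraic_imp_real False by fastforce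
      then show ?thesis by (simp only: slice_eq_0_iff)
    qed
    moreover have "uncountable {(x0, y0). pe ?D x0 y0 = 0}"
    proof (rule uncountable_if_interval_image[where f = snd and e = 1])
      show "{0<..<1} \<subseteq> snd ` {(x0, y0). pe ?D x0 y0 = 0}"
        by (force simp: ev_inner[OF rhom_id] image_iff)
    qed simp
    ultimately show ?thesis using D by blast
  qed (use r in blast)
qed

end

section \<open>Prime cones of the polynomial ring\<close>

definition support :: "'a::comm_ring_1 set \<Rightarrow> 'a set" where
  "support Q = {a. a \<in> Q \<and> - a \<in> Q}"

text \<open>A point of the real spectrum: the nonnegative elements for an ordering of the domain
  obtained by dividing out the support. Squares belong to \<open>Q\<close> since \<open>a\<close> or
  \<open>- a\<close> does.\<close>

definition prime_cone :: "'a::comm_ring_1 set \<Rightarrow> bool" where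
  "prime_cone Q \<longleftrightarrow> (\<forall>a\<in>Q. \<forall>b\<in>Q. a + b \<in> Q \<and> a * b \<in> Q) \<and> (\<forall>a. a \<in> Q \<or> - a \<in> Q) \<and> - 1 \<notin> Q
    \<and> (\<forall>a b. a * b \<in> support Q \<longrightarrow> a \<in> support Q \<or> b \<in> support Q)"

lemma prime_coneD:
  assumes "prime_cone Q"
  shows "a \<in> Q \<Longrightarrow> b \<in> Q \<Longrightarrow> a + b \<in> Q" "a \<in> Q \<Longrightarrow> b \<in> Q \<Longrightarrow> a * b \<in> Q" "a \<in> Q \<or> - a \<in> Q" "- 1 \<notin> Q"
    "a * b \<in> support Q \<Longrightarrow> a \<in> support Q \<or> b \<in> support Q"
  using assms by (auto simp: prime_cone_def)

lemma support_ideal: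
  assumes "prime_cone Q"
  shows "0 \<in> support Q" "a \<in> support Q \<Longrightarrow> b \<in> support Q \<Longrightarrow> a + b \<in> support Q"
    "a \<in> support Q \<Longrightarrow> a * b \<in> support Q" "a \<in> support Q \<Longrightarrow> - a \<in> support Q" "1 \<notin> support Q"
proof -
  note Q = prime_coneD[OF assms]
  show "0 \<in> support Q" using Q(3)[of 0] by (simp add: support_def)
  show "a \<in> support Q \<Longrightarrow> b \<in> support Q \<Longrightarrow> a + b \<in> support Q"
    using Q(1)[of a b] Q(1)[of "- a" "- b"] by (simp add: support_def add.commute)
  show "a \<in> support Q \<Longrightarrow> - a \<in> support Q" by (simp add: support_def)
  show "1 \<notin> support Q" using Q(4) by (simp add: support_def)
  assume a: "a \<in> support Q"
  show "a * b \<in> support Q"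
    using Q(3)[of b] a Q(2)[of a b] Q(2)[of "- a" b] Q(2)[of a "- b"] Q(2)[of "- a" "- b"]
    by (auto simp: support_def)
qed

text \<open>Supplies the default value of \<open>worst_cone\<close>; polynomials over the reals are
  ordered by the sign of the leading coefficient.\<close>

lemma nonneg_prime_cone: "prime_cone {p :: 'a::linordered_idom. 0 \<le> p}"
proof -
  have "support {p :: 'a. 0 \<le> p} = {0}" by (auto simp: support_def)
  then show ?thesis unfolding prime_cone_def by (simp add: linorder_linear)
qed

definition cone_dichotomy :: "real poly poly set \<Rightarrow> bool" where
  "cone_dichotomy Q \<longleftrightarrow> support Q = {0}
    \<or> (\<exists>a b. [:[:- a, 1:]:] \<in> support Q \<and> [:[:- b:], 1:] \<in> support Q)
    \<or> (\<exists>D. prime_elem D \<and> support Q = {f. D dvd f} \<and> uncountable {(x, y). pe D x y = 0})"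

text \<open>Ordered residue fields of prime cones are needed as types of class
  \<^class>\<open>linordered_field\<close>. Types cannot depend on a variable cone, so the construction is carried
  out for one fixed cone, chosen to violate the dichotomy if any cone does.\<close>

definition worst_cone :: "real poly poly set" where
  "worst_cone = (if \<exists>Q. prime_cone Q \<and> \<not> cone_dichotomy Q
     then SOME Q. prime_cone Q \<and> \<not> cone_dichotomy Q else {p. 0 \<le> p})"

lemma worst_cone: "prime_cone worst_cone"
proof (cases "\<exists>Q. prime_cone Q \<and> \<not> cone_dichotomy Q")
  case True
  then show ?thesis using someI_ex[OF True] by (simp add: worst_cone_def)
next
  case False
  then have *: "worst_cone = {p. 0 \<le> p}" unfolding worst_cone_def by (rule if_not_P)
  show ?thesis unfolding * by (rule nonneg_prime_cone)
qed

lemma cone_dichotomy_if_worst_cone: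
  assumes "cone_dichotomy worst_cone" "prime_cone Q" shows "cone_dichotomy Q"
proof (rule ccontr)
  assume "\<not> cone_dichotomy Q"
  then have ex: "\<exists>Q. prime_cone Q \<and> \<not> cone_dichotomy Q" using assms(2) by blast
  show False using someI_ex[OF ex] assms(1) ex by (simp add: worst_cone_def)
qed

lemmas wc = prime_coneD[OF worst_cone] and ws = support_ideal[OF worst_cone]

\<comment> \<open>The ordered residue domain of the chosen cone\<close>
quotient_type cone_residue = "real poly poly" / "\<lambda>a b. a - b \<in> support worst_cone"
  morphisms residue_rep residue
proof (rule equivpI)
  show "reflp (\<lambda>a b. a - b \<in> support worst_cone)" by (rule reflpI) (simp add: ws)
  show "symp (\<lambda>a b. a - b \<in> support worst_cone)"
  proof (rule sympI)
    fix a b assume "a - b \<in> support worst_cone"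
    then show "b - a \<in> support worst_cone" using ws(4)[of "a - b"] by simp
  qed
  show "transp (\<lambda>a b. a - b \<in> support worst_cone)"
  proof (rule transpI)
    fix a b c assume "a - b \<in> support worst_cone" "b - c \<in> support worst_cone"
    then show "a - c \<in> support worst_cone" using ws(2)[of "a - b" "b - c"] by simp
  qed
qed

instantiation cone_residue :: comm_ring_1
begin

lift_definition zero_cone_residue :: cone_residue is 0 .
lift_definition one_cone_residue :: cone_residue is 1 .

lift_definition plus_cone_residue :: "cone_residue \<Rightarrow> cone_residue \<Rightarrow> cone_residue" is "(+)"
proof -
  fix a b c d assume "a - b \<in> support worst_cone" "c - d \<in> support worst_cone"
  then show "a + c - (b + d) \<in> support worst_cone" using ws(2)[of "a - b" "c - d"] by (simp add: algebra_simps)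
qed

lift_definition uminus_cone_residue :: "cone_residue \<Rightarrow> cone_residue" is uminus
proof -
  fix a b assume "a - b \<in> support worst_cone"
  then show "- a - - b \<in> support worst_cone" using ws(4)[of "a - b"] by simp
qed

lift_definition minus_cone_residue :: "cone_residue \<Rightarrow> cone_residue \<Rightarrow> cone_residue" is "(-)"
proof -
  fix a b c d assume "a - b \<in> support worst_cone" "c - d \<in> support worst_cone"
  then show "a - c - (b - d) \<in> support worst_cone"
    using ws(2)[of "a - b" "- (c - d)"] ws(4)[of "c - d"] by (simp add: algebra_simps)
qed

lift_definition times_cone_residue :: "cone_residue \<Rightarrow> cone_residue \<Rightarrow> cone_residue" is "(*)"
proof -
  fix a b c d assume "a - b \<in> support worst_cone" "c - d \<in> support worst_cone"
  then show "a * c - b * d \<in> support worst_cone"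
    using ws(2)[OF ws(3)[of "a - b" c] ws(3)[of "c - d" b]] by (simp add: algebra_simps)
qed

instance
proof
  fix a b c :: cone_residue
  show "a + b + c = a + (b + c)" by transfer (simp add: ws add.assoc)
  show "a + b = b + a" by transfer (simp add: ws add.commute)
  show "0 + a = a" by transfer (simp add: ws)
  show "- a + a = 0" by transfer (simp add: ws)
  show "a - b = a + - b" by transfer (simp add: ws)
  show "a * b * c = a * (b * c)" by transfer (simp add: ws mult.assoc)
  show "a * b = b * a" by transfer (simp add: ws mult.commute)
  show "1 * a = a" by transfer (simp add: ws)
  show "(a + b) * c = a * c + b * c" by transfer (simp add: ws algebra_simps)
  show "(0::cone_residue) \<noteq> 1" by transfer (use ws(4)[of "- 1"] ws(5) in auto)
qed

end

instance cone_residue :: idom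
proof
  fix a b :: cone_residue assume "a \<noteq> 0" "b \<noteq> 0"
  then show "a * b \<noteq> 0" by transfer (use wc(5) in auto)
qed

lemma worst_cone_trans: "b - a \<in> worst_cone \<Longrightarrow> c - b \<in> worst_cone \<Longrightarrow> c - a \<in> worst_cone"
  using wc(1)[of "b - a" "c - b"] by simp

lemma worst_cone_total: "b - a \<in> worst_cone \<or> a - b \<in> worst_cone"
  using wc(3)[of "b - a"] by simp

lemma worst_cone_mult: "b - a \<in> worst_cone \<Longrightarrow> c - 0 \<in> worst_cone \<Longrightarrow> c * b - c * a \<in> worst_cone"
  using wc(2)[of c "b - a"] by (simp add: right_diff_distrib)

instantiation cone_residue :: linordered_idom
begin

lift_definition less_eq_cone_residue :: "cone_residue \<Rightarrow> cone_residue \<Rightarrow> bool" is "\<lambda>a b. b - a \<in> worst_cone"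
proof -
  have *: "d - b \<in> worst_cone" if "a - b \<in> support worst_cone" "c - d \<in> support worst_cone" "c - a \<in> worst_cone" for a b c d
  proof -
    have "a - b \<in> worst_cone" "- (c - d) \<in> worst_cone" using that by (auto simp: support_def)
    then have "(c - a) + (a - b) + - (c - d) \<in> worst_cone" using that(3) by (intro wc(1))
    then show ?thesis by simp
  qed
  have sym: "b - a \<in> support worst_cone" if "a - b \<in> support worst_cone" for a b using ws(4)[OF that] by simp
  fix a b c d assume "a - b \<in> support worst_cone" "c - d \<in> support worst_cone"
  then show "(c - a \<in> worst_cone) = (d - b \<in> worst_cone)" using *[of a b c d] *[of b a d c] sym by blast
qed

definition less_cone_residue :: "cone_residue \<Rightarrow> cone_residue \<Rightarrow> bool" where
  "less_cone_residue a b \<longleftrightarrow> a \<le> b \<and> \<not> b \<le> a"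

definition abs_cone_residue :: "cone_residue \<Rightarrow> cone_residue" where
  "abs_cone_residue a = (if a < 0 then - a else a)"

definition sgn_cone_residue :: "cone_residue \<Rightarrow> cone_residue" where
  "sgn_cone_residue a = (if a = 0 then 0 else if 0 < a then 1 else - 1)"

instance
proof
  fix a b c :: cone_residue
  have 0: "0 \<in> worst_cone" using ws(1) by (simp add: support_def)
  show refl: "a \<le> a" by transfer (simp add: 0)
  show trans: "a \<le> b \<Longrightarrow> b \<le> c \<Longrightarrow> a \<le> c"
    by transfer (rule worst_cone_trans)
  show antisym: "a \<le> b \<Longrightarrow> b \<le> a \<Longrightarrow> a = b" by transfer (simp add: support_def)
  show total: "a \<le> b \<or> b \<le> a" by transfer (rule worst_cone_total)
  show "(a < b) = (a \<le> b \<and> \<not> b \<le> a)" by (simp add: less_cone_residue_def)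
  show "a \<le> b \<Longrightarrow> c + a \<le> c + b" by transfer simp
  show "\<bar>a\<bar> = (if a < 0 then - a else a)" by (simp add: abs_cone_residue_def)
  show "sgn a = (if a = 0 then 0 else if 0 < a then 1 else - 1)" by (simp add: sgn_cone_residue_def)
  assume ab: "a < b" and c: "0 < c"
  have le: "c * a \<le> c * b"
  proof -
    have "a \<le> b" "0 \<le> c" using ab c by (auto simp: less_cone_residue_def)
    then show ?thesis by transfer (rule worst_cone_mult)
  qed
  have "\<not> c * b \<le> c * a"
  proof
    assume "c * b \<le> c * a"
    then have "c * a = c * b" using le by transfer (simp add: support_def)
    then have "c * (a - b) = 0" by (simp add: right_diff_distrib)
    moreover have "c \<noteq> 0" using c by (auto simp: less_cone_residue_def)
    moreover have "a - b \<noteq> 0" using ab refl by (auto simp: less_cone_residue_def)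
    ultimately show False by simp
  qed
  then show "c * a < c * b" using le by (simp add: less_cone_residue_def)
qed

end

lemma residue_eq_0_iff: "residue p = 0 \<longleftrightarrow> p \<in> support worst_cone"
  by (simp add: zero_cone_residue_def cone_residue.abs_eq_iff)

lemma rhom_residue: "rhom (\<lambda>p. Fract (residue p) 1)"
  by (simp add: rhom_def one_cone_residue_def[symmetric] One_fract_def
      plus_cone_residue.abs_eq[symmetric] times_cone_residue.abs_eq[symmetric])

text \<open>The classes \<open>x\<close> and \<open>y\<close> of the coordinates form a generic
  point: evaluation there is the residue map, and its kernel is the support. The order extends to
  the field of fractions, where \<open>kernel_dichotomy\<close> applies.\<close>

lemma cone_dichotomy_worst_cone: "cone_dichotomy worst_cone"
proof (cases "support worst_cone = {0}")
  case False
  then obtain p where p: "p \<noteq> 0" "p \<in> support worst_cone" using ws(1) by blast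
  define \<pi> where "\<pi> = (\<lambda>p. Fract (residue p) 1)"
  define \<iota> where "\<iota> = (\<lambda>r. \<pi> [:[:r:]:])"
  define x where "x = \<pi> [:[:0, 1:]:]" define y where "y = \<pi> [:0, 1:]"
  have \<pi>: "rhom \<pi>" using rhom_residue by (simp add: \<pi>_def)
  have \<iota>: "rhom \<iota>" unfolding \<iota>_def by (intro rhom_comp[OF \<pi>] rhom_comp[OF rhom_const_poly rhom_const_poly])
  interpret ordered_real_ext \<iota> by standard (rule \<iota>)
  have X: "poly (map_poly (\<lambda>r. [:[:r:]:]) c) [:[:0, 1:]:] = ([:c:] :: real poly poly)" for c :: "real poly"
    by (induction c) (auto simp: map_poly_pCons)
  have Y: "ev (\<lambda>r. [:[:r:]:]) f [:[:0, 1:]:] [:0, 1:] = f" for f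
    by (induction f) (auto simp: ev_pCons ev_zero rhom_comp[OF rhom_const_poly rhom_const_poly] X)
  have e: "ev \<iota> f x y = \<pi> f" for f
    using rhom_ev_comp[OF \<pi> rhom_comp[OF rhom_const_poly rhom_const_poly], of f "[:[:0, 1:]:]" "[:0, 1:]"]
    by (simp add: Y \<iota>_def x_def y_def)
  have z: "\<pi> f = 0 \<longleftrightarrow> f \<in> support worst_cone" for f
    by (simp add: \<pi>_def eq_fract Zero_fract_def residue_eq_0_iff)
  have "(\<exists>a b. x = \<iota> a \<and> y = \<iota> b) \<or> (\<exists>D. prime_elem D \<and> (\<forall>f. ev \<iota> f x y = 0 \<longleftrightarrow> D dvd f) \<and>
    uncountable {(x0, y0). pe D x0 y0 = 0})"
    by (rule kernel_dichotomy[OF p(1)]) (simp add: e z p(2))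
  then show ?thesis
  proof
    assume "\<exists>a b. x = \<iota> a \<and> y = \<iota> b"
    then obtain a b where ab: "x = \<iota> a" "y = \<iota> b" by blast
    have "\<pi> ([:[:0, 1:]:] - [:[:a:]:]) = 0" "\<pi> ([:0, 1:] - [:[:b:]:]) = 0"
      using ab by (simp_all only: rhomD(6)[OF \<pi>] \<iota>_def x_def y_def diff_self)
    then have "[:[:- a, 1:]:] \<in> support worst_cone" "[:[:- b:], 1:] \<in> support worst_cone" by (simp_all add: z)
    then show ?thesis by (auto simp: cone_dichotomy_def)
  next
    assume "\<exists>D. prime_elem D \<and> (\<forall>f. ev \<iota> f x y = 0 \<longleftrightarrow> D dvd f) \<and> uncountable {(x0, y0). pe D x0 y0 = 0}"
    then obtain D where D: "prime_elem D" "\<And>f. ev \<iota> f x y = 0 \<longleftrightarrow> D dvd f" "uncountable {(x0, y0). pe D x0 y0 = 0}"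
      by blast
    then have "support worst_cone = {f. D dvd f}" using e z by auto
    then show ?thesis using D(1,3) unfolding cone_dichotomy_def by (intro disjI2 exI[of _ D]) simp
  qed
qed (simp add: cone_dichotomy_def)

theorem prime_cone_dichotomy: "prime_cone Q \<Longrightarrow> cone_dichotomy Q"
  using cone_dichotomy_if_worst_cone cone_dichotomy_worst_cone by blast

section \<open>Regular functions and blowings-up\<close>

definition pfun :: "real poly poly \<Rightarrow> real \<times> real \<Rightarrow> real" where
  "pfun D z = pe D (fst z) (snd z)"

lemma pfun_simps:
  "pfun (D + E) z = pfun D z + pfun E z" "pfun (D * E) z = pfun D z * pfun E z" "pfun (- D) z = - pfun D z"
  "pfun (D - E) z = pfun D z - pfun E z" "pfun [:[:r:]:] z = r" "pfun [:[:0, 1:]:] z = fst z" "pfun [:0, 1:] z = snd z"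
  "pfun 0 z = 0" "pfun 1 z = 1"
  by (simp_all add: pfun_def ev_simps[OF rhom_id] ev_const[OF rhom_id] ev_X[OF rhom_id] ev_Y[OF rhom_id])

lemma poly2_iff: "poly2 p \<longleftrightarrow> (\<exists>D. p = pfun D)"
proof
  assume "poly2 p"
  then obtain N c where p: "\<And>x y. p (x, y) = (\<Sum>i\<le>N. \<Sum>j\<le>N. c i j * x ^ i * y ^ j)"
    unfolding poly2_def by blast
  have "p z = pfun (\<Sum>i\<le>N. \<Sum>j\<le>N. monom (monom (c i j) i) j) z" for z
    using p[of "fst z" "snd z"] by (simp add: pfun_def rhom_sum[OF rhom_ev[OF rhom_id]] ev_monom[OF rhom_id])
  then show "\<exists>D. p = pfun D" by blast
next
  assume "\<exists>D. p = pfun D"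
  then obtain D where D: "p = pfun D" by blast
  define N where "N = Max (insert 0 (fst ` mon_supp D \<union> snd ` mon_supp D))"
  have fin: "finite (insert 0 (fst ` mon_supp D \<union> snd ` mon_supp D))" by (simp add: finite_mon_supp)
  have N: "fst z \<le> N" "snd z \<le> N" if "z \<in> mon_supp D" for z
    unfolding N_def using that fin by (auto intro!: Max_ge)
  have "p (x, y) = (\<Sum>i\<le>N. \<Sum>j\<le>N. coeff (coeff D j) i * x ^ i * y ^ j)" for x y
  proof -
    have "p (x, y) = (\<Sum>(i, j)\<in>mon_supp D. coeff (coeff D j) i * x ^ i * y ^ j)"
      by (simp add: D pfun_def ev_sum_mon[OF rhom_id])
    also have "\<dots> = (\<Sum>(i, j)\<in>{..N} \<times> {..N}. coeff (coeff D j) i * x ^ i * y ^ j)"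
      using N by (intro sum.mono_neutral_left) (force simp: mon_supp_def)+
    also have "\<dots> = (\<Sum>i\<le>N. \<Sum>j\<le>N. coeff (coeff D j) i * x ^ i * y ^ j)"
      by (simp add: sum.cartesian_product)
    finally show ?thesis .
  qed
  then show "poly2 p" unfolding poly2_def by (intro exI[of _ N] exI[of _ "\<lambda>i j. coeff (coeff D j) i"]) blast
qed

lemma poly2I: "(\<And>z. p z = pfun D z) \<Longrightarrow> poly2 p"
  using poly2_iff by blast

lemma poly2_const: "poly2 (\<lambda>z. r)" by (rule poly2I[of _ "[:[:r:]:]"]) (simp add: pfun_simps)
lemma poly2_fst: "poly2 fst" by (rule poly2I[of _ "[:[:0, 1:]:]"]) (simp add: pfun_simps)
lemma poly2_snd: "poly2 snd" by (rule poly2I[of _ "[:0, 1:]"]) (simp add: pfun_simps)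
lemma poly2_add: "poly2 p \<Longrightarrow> poly2 q \<Longrightarrow> poly2 (\<lambda>z. p z + q z)"
  unfolding poly2_iff by (metis (no_types, lifting) pfun_simps(1) ext)
lemma poly2_diff: "poly2 p \<Longrightarrow> poly2 q \<Longrightarrow> poly2 (\<lambda>z. p z - q z)"
  unfolding poly2_iff by (metis (no_types, lifting) pfun_simps(4) ext)
lemma poly2_mult: "poly2 p \<Longrightarrow> poly2 q \<Longrightarrow> poly2 (\<lambda>z. p z * q z)"
  unfolding poly2_iff by (metis (no_types, lifting) pfun_simps(2) ext)
lemma poly2_power: "poly2 p \<Longrightarrow> poly2 (\<lambda>z. p z ^ n)"
  by (induction n) (auto simp: poly2_const poly2_mult)

lemma poly2_comp:
  assumes "poly2 p" "poly2 a" "poly2 b" shows "poly2 (\<lambda>z. p (a z, b z))"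
proof -
  obtain D A B where "p = pfun D" "a = pfun A" "b = pfun B" using assms poly2_iff by auto
  then show ?thesis by (intro poly2I[of _ "subst2 D A B"]) (simp add: pfun_def ev_subst2[OF rhom_id])
qed

lemmas poly2_intros = poly2_const poly2_fst poly2_snd poly2_add poly2_diff poly2_mult poly2_power

lemma poly2_induct [consumes 1, case_names const fst snd add mult]:
  assumes "poly2 p" and P: "\<And>r. P (\<lambda>z. r)" "P fst" "P snd"
    "\<And>p q. P p \<Longrightarrow> P q \<Longrightarrow> P (\<lambda>z. p z + q z)" "\<And>p q. P p \<Longrightarrow> P q \<Longrightarrow> P (\<lambda>z. p z * q z)"
  shows "P p"
proof -
  have inner: "P (\<lambda>z. poly c (fst z))" for c
    by (induction c) (simp_all add: P)
  have "P (pfun D)" for D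
  proof (induction D)
    case 0 then show ?case using P(1)[of 0] by (simp add: pfun_def[abs_def] ev_zero[OF rhom_id])
  next
    case (pCons c D)
    then show ?case
      using P(4)[OF inner[of c] P(5)[OF P(3) pCons(2)]] by (simp add: pfun_def[abs_def] ev_pCons[OF rhom_id])
  qed
  then show ?thesis using assms(1) poly2_iff by auto
qed

lemma poly2_isCont: "poly2 p \<Longrightarrow> isCont p z"
  by (induction p rule: poly2_induct) (auto intro!: continuous_intros)

lemma poly2_div_fst:
  assumes "poly2 P" "infinite {y. P (a, y) = 0}"
  shows "\<exists>P1. poly2 P1 \<and> (\<forall>z. P z = (fst z - a) * P1 z)"
proof -
  obtain D where D: "P = pfun D" using assms poly2_iff by auto
  have "slice a D = 0" using assms(2) poly_roots_finite[of "slice a D"] by (auto simp: D pfun_def pe_slice)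
  then obtain E where "D = [:[:-a, 1:]:] * E" using slice_eq_0_iff by blast
  then have "P z = (fst z - a) * pfun E z" for z
    unfolding D pfun_def by (simp only: ev_simps[OF rhom_id] ev_inner[OF rhom_id]) simp
  then show ?thesis using poly2_iff by blast
qed

lemma poly2_div_snd:
  assumes "poly2 P" "infinite {x. P (x, b) = 0}"
  shows "\<exists>P1. poly2 P1 \<and> (\<forall>z. P z = (snd z - b) * P1 z)"
proof -
  obtain D where D: "P = pfun D" using assms poly2_iff by auto
  have "poly D [:b:] = 0"
    using assms(2) poly_roots_finite[of "poly D [:b:]"] by (auto simp: D pfun_def pe_swap)
  then obtain E where "D = [:-[:b:], 1:] * E" using poly_eq_0_iff_dvd by blast
  then have "P z = (snd z - b) * pfun E z" for z
    unfolding D pfun_def by (simp only: ev_simps[OF rhom_id]) (simp add: ev_pCons[OF rhom_id] ev_zero[OF rhom_id])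
  then show ?thesis using poly2_iff by blast
qed

lemma poly2_cofinite_fst: assumes "poly2 Q" "Q (a, b) \<noteq> 0" shows "finite {y. Q (a, y) = 0}"
proof -
  obtain D where D: "Q = pfun D" using assms poly2_iff by auto
  have "slice a D \<noteq> 0" using assms(2) by (auto simp: D pfun_def pe_slice)
  then show ?thesis using poly_roots_finite by (simp add: D pfun_def pe_slice)
qed

lemma poly2_cofinite_snd: assumes "poly2 Q" "Q (a, b) \<noteq> 0" shows "finite {x. Q (x, b) = 0}"
proof -
  obtain D where D: "Q = pfun D" using assms poly2_iff by auto
  have "poly D [:b:] \<noteq> 0" using assms(2) by (auto simp: D pfun_def pe_swap)
  then show ?thesis using poly_roots_finite by (simp add: D pfun_def pe_swap)
qed

text \<open>The Zariski open set becomes the nonvanishing locus of a denominator once both terms of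
  the fraction are multiplied by a defining polynomial of the set that is nonzero at
  \<open>x\<close>.\<close>

lemma regular_at_iff:
  "regular_at g x \<longleftrightarrow> (\<exists>p q. poly2 p \<and> poly2 q \<and> q x \<noteq> 0 \<and> (\<forall>y. q y \<noteq> 0 \<longrightarrow> g y = p y / q y))"
proof
  assume "regular_at g x"
  then obtain p q U where h: "poly2 p" "poly2 q" "zariski_open U" "x \<in> U" "\<forall>y\<in>U. q y \<noteq> 0 \<and> g y = p y / q y"
    unfolding regular_at_def by blast
  then obtain S where S: "\<forall>p\<in>S. poly2 p" "U = - {x. \<forall>p\<in>S. p x = 0}" unfolding zariski_open_def by blast
  then obtain s where s: "s \<in> S" "s x \<noteq> 0" using h(4) by auto
  have "g y = p y * s y / (q y * s y)" if "q y * s y \<noteq> 0" for y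
  proof -
    have "y \<in> U" using S(2) s(1) that by auto
    then show ?thesis using h(5) that by simp
  qed
  moreover have "q x * s x \<noteq> 0" using h(4,5) s by simp
  ultimately show "\<exists>p q. poly2 p \<and> poly2 q \<and> q x \<noteq> 0 \<and> (\<forall>y. q y \<noteq> 0 \<longrightarrow> g y = p y / q y)"
    using S(1) s(1) h(1,2)
    by (intro exI[of _ "\<lambda>z. p z * s z"] exI[of _ "\<lambda>z. q z * s z"]) (auto intro!: poly2_mult)
next
  assume "\<exists>p q. poly2 p \<and> poly2 q \<and> q x \<noteq> 0 \<and> (\<forall>y. q y \<noteq> 0 \<longrightarrow> g y = p y / q y)"
  then obtain p q where h: "poly2 p" "poly2 q" "q x \<noteq> 0" "\<forall>y. q y \<noteq> 0 \<longrightarrow> g y = p y / q y" by blast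
  have "zariski_open {y. q y \<noteq> 0}" unfolding zariski_open_def using h(2) by (intro exI[of _ "{q}"]) auto
  then show "regular_at g x" unfolding regular_at_def using h by blast
qed

lemma rational2_iff: "rational2 f \<longleftrightarrow> (\<exists>x. regular_at f x)"
  unfolding rational2_def regular_at_def by blast

lemma poly2_regular_at: "poly2 p \<Longrightarrow> regular_at p x"
  unfolding regular_at_iff by (intro exI[of _ p] exI[of _ "\<lambda>_. 1"]) (auto simp: poly2_const)

lemma regular_at_isCont: assumes "regular_at g x" shows "isCont g x"
proof -
  obtain p q where h: "poly2 p" "poly2 q" "q x \<noteq> 0" "\<And>y. q y \<noteq> 0 \<Longrightarrow> g y = p y / q y"
    using assms regular_at_iff by auto
  have c: "isCont p x" "isCont q x" using h poly2_isCont by auto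
  then have "eventually (\<lambda>y. q y \<noteq> 0) (nhds x)"
    using h(3) by (metis isCont_def t1_space_nhds tendsto_imp_eventually_ne eventually_nhds_conv_at)
  then have "eventually (\<lambda>y. g y = p y / q y) (nhds x)" by (rule eventually_mono) (rule h(4))
  moreover have "isCont (\<lambda>y. p y / q y) x" using c h(3) by (intro continuous_intros)
  ultimately show ?thesis using isCont_cong by force
qed

text \<open>A numerator of \<open>G\<close> is divisible by the equation of each line on which
  \<open>G\<close> vanishes, so \<open>G ^ N\<close> brings \<open>N\<close> such factors, more than
  the denominator takes away.\<close>

lemma regular_divide:
  assumes G: "regular_at G (a, b)" and e: "poly2 e" "e (a, b) \<noteq> 0" and ij: "i < N" "j < N"
    and vi: "0 < i \<Longrightarrow> \<forall>y. G (a, y) = 0" and vj: "0 < j \<Longrightarrow> \<forall>x. G (x, b) = 0"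
  shows "regular_at (\<lambda>z. G z ^ N / ((fst z - a) ^ i * (snd z - b) ^ j * e z)) (a, b)"
proof -
  obtain P Q where PQ: "poly2 P" "poly2 Q" "Q (a, b) \<noteq> 0" "\<And>z. Q z \<noteq> 0 \<Longrightarrow> G z = P z / Q z"
    using G regular_at_iff by auto
  have inf: "infinite {y::real. y \<notin> S}" if "finite S" for S
    using that infinite_UNIV_char_0 by (metis Collect_mem_eq Compl_eq finite_compl)
  obtain P1 where P1: "poly2 P1" "\<And>z. P z = (if 0 < i then fst z - a else 1) * P1 z"
  proof (cases "0 < i")
    case True
    have "{y. y \<notin> {y. Q (a, y) = 0}} \<subseteq> {y. P (a, y) = 0}"
      using vi[OF True] PQ(4) by (auto simp: divide_eq_0_iff) (metis divide_eq_0_iff)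
    then have "infinite {y. P (a, y) = 0}" using inf[OF poly2_cofinite_fst[OF PQ(2,3)]] finite_subset by blast
    from poly2_div_fst[OF PQ(1) this] obtain P1 where P1: "poly2 P1" "\<And>z. P z = (fst z - a) * P1 z" by blast
    show ?thesis using True by (intro that[of P1] P1(1)) (simp add: P1(2))
  next
    case False then show ?thesis using that[of P] PQ(1) by simp
  qed
  obtain R where R: "poly2 R" "\<And>z. P1 z = (if 0 < j then snd z - b else 1) * R z"
  proof (cases "0 < j")
    case True
    \<comment> \<open>The factorization of \<open>P\<close> determines \<open>P1\<close> only off
      the line over \<open>a\<close>, so \<open>x = a\<close> is excluded too.\<close>
    have "P1 (x, b) = 0" if x: "x \<notin> insert a {x. Q (x, b) = 0}" for x
    proof -
      have "P (x, b) = 0" using vj[OF True] PQ(4)[of "(x, b)"] x by simp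
      then show "P1 (x, b) = 0" using x by (simp add: P1(2) split: if_splits)
    qed
    then have "{x. x \<notin> insert a {x. Q (x, b) = 0}} \<subseteq> {x. P1 (x, b) = 0}" by blast
    moreover have "infinite {x. x \<notin> insert a {x. Q (x, b) = 0}}"
      using poly2_cofinite_snd[OF PQ(2,3)] by (intro inf) simp
    ultimately have "infinite {x. P1 (x, b) = 0}" by (rule infinite_super)
    from poly2_div_snd[OF P1(1) this] obtain R where R: "poly2 R" "\<And>z. P1 z = (snd z - b) * R z" by blast
    show ?thesis using True by (intro that[of R] R(1)) (simp add: R(2))
  next
    case False then show ?thesis using that[of P1] P1(1) by simp
  qed
  define A where "A z = (if 0 < i then (fst z - a) ^ (N - i) else 1)" for z :: "real \<times> real"
  define B where "B z = (if 0 < j then (snd z - b) ^ (N - j) else 1)" for z :: "real \<times> real"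
  have pA: "poly2 A" unfolding A_def by (cases "0 < i") (auto intro!: poly2_intros)
  have pB: "poly2 B" unfolding B_def by (cases "0 < j") (auto intro!: poly2_intros)
  have "G z ^ N / ((fst z - a) ^ i * (snd z - b) ^ j * e z) = A z * B z * R z ^ N / (Q z ^ N * e z)"
    if z: "Q z ^ N * e z \<noteq> 0" for z
  proof (cases "(fst z - a) ^ i * (snd z - b) ^ j = 0")
    case True
    \<comment> \<open>On the lines the quotient is 0 by the convention for division by 0. The right
      side agrees because \<open>i < N\<close> and \<open>j < N\<close> leave a positive power in
      \<open>A\<close> or \<open>B\<close>.\<close>
    then have "A z * B z = 0" using ij by (auto simp: A_def B_def)
    then show ?thesis by (simp only: True mult_zero_left div_by_0 div_0)
  next
    case False
    have Q: "Q z \<noteq> 0" "e z \<noteq> 0" using z ij by auto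
    have a: "(if 0 < i then fst z - a else 1) ^ N = A z * (fst z - a) ^ i"
      using ij by (auto simp: A_def simp flip: power_add)
    have b: "(if 0 < j then snd z - b else 1) ^ N = B z * (snd z - b) ^ j"
      using ij by (auto simp: B_def simp flip: power_add)
    have "G z = (if 0 < i then fst z - a else 1) * ((if 0 < j then snd z - b else 1) * R z) / Q z"
      by (simp only: PQ(4)[OF Q(1)] P1(2)[of z] R(2)[of z])
    then have GN: "G z ^ N = (A z * (fst z - a) ^ i) * ((B z * (snd z - b) ^ j) * R z ^ N) / Q z ^ N"
      by (simp only: power_divide power_mult_distrib a b)
    have *: "(A z * U) * ((B z * V) * R z ^ N) / Q z ^ N / (U * V * e z) = A z * B z * R z ^ N / (Q z ^ N * e z)"
      if "U \<noteq> 0" "V \<noteq> 0" for U V using that Q by (simp add: field_simps)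
    have "(fst z - a) ^ i \<noteq> 0" "(snd z - b) ^ j \<noteq> 0" using False by auto
    then show ?thesis unfolding GN by (rule *)
  qed
  moreover have "Q (a, b) ^ N * e (a, b) \<noteq> 0" using PQ(3) e by simp
  ultimately show ?thesis unfolding regular_at_iff
    by (intro exI[of _ "\<lambda>z. A z * B z * R z ^ N"] exI[of _ "\<lambda>z. Q z ^ N * e z"])
       (auto intro!: poly2_intros pA pB R PQ e)
qed

lemma poly2_bl1: assumes "poly2 e" shows "poly2 (e \<circ> bl1 c)"
proof -
  have *: "e \<circ> bl1 c = (\<lambda>z. e (fst c + fst z, snd c + fst z * snd z))" by (auto simp: bl1_def fun_eq_iff)
  show ?thesis unfolding * by (intro poly2_comp[OF assms] poly2_intros)
qed

lemma poly2_bl2: assumes "poly2 e" shows "poly2 (e \<circ> bl2 c)"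
proof -
  have *: "e \<circ> bl2 c = (\<lambda>z. e (fst c + fst z * snd z, snd c + snd z))" by (auto simp: bl2_def fun_eq_iff)
  show ?thesis unfolding * by (intro poly2_comp[OF assms] poly2_intros)
qed

text \<open>The exponents of a monomial at most double in total under a blowing-up, and a function
  vanishing on its zero lines vanishes on those of its pullback.\<close>

lemma resolved_divide:
  assumes "resolved l G (a, b)" "poly2 e" "e (a, b) \<noteq> 0" "(i + j) * 2 ^ l < N"
    "0 < i \<Longrightarrow> \<forall>y. G (a, y) = 0" "0 < j \<Longrightarrow> \<forall>x. G (x, b) = 0"
  shows "resolved l (\<lambda>z. G z ^ N / ((fst z - a) ^ i * (snd z - b) ^ j * e z)) (a, b)"
  using assms
proof (induction l arbitrary: G a b e i j)
  case 0
  then show ?case using regular_divide[of G a b e i N j] by simp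
next
  case (Suc l G a b e i j)
  let ?h = "\<lambda>z. G z ^ N / ((fst z - a) ^ i * (snd z - b) ^ j * e z)"
  have "(2 * (i + j)) * 2 ^ l = (i + j) * 2 ^ Suc l" by (simp only: power_Suc mult_ac)
  then have bd: "(2 * (i + j)) * 2 ^ l < N" using Suc.prems(4) by (simp only:)
  have "i + j \<le> (i + j) * 2 ^ Suc l" by simp
  then have N: "i < N" "j < N" using Suc.prems(4) by linarith+
  show ?case
  proof (cases "regular_at G (a, b)")
    case True
    then show ?thesis using regular_divide[OF True Suc.prems(2,3) N Suc.prems(5,6)] by simp
  next
    case False
    then have r: "finite {v. \<not> regular_at (G \<circ> bl1 (a, b)) (0, v)}" "\<And>v. resolved l (G \<circ> bl1 (a, b)) (0, v)"
      "resolved l (G \<circ> bl2 (a, b)) (0, 0)" using Suc.prems(1) by auto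
    have G0: "G (a, b) = 0" if "0 < i + j" using Suc.prems(5,6) that by (cases "0 < i") auto
    \<comment> \<open>Level 0 gives regularity outside finitely many points of the exceptional line,
      level \<open>l\<close> the resolution of every point on it.\<close>
    have chart1: "resolved m (?h \<circ> bl1 (a, b)) (0, v)"
      if m: "resolved m (G \<circ> bl1 (a, b)) (0, v)" "m = 0 \<or> m = l" for m v
    proof -
      have bm: "((i + j) + j) * 2 ^ m < N"
      proof -
        have "((i + j) + j) * 2 ^ m \<le> (2 * (i + j)) * 2 ^ l"
          using m(2) by (intro mult_mono) (auto simp: power_increasing)
        then show ?thesis using bd by (rule le_less_trans)
      qed
      have step: "resolved m (\<lambda>z. (G \<circ> bl1 (a, b)) z ^ N / ((fst z - 0) ^ i' * (snd z - v) ^ j' * e' z)) (0, v)"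
        if "poly2 e'" "e' (0, v) \<noteq> 0" "(i' + j') * 2 ^ m < N"
          "0 < i' \<Longrightarrow> \<forall>y. (G \<circ> bl1 (a, b)) (0, y) = 0" "0 < j' \<Longrightarrow> \<forall>x. (G \<circ> bl1 (a, b)) (x, v) = 0" for i' j' e'
      proof (cases "m = 0")
        case True
        then show ?thesis using regular_divide[of "G \<circ> bl1 (a, b)" 0 v e' i' N j'] that m(1) by simp
      next
        case False
        then show ?thesis using Suc.IH[of "G \<circ> bl1 (a, b)" 0 v e' i' j'] that m by blast
      qed
      have e1: "poly2 (e \<circ> bl1 (a, b))" "(e \<circ> bl1 (a, b)) (0, v) \<noteq> 0"
        using poly2_bl1 Suc.prems(2,3) by (auto simp: bl1_def)
      have v1: "\<forall>y. (G \<circ> bl1 (a, b)) (0, y) = 0" if "0 < i + j" using G0[OF that] by (simp add: bl1_def)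
      show ?thesis
      proof (cases "v = 0")
        case True
        have "?h \<circ> bl1 (a, b) = (\<lambda>z. (G \<circ> bl1 (a, b)) z ^ N / ((fst z - 0) ^ (i + j) * (snd z - v) ^ j * (e \<circ> bl1 (a, b)) z))"
          using True by (auto simp: fun_eq_iff bl1_def power_mult_distrib power_add mult_ac)
        moreover have "\<forall>x. (G \<circ> bl1 (a, b)) (x, v) = 0" if "0 < j" using Suc.prems(6)[OF that] True by (simp add: bl1_def)
        ultimately show ?thesis using step[OF e1 bm v1] by presburger
      next
        \<comment> \<open>Away from the origin of the chart, \<open>snd z ^ j\<close> is nonzero at
          the point considered and joins the unit; only the exceptional line stays in the
          denominator.\<close>
        case False
        have *: "?h \<circ> bl1 (a, b) = (\<lambda>z. (G \<circ> bl1 (a, b)) z ^ N / ((fst z - 0) ^ (i + j) * (snd z - v) ^ 0 * (snd z ^ j * (e \<circ> bl1 (a, b)) z)))"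
          by (auto simp: fun_eq_iff bl1_def power_mult_distrib power_add mult_ac)
        have b0: "((i + j) + 0) * 2 ^ m < N" using bm by (simp add: distrib_right)
        have p: "poly2 (\<lambda>z. snd z ^ j * (e \<circ> bl1 (a, b)) z)" by (intro poly2_intros e1)
        have n: "snd (0, v) ^ j * (e \<circ> bl1 (a, b)) (0, v) \<noteq> 0" using e1(2) False by simp
        show ?thesis unfolding * by (rule step[OF p n b0 v1]) simp_all
      qed
    qed
    have "finite {v. \<not> regular_at (?h \<circ> bl1 (a, b)) (0, v)}"
      using chart1[of 0] by (intro finite_subset[OF _ r(1)]) auto
    moreover have "resolved l (?h \<circ> bl1 (a, b)) (0, v)" for v using chart1[of l] r(2) by blast
    moreover have "resolved l (?h \<circ> bl2 (a, b)) (0, 0)"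
    proof -
      have "(i + (i + j)) * 2 ^ l \<le> (2 * (i + j)) * 2 ^ l" by (intro mult_mono) auto
      then have "(i + (i + j)) * 2 ^ l < N" using bd by (rule le_less_trans)
      moreover have "poly2 (e \<circ> bl2 (a, b))" "(e \<circ> bl2 (a, b)) (0, 0) \<noteq> 0"
        using poly2_bl2 Suc.prems(2,3) by (auto simp: bl2_def)
      moreover have "\<forall>x. (G \<circ> bl2 (a, b)) (x, 0) = 0" if "0 < i + j" using G0[OF that] by (simp add: bl2_def)
      moreover have "\<forall>y. (G \<circ> bl2 (a, b)) (0, y) = 0" if "0 < i" using Suc.prems(5)[OF that] by (simp add: bl2_def)
      ultimately have "resolved l (\<lambda>z. (G \<circ> bl2 (a, b)) z ^ N / ((fst z - 0) ^ i * (snd z - 0) ^ (i + j) * (e \<circ> bl2 (a, b)) z)) (0, 0)"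
        using Suc.IH[OF r(3)] by blast
      moreover have "?h \<circ> bl2 (a, b) = (\<lambda>z. (G \<circ> bl2 (a, b)) z ^ N / ((fst z - 0) ^ i * (snd z - 0) ^ (i + j) * (e \<circ> bl2 (a, b)) z))"
        by (auto simp: fun_eq_iff bl2_def power_mult_distrib power_add mult_ac)
      ultimately show ?thesis by presburger
    qed
    ultimately show ?thesis by auto
  qed
qed

section \<open>Differentiability of quotients\<close>

text \<open>Directions of slope at most \<open>K\<close> are covered by a compact segment of the
  exceptional line in the first chart, where the estimate is uniform; steeper ones lie near the
  origin of the second chart.\<close>

lemma resolved_isCont: "resolved l g x \<Longrightarrow> isCont g x"
proof (induction l arbitrary: g x)
  case 0 then show ?case by (simp add: regular_at_isCont)
next
  case (Suc l g x)
  show ?case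
  proof (cases "regular_at g x")
    case True then show ?thesis by (rule regular_at_isCont)
  next
    case False
    then have c1: "isCont (g \<circ> bl1 x) (0, v)" and c2: "isCont (g \<circ> bl2 x) (0, 0)" for v
      using Suc by auto
    show ?thesis unfolding continuous_at_eps_delta
    proof (intro allI impI)
      fix e :: real assume e: "0 < e"
      obtain d2 where d2: "d2 > 0" "\<And>w. dist w (0, 0) < d2 \<Longrightarrow> dist (g (bl2 x w)) (g x) < e"
        using c2 e unfolding continuous_at_eps_delta by (auto simp: bl2_def)
      \<comment> \<open>Chosen so that \<open>\<bar>Y\<bar> > K * \<bar>X\<bar>\<close> implies
        \<open>\<bar>X / Y\<bar> < d2 / 2\<close>.\<close>
      define K where "K = 2 / d2 + 1"
      have K: "K > 0" using d2 by (simp add: K_def add_pos_pos)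
      define W where "W = {w. dist (g (bl1 x w)) (g x) < e}"
      have sub: "{0} \<times> {- K..K} \<subseteq> interior W"
      proof clarify
        fix v
        obtain d where d: "d > 0" "\<And>w. dist w (0, v) < d \<Longrightarrow> dist (g (bl1 x w)) (g x) < e"
          using c1[of v] e unfolding continuous_at_eps_delta by (auto simp: bl1_def)
        then have "ball (0, v) d \<subseteq> W" by (auto simp: W_def dist_commute)
        then show "(0, v) \<in> interior W" using d(1) centre_in_ball interior_maximal open_ball by blast
      qed
      have "compact ({0::real} \<times> {- K..K})" by (intro compact_Times) auto
      then obtain d1 where d1: "d1 > 0" "(\<Union>w\<in>{0} \<times> {- K..K}. ball w d1) \<subseteq> interior W"
        using compact_subset_open_imp_ball_epsilon_subset[OF _ open_interior sub] by blast
      have near1: "dist (g (bl1 x (u, v))) (g x) < e" if "\<bar>u\<bar> < d1" "\<bar>v\<bar> \<le> K" for u v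
      proof -
        have "(u, v) \<in> ball (0, v) d1" using that by (simp add: dist_Pair_Pair dist_real_def)
        moreover have "(0, v) \<in> {0} \<times> {- K..K}" using that by auto
        ultimately have "(u, v) \<in> interior W" using d1(2) by blast
        then show ?thesis using interior_subset by (auto simp: W_def)
      qed
      define d where "d = min d1 (d2 / 2)"
      have "dist (g y) (g x) < e" if y: "dist y x < d" for y
      proof -
        define X where "X = fst y - fst x" define Y where "Y = snd y - snd x"
        have XY: "\<bar>X\<bar> < d" "\<bar>Y\<bar> < d"
          using y dist_fst_le[of y x] dist_snd_le[of y x] by (auto simp: X_def Y_def dist_real_def)
        show ?thesis
        proof (cases "\<bar>Y\<bar> \<le> K * \<bar>X\<bar>")
          case True
          show ?thesis
          proof (cases "X = 0")
            case True
            then have "Y = 0" using \<open>\<bar>Y\<bar> \<le> K * \<bar>X\<bar>\<close> by simp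
            then have "y = x" using True by (auto simp: X_def Y_def prod_eq_iff)
            then show ?thesis using e by simp
          next
            case False
            then have "\<bar>Y / X\<bar> \<le> K" using True by (simp add: field_simps)
            moreover have "bl1 x (X, Y / X) = y" using False by (simp add: bl1_def X_def Y_def prod_eq_iff)
            ultimately show ?thesis using near1[of X "Y / X"] XY by (simp add: d_def)
          qed
        next
          case False
          then have Y0: "Y \<noteq> 0" using K by auto
          have "\<bar>X / Y\<bar> < d2 / 2"
          proof -
            have "(2 / d2) * \<bar>X\<bar> \<le> K * \<bar>X\<bar>" by (intro mult_right_mono) (auto simp: K_def)
            then have "(2 / d2) * \<bar>X\<bar> < \<bar>Y\<bar>" using False by linarith
            then show ?thesis using Y0 d2(1) by (simp add: field_simps)
          qed
          moreover have "\<bar>Y\<bar> < d2 / 2" using XY by (simp add: d_def)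
          moreover have "norm (X / Y, Y) \<le> \<bar>X / Y\<bar> + \<bar>Y\<bar>" using norm_Pair_le[of "X / Y" Y] by (simp only: real_norm_def)
          ultimately have "norm (X / Y, Y) < d2" by linarith
          then have "dist (X / Y, Y) (0, 0) < d2" by (simp add: dist_norm)
          moreover have "bl2 x (X / Y, Y) = y" using Y0 by (simp add: bl2_def X_def Y_def prod_eq_iff)
          ultimately show ?thesis using d2(2)[of "(X / Y, Y)"] by simp
        qed
      qed
      then show "\<exists>d>0. \<forall>x'. dist x' x < d \<longrightarrow> dist (g x') (g x) < e"
        using d1 d2 by (intro exI[of _ d]) (auto simp: d_def)
    qed
  qed
qed

declare split_paired_All [simp del] split_paired_Ex [simp del]

lemma frechet_derivative_eqI: "(f has_derivative f') (at x) \<Longrightarrow> frechet_derivative f (at x) = f'"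
  using frechet_derivative_at by metis

lemma differentiable_has_frechet: "f differentiable (at x) \<Longrightarrow> (f has_derivative frechet_derivative f (at x)) (at x)"
  by (simp add: frechet_derivative_works)

lemma Ck_isCont: "Ck k f \<Longrightarrow> isCont f x"
  by (cases k) (auto simp: continuous_on_eq_continuous_at differentiable_imp_continuous_within)

lemma Ck_SucD: "Ck (Suc k) f \<Longrightarrow> Ck k f"
proof (induction k arbitrary: f)
  case 0 then show ?case using Ck_isCont[OF 0] by (simp add: continuous_on_eq_continuous_at)
next
  case (Suc k)
  have "Ck k (\<lambda>x. frechet_derivative f (at x) (1, 0))" "Ck k (\<lambda>x. frechet_derivative f (at x) (0, 1))"
    using Suc.prems unfolding Ck.simps(2)[of "Suc k"] by (blast intro: Suc.IH)+
  then show ?case using Suc.prems unfolding Ck.simps(2) by blast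
qed

lemma Ck_SucI:
  assumes "\<And>x. (f has_derivative f' x) (at x)" "Ck k (\<lambda>x. f' x (1, 0))" "Ck k (\<lambda>x. f' x (0, 1))"
  shows "Ck (Suc k) f"
proof -
  have "frechet_derivative f (at x) = f' x" for x by (rule frechet_derivative_eqI[OF assms(1)])
  moreover have "f differentiable (at x)" for x using assms(1) by (rule differentiableI)
  ultimately show ?thesis using assms(2,3) by simp
qed

lemma Ck_const: "Ck k (\<lambda>_. c)"
  by (induction k arbitrary: c) (auto intro!: Ck_SucI[where f' = "\<lambda>_ _. 0", simplified])

lemma Ck_fst: "Ck k fst"
proof (cases k)
  case (Suc j)
  have "Ck (Suc j) fst" by (rule Ck_SucI[where f' = "\<lambda>_. fst"]) (auto intro!: derivative_eq_intros Ck_const)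
  then show ?thesis by (simp only: Suc)
qed (auto intro!: continuous_intros)

lemma Ck_snd: "Ck k snd"
proof (cases k)
  case (Suc j)
  have "Ck (Suc j) snd" by (rule Ck_SucI[where f' = "\<lambda>_. snd"]) (auto intro!: derivative_eq_intros Ck_const)
  then show ?thesis by (simp only: Suc)
qed (auto intro!: continuous_intros)

lemma Ck_add: "Ck k f \<Longrightarrow> Ck k g \<Longrightarrow> Ck k (\<lambda>x. f x + g x)"
proof (induction k arbitrary: f g)
  case 0 then show ?case by (auto intro!: continuous_intros)
next
  case (Suc k)
  show ?case
    by (rule Ck_SucI[where f' = "\<lambda>x v. frechet_derivative f (at x) v + frechet_derivative g (at x) v"])
      (use Suc in \<open>auto intro!: has_derivative_add differentiable_has_frechet\<close>)
qed

lemma Ck_mult: "Ck k f \<Longrightarrow> Ck k g \<Longrightarrow> Ck k (\<lambda>x. f x * g x)"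
proof (induction k arbitrary: f g)
  case 0 then show ?case by (auto intro!: continuous_intros)
next
  case (Suc k)
  have fg: "Ck k f" "Ck k g" using Ck_SucD[OF Suc.prems(1)] Ck_SucD[OF Suc.prems(2)] by simp_all
  show ?case
    by (rule Ck_SucI[where f' = "\<lambda>x v. f x * frechet_derivative g (at x) v + frechet_derivative f (at x) v * g x"])
      (use Suc fg in \<open>auto intro!: has_derivative_mult differentiable_has_frechet Ck_add\<close>)
qed

lemma Ck_poly2: "poly2 p \<Longrightarrow> Ck k p"
  by (induction p rule: poly2_induct) (auto intro: Ck_const Ck_fst Ck_snd Ck_add Ck_mult)

definition sqdist :: "real \<times> real \<Rightarrow> real \<times> real \<Rightarrow> real" where
  "sqdist c z = (fst z - fst c) ^ 2 + (snd z - snd c) ^ 2"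

lemma poly2_sqdist: "poly2 (sqdist c)"
  unfolding sqdist_def by (intro poly2_intros)

lemma sqdist_dist: "sqdist c z = dist z c ^ 2"
  by (cases z, cases c) (simp add: sqdist_def dist_Pair_Pair dist_real_def)

lemma sqdist_eq_0_iff: "sqdist c z = 0 \<longleftrightarrow> z = c"
  by (simp add: sqdist_dist)

lemma sqdist_self [simp]: "sqdist c c = 0"
  by (simp add: sqdist_dist)

lemma sqdist_has_derivative:
  "(sqdist c has_derivative (\<lambda>v. 2 * (fst z - fst c) * fst v + 2 * (snd z - snd c) * snd v)) (at z)"
  unfolding sqdist_def by (auto intro!: derivative_eq_intros simp: fun_eq_iff algebra_simps)

lemma sqdist_bound:
  assumes "f differentiable (at c)" "f c = 0"
  shows "\<exists>C. eventually (\<lambda>z. f z ^ 2 \<le> C * sqdist c z) (nhds c)"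
proof -
  obtain f' where f': "(f has_derivative f') (at c)" using assms(1) by (auto simp: differentiable_def)
  then obtain B where B: "\<And>v. norm (f' v) \<le> norm v * B"
    using has_derivative_bounded_linear bounded_linear.bounded by blast
  obtain d where d: "d > 0" "\<And>z. norm (z - c) < d \<Longrightarrow> norm (f z - f c - f' (z - c)) \<le> 1 * norm (z - c)"
    using f' unfolding has_derivative_at_alt by (metis zero_less_one)
  have "f z ^ 2 \<le> (1 + \<bar>B\<bar>) ^ 2 * sqdist c z" if "dist z c < d" for z
  proof -
    have "\<bar>f z\<bar> \<le> \<bar>f z - f' (z - c)\<bar> + \<bar>f' (z - c)\<bar>" by linarith
    also have "\<dots> \<le> dist z c + dist z c * B"
      using d(2)[of z] B[of "z - c"] that assms(2) by (intro add_mono) (auto simp: dist_norm)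
    also have "\<dots> \<le> (1 + \<bar>B\<bar>) * dist z c"
      using mult_left_mono[of B "\<bar>B\<bar>" "dist z c"] by (simp add: algebra_simps)
    finally have "\<bar>f z\<bar> ^ 2 \<le> ((1 + \<bar>B\<bar>) * dist z c) ^ 2" by (rule power_mono) simp
    then show ?thesis by (simp add: sqdist_dist power_mult_distrib)
  qed
  then show ?thesis using d(1) unfolding eventually_nhds_metric by blast
qed

lemma isCont_eventually_bounded:
  fixes f :: "real \<times> real \<Rightarrow> real"
  assumes "isCont f c" "\<bar>f c\<bar> < K" shows "eventually (\<lambda>z. \<bar>f z\<bar> \<le> K) (nhds c)"
proof -
  obtain d where d: "d > 0" "\<And>z. dist z c < d \<Longrightarrow> dist (f z) (f c) < K - \<bar>f c\<bar>"
    using assms unfolding continuous_at_eps_delta by (metis diff_gt_0_iff_gt)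
  have "\<bar>f z\<bar> \<le> K" if "dist z c < d" for z using d(2)[OF that] by (simp add: dist_real_def)
  then show ?thesis using d(1) unfolding eventually_nhds_metric by blast
qed

text \<open>Of the power \<open>f ^ N\<close>, \<open>2 * M + 2\<close> factors produce
  \<open>sqdist c z ^ (M + 1)\<close>, one more than the denominator. The surplus gives both
  continuity at \<open>c\<close> and a vanishing derivative there.\<close>

lemma quotient_bound:
  assumes f: "f differentiable (at c)" "f c = 0" and \<Phi>: "isCont \<Phi> c" and M: "M > 0" and N: "N \<ge> 2 * M + 2"
  shows "\<exists>K. eventually (\<lambda>z. \<bar>\<Phi> z * f z ^ N / sqdist c z ^ M\<bar> \<le> K * sqdist c z) (nhds c)"
proof -
  obtain C where C: "eventually (\<lambda>z. f z ^ 2 \<le> C * sqdist c z) (nhds c)" using sqdist_bound[OF f] by blast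
  have f1: "eventually (\<lambda>z. \<bar>f z\<bar> \<le> 1) (nhds c)"
    by (rule isCont_eventually_bounded) (use f in \<open>auto intro: differentiable_imp_continuous_within\<close>)
  have P1: "eventually (\<lambda>z. \<bar>\<Phi> z\<bar> \<le> \<bar>\<Phi> c\<bar> + 1) (nhds c)"
    by (rule isCont_eventually_bounded[OF \<Phi>]) simp
  have "eventually (\<lambda>z. \<bar>\<Phi> z * f z ^ N / sqdist c z ^ M\<bar> \<le> ((\<bar>\<Phi> c\<bar> + 1) * C ^ (M + 1)) * sqdist c z) (nhds c)"
    using C f1 P1
  proof eventually_elim
    case (elim z)
    define r where "r = sqdist c z"
    show ?case
    proof (cases "r = 0")
      case False
      then have r: "r > 0" by (simp add: r_def sqdist_dist)
      have "\<bar>f z\<bar> ^ N = (f z ^ 2) ^ (M + 1) * \<bar>f z\<bar> ^ (N - (2 * M + 2))"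
      proof -
        have "N = 2 * (M + 1) + (N - (2 * M + 2))" using N by simp
        then have "\<bar>f z\<bar> ^ N = \<bar>f z\<bar> ^ (2 * (M + 1)) * \<bar>f z\<bar> ^ (N - (2 * M + 2))"
          by (metis power_add)
        then show ?thesis by (simp only: power_mult power2_abs)
      qed
      also have "\<dots> \<le> (C * r) ^ (M + 1) * 1"
      proof (rule mult_mono)
        have cr: "0 \<le> C * r" using elim(1) order_trans[OF zero_le_power2] by (simp add: r_def)
        then show "0 \<le> (C * r) ^ (M + 1)" by (rule zero_le_power)
        show "(f z ^ 2) ^ (M + 1) \<le> (C * r) ^ (M + 1)" using elim(1) by (intro power_mono) (auto simp: r_def)
      qed (use elim in \<open>auto intro: power_le_one\<close>)
      finally have fN: "\<bar>f z\<bar> ^ N \<le> C ^ (M + 1) * r ^ (M + 1)" by (simp only: power_mult_distrib mult_1_right)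
      have "\<bar>\<Phi> z * f z ^ N / r ^ M\<bar> = \<bar>\<Phi> z\<bar> * \<bar>f z\<bar> ^ N / r ^ M" using r by (simp add: abs_mult power_abs)
      also have "\<dots> \<le> (\<bar>\<Phi> c\<bar> + 1) * (C ^ (M + 1) * r ^ (M + 1)) / r ^ M"
        using r elim fN by (intro divide_right_mono mult_mono) auto
      also have "\<dots> = ((\<bar>\<Phi> c\<bar> + 1) * C ^ (M + 1)) * r" using r by simp
      finally show ?thesis by (simp add: r_def)
    qed (use M in \<open>simp add: r_def zero_power\<close>)
  qed
  then show ?thesis by blast
qed

text \<open>The factor \<open>\<Phi>\<close> makes this class of quotients closed under
  differentiation. A derivative lowers \<open>N\<close> by at most one or raises \<open>M\<close> by
  one, and the bound on \<open>N\<close> survives because \<open>j\<close> drops by one.\<close>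

lemma Ck_quotient:
  assumes f: "f differentiable (at c)" "f c = 0"
  shows "Ck j f \<Longrightarrow> Ck j \<Phi> \<Longrightarrow> M > 0 \<Longrightarrow> N \<ge> 2 * M + 2 * j + 2 \<Longrightarrow>
    Ck j (\<lambda>z. \<Phi> z * f z ^ N / sqdist c z ^ M)"
proof (induction j arbitrary: \<Phi> M N)
  case (0 \<Phi> M N)
  let ?H = "\<lambda>z. \<Phi> z * f z ^ N / sqdist c z ^ M"
  have "isCont ?H z" for z
  proof (cases "z = c")
    case False
    then show ?thesis using 0 poly2_isCont[OF poly2_sqdist]
      by (auto intro!: continuous_intros simp: sqdist_eq_0_iff continuous_on_eq_continuous_at)
  next
    case True
    have "2 * M + 2 \<le> N" using 0(4) by simp
    from quotient_bound[OF f Ck_isCont[OF 0(2)] 0(3) this]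
    obtain K where K: "eventually (\<lambda>z. \<bar>?H z\<bar> \<le> K * sqdist c z) (nhds c)" by blast
    have "isCont (\<lambda>z. K * sqdist c z) c" using poly2_isCont[OF poly2_sqdist] by (rule isCont_mult[OF continuous_const])
    then have lim: "((\<lambda>z. K * sqdist c z) \<longlongrightarrow> 0) (at c)"
      unfolding isCont_def using sqdist_eq_0_iff[of c c] by simp
    have "eventually (\<lambda>z. norm (?H z) \<le> K * sqdist c z) (at c)"
      using K unfolding eventually_nhds_conv_at real_norm_def by (rule conjunct1)
    then have "(?H \<longlongrightarrow> 0) (at c)" using lim by (rule Lim_null_comparison)
    moreover have "?H c = 0" using 0(3) sqdist_eq_0_iff[of c c] by (simp add: zero_power)
    ultimately show ?thesis using True unfolding isCont_def by (simp only:)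
  qed
  then show ?case by (simp add: continuous_on_eq_continuous_at)
next
  case (Suc j \<Phi> M N)
  let ?H = "\<lambda>z. \<Phi> z * f z ^ N / sqdist c z ^ M"
  let ?d = "\<lambda>g z. frechet_derivative g (at z)"
  let ?r' = "\<lambda>z v. 2 * (fst z - fst c) * fst v + 2 * (snd z - snd c) * snd v"
  \<comment> \<open>The quotient rule, sorted into three quotients of the same shape with exponents
    \<open>(N, M)\<close>, \<open>(N - 1, M)\<close> and \<open>(N, M + 1)\<close>.\<close>
  let ?H' = "\<lambda>z v. ?d \<Phi> z v * f z ^ N / sqdist c z ^ M
     + (real N * \<Phi> z * ?d f z v) * f z ^ (N - 1) / sqdist c z ^ M
     + (- real M * \<Phi> z * ?r' z v) * f z ^ N / sqdist c z ^ (M + 1)"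
  have D: "(\<Phi> has_derivative ?d \<Phi> z) (at z)" "(f has_derivative ?d f z) (at z)" for z
    using Suc.prems by (auto intro: differentiable_has_frechet)
  have hd: "(?H has_derivative ?H' z) (at z)" for z
  proof (cases "z = c")
    case False
    define s where "s = sqdist c z"
    have s: "s \<noteq> 0" using False by (simp add: s_def sqdist_eq_0_iff)
    define t where "t = s ^ (M - 1)"
    have t: "t \<noteq> 0" "s ^ M = s * t" "s ^ (M + 1) = s * (s * t)"
      using s Suc.prems(3) by (cases M; simp add: t_def)+
    have num: "((\<lambda>z. \<Phi> z * f z ^ N) has_derivative
        (\<lambda>v. \<Phi> z * (real N * ?d f z v * f z ^ (N - 1)) + ?d \<Phi> z v * f z ^ N)) (at z)"
      by (intro has_derivative_mult has_derivative_power D)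
    have den: "((\<lambda>z. sqdist c z ^ M) has_derivative (\<lambda>v. real M * ?r' z v * s ^ (M - 1))) (at z)"
      unfolding s_def by (intro has_derivative_power sqdist_has_derivative)
    have "(?H has_derivative (\<lambda>v. ((\<Phi> z * (real N * ?d f z v * f z ^ (N - 1)) + ?d \<Phi> z v * f z ^ N) * sqdist c z ^ M
        - \<Phi> z * f z ^ N * (real M * ?r' z v * s ^ (M - 1))) / (sqdist c z ^ M * sqdist c z ^ M))) (at z)"
      using num den by (rule has_derivative_divide') (simp add: s flip: s_def)
    moreover have "((\<Phi>' * (n * df * F) + d\<Phi> * FN) * (s * t) - \<Phi>' * FN * (m * r * t)) / ((s * t) * (s * t))
       = d\<Phi> * FN / (s * t) + (n * \<Phi>' * df) * F / (s * t) + (- m * \<Phi>' * r) * FN / (s * (s * t))"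
      for \<Phi>' n df F d\<Phi> FN m r :: real
      using s t(1) by (simp add: field_simps)
    ultimately show ?thesis unfolding s_def[symmetric] t_def[symmetric] t(2,3) by (simp only:)
  next
    case True
    \<comment> \<open>At \<open>c\<close> the candidate is 0 by division by zero, and the bound by
      \<open>K * sqdist c z\<close> makes the true derivative 0 as well.\<close>
    have H0: "?H' z = (\<lambda>v. 0)" using True Suc.prems(3) by (auto simp: fun_eq_iff sqdist_eq_0_iff zero_power)
    have "2 * M + 2 \<le> N" using Suc.prems(4) by simp
    from quotient_bound[OF f Ck_isCont[OF Suc.prems(2)] Suc.prems(3) this]
    obtain K where "eventually (\<lambda>z. \<bar>?H z\<bar> \<le> K * sqdist c z) (nhds c)" by blast
    then obtain d where d: "d > 0" "\<And>z. dist z c < d \<Longrightarrow> \<bar>?H z\<bar> \<le> K * sqdist c z"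
      unfolding eventually_nhds_metric by blast
    have Hc: "?H c = 0" using Suc.prems(3) by (simp add: sqdist_eq_0_iff zero_power)
    have "(?H has_derivative (\<lambda>v. 0)) (at c)"
      unfolding has_derivative_at_alt
    proof (intro conjI allI impI)
      show "bounded_linear (\<lambda>v::real \<times> real. 0::real)" by (rule bounded_linear_zero)
      fix e :: real assume e: "0 < e"
      define d' where "d' = min d (e / (\<bar>K\<bar> + 1))"
      have "norm (?H y - ?H c - 0) \<le> e * norm (y - c)" if y: "norm (y - c) < d'" for y
      proof -
        have "\<bar>?H y\<bar> \<le> K * norm (y - c) ^ 2" using d(2)[of y] y by (simp add: d'_def sqdist_dist dist_norm)
        also have "\<dots> \<le> (\<bar>K\<bar> + 1) * norm (y - c) ^ 2" by (intro mult_right_mono) auto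
        also have "\<dots> = ((\<bar>K\<bar> + 1) * norm (y - c)) * norm (y - c)" by (simp add: power2_eq_square)
        also have "\<dots> \<le> e * norm (y - c)"
          using y by (intro mult_right_mono) (auto simp: d'_def field_simps)
        finally show ?thesis unfolding Hc real_norm_def by (simp only: diff_0_right)
      qed
      moreover have "d' > 0" using d e by (simp add: d'_def add_nonneg_pos)
      ultimately show "\<exists>d>0. \<forall>y. norm (y - c) < d \<longrightarrow> norm (?H y - ?H c - 0) \<le> e * norm (y - c)" by blast
    qed
    then show ?thesis unfolding H0 using True by simp
  qed
  have ck: "Ck j (\<lambda>z. ?H' z v)" if "Ck j (\<lambda>z. ?d \<Phi> z v)" "Ck j (\<lambda>z. ?d f z v)" for v
  proof -
    have f\<Phi>: "Ck j f" "Ck j \<Phi>" using Suc.prems Ck_SucD by blast+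
    have "poly2 (\<lambda>z. ?r' z v)" by (intro poly2_intros)
    then have r: "Ck j (\<lambda>z. ?r' z v)" by (rule Ck_poly2)
    show ?thesis
    proof (intro Ck_add)
      show "Ck j (\<lambda>z. ?d \<Phi> z v * f z ^ N / sqdist c z ^ M)"
        using Suc.prems f\<Phi> that by (intro Suc.IH) auto
      show "Ck j (\<lambda>z. (real N * \<Phi> z * ?d f z v) * f z ^ (N - 1) / sqdist c z ^ M)"
        using Suc.prems f\<Phi> that by (intro Suc.IH Ck_mult Ck_const) auto
      show "Ck j (\<lambda>z. (- real M * \<Phi> z * ?r' z v) * f z ^ N / sqdist c z ^ (M + 1))"
        using Suc.prems f\<Phi> r by (intro Suc.IH Ck_mult Ck_const) auto
    qed
  qed
  show ?case by (rule Ck_SucI[where f' = ?H', OF hd ck ck]) (use Suc.prems(1,2) in simp_all)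
qed

section \<open>Ring elements and cones\<close>

lemma RklD:
  assumes "f \<in> Rkl k l"
  shows "Ck k f" "finite {x. \<not> regular_at f x}" "resolved l f x" "isCont f x"
  using assms Ck_isCont[of k f x] by (auto simp: Rkl_def regulous_def)

text \<open>Rationality follows from regularity at a single point, which exists because the plane is
  infinite.\<close>

lemma RklI:
  assumes "Ck k f" "finite {x. \<not> regular_at f x}" "\<And>x. resolved l f x"
  shows "f \<in> Rkl k l"
proof -
  have "infinite (UNIV :: (real \<times> real) set)" by (simp add: finite_prod infinite_UNIV_char_0)
  then have "\<exists>x. regular_at f x" using ex_new_if_finite[OF _ assms(2)] by auto
  then show ?thesis unfolding Rkl_def regulous_def rational2_iff using assms by blast
qed

lemma regular_at_resolved: "regular_at f x \<Longrightarrow> resolved l f x"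
  by (cases l) auto

lemma poly2_Rkl: assumes "poly2 p" shows "p \<in> Rkl k l"
  by (rule RklI) (simp_all add: assms Ck_poly2 poly2_regular_at regular_at_resolved)

text \<open>In the charts at \<open>c\<close>, \<open>sqdist c\<close> becomes
  \<open>u ^ 2 * (1 + v ^ 2)\<close> and \<open>v ^ 2 * (1 + u ^ 2)\<close>: a power of the
  exceptional equation times a unit. The pullback of \<open>f\<close> vanishes on the exceptional
  line, so \<open>resolved_divide\<close> applies in each chart with one stage fewer.\<close>

lemma Rkl_divide_sqdist:
  assumes f: "f \<in> Rkl k l" and c: "f c = 0" "\<not> regular_at f c"
  shows "\<exists>N. \<exists>h\<in>Rkl k l. \<forall>z. f z ^ N = sqdist c z * h z"
proof -
  \<comment> \<open>\<open>2 * 2 ^ l\<close> is what \<open>resolved_divide\<close> asks for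
    exponent 2, and \<open>2 * k + 4\<close> what \<open>Ck_quotient\<close> asks for
    \<open>M = 1\<close> and \<open>j = k\<close>.\<close>
  define N where "N = 2 * 2 ^ l + 2 * k + 4"
  define h where "h = (\<lambda>z. f z ^ N / sqdist c z)"
  have N0: "N > 0" by (simp add: N_def)
  obtain a b where ab: "c = (a, b)" by (cases c)
  have away: "resolved m h z" if "z \<noteq> c" "resolved m f z" for m z
  proof -
    obtain x y where z: "z = (x, y)" by (cases z)
    have "resolved m (\<lambda>z. f z ^ N / ((fst z - x) ^ 0 * (snd z - y) ^ 0 * sqdist c z)) (x, y)"
      using that N0 by (intro resolved_divide) (auto simp: z poly2_sqdist sqdist_eq_0_iff)
    then show ?thesis by (simp add: h_def z)
  qed
  obtain l' where l': "l = Suc l'" using RklD(3)[OF f, of c] c(2) by (cases l) auto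
  then have r: "finite {v. \<not> regular_at (f \<circ> bl1 c) (0, v)}" "\<And>v. resolved l' (f \<circ> bl1 c) (0, v)"
      "resolved l' (f \<circ> bl2 c) (0, 0)" using RklD(3)[OF f, of c] c(2) by auto
  have N1: "(2 + 0) * 2 ^ m < N" "(0 + 2) * 2 ^ m < N" if "m \<le> l" for m :: nat
  proof -
    have "(2::nat) ^ m \<le> 2 ^ l" using that by (intro power_increasing) auto
    moreover have "x \<le> y \<Longrightarrow> (2 + 0) * x < 2 * y + 2 * k + 4" "x \<le> y \<Longrightarrow> (0 + 2) * x < 2 * y + 2 * k + 4" for x y :: nat
      by simp_all
    ultimately show "(2 + 0) * 2 ^ m < N" "(0 + 2) * 2 ^ m < N" unfolding N_def by blast+
  qed
  have ne: "1 + t ^ 2 \<noteq> 0" for t :: real using zero_le_power2[of t] by linarith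
  have h1: "h \<circ> bl1 c = (\<lambda>w. (f \<circ> bl1 c) w ^ N / ((fst w - 0) ^ 2 * (snd w - v) ^ 0 * (1 + snd w ^ 2)))" for v
    by (auto simp: fun_eq_iff h_def bl1_def sqdist_def power_mult_distrib distrib_left)
  have h2: "h \<circ> bl2 c = (\<lambda>w. (f \<circ> bl2 c) w ^ N / ((fst w - 0) ^ 0 * (snd w - 0) ^ 2 * (1 + fst w ^ 2)))"
    by (auto simp: fun_eq_iff h_def bl2_def sqdist_def power_mult_distrib algebra_simps)
  have chart1: "resolved m (h \<circ> bl1 c) (0, v)" if m: "resolved m (f \<circ> bl1 c) (0, v)" "m \<le> l" for m v
    unfolding h1[of v]
  proof (rule resolved_divide[OF m(1) _ _ N1(1)[OF m(2)]])
    show "poly2 (\<lambda>w. 1 + snd w ^ 2)" by (intro poly2_intros)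
    show "1 + snd (0, v) ^ 2 \<noteq> 0" using ne by simp
    show "\<forall>y. (f \<circ> bl1 c) (0, y) = 0" using c(1) by (simp add: bl1_def)
  qed simp
  have chart2: "resolved l' (h \<circ> bl2 c) (0, 0)"
    unfolding h2
  proof (rule resolved_divide[OF r(3) _ _ N1(2)])
    show "l' \<le> l" by (simp add: l')
    show "poly2 (\<lambda>w. 1 + fst w ^ 2)" by (intro poly2_intros)
    show "1 + fst (0::real, 0::real) ^ 2 \<noteq> 0" using ne by simp
    show "\<forall>y. (f \<circ> bl2 c) (y, 0) = 0" using c(1) by (simp add: bl2_def)
  qed simp
  have "finite {v. \<not> regular_at (h \<circ> bl1 c) (0, v)}"
    using chart1[of 0] by (intro finite_subset[OF _ r(1)]) auto
  then have "resolved l h c" using chart1[of l'] r(2) chart2 by (simp add: l')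
  then have res: "resolved l h z" for z using away RklD(3)[OF f] by (cases "z = c") auto
  have "{z. \<not> regular_at h z} \<subseteq> insert c {z. \<not> regular_at f z}" using away[of _ 0] by auto
  then have fin: "finite {z. \<not> regular_at h z}" using RklD(2)[OF f] finite_subset by blast
  have "Ck k h"
  proof (cases k)
    case 0
    then show ?thesis using resolved_isCont[OF res] by (simp add: continuous_on_eq_continuous_at)
  next
    case (Suc k')
    have fk: "Ck (Suc k') f" using RklD(1)[OF f] Suc by simp
    then have "f differentiable (at c)" by simp
    from Ck_quotient[OF this c(1) fk Ck_const[of "Suc k'" 1], of 1 N]
    show ?thesis by (simp add: h_def N_def Suc del: Ck.simps)
  qed
  then have "h \<in> Rkl k l" using fin res by (rule RklI)
  moreover have "f z ^ N = sqdist c z * h z" for z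
    using c(1) N0 sqdist_eq_0_iff[of c z] by (cases "z = c") (auto simp: h_def zero_power)
  ultimately show ?thesis by blast
qed

text \<open>The equation is clear where \<open>q\<close> is nonzero. Any point is joined to
  \<open>x\<close> by a line on which \<open>q\<close> has finitely many zeros, and continuity along
  it does the rest.\<close>

lemma regular_denominator:
  assumes cont: "\<And>x. isCont g x" and reg: "regular_at g x"
  shows "\<exists>p q. poly2 p \<and> poly2 q \<and> q x \<noteq> 0 \<and> (\<forall>y. q y * g y = p y)"
proof -
  obtain p q where pq: "poly2 p" "poly2 q" "q x \<noteq> 0" "\<And>y. q y \<noteq> 0 \<Longrightarrow> g y = p y / q y"
    using reg regular_at_iff by auto
  obtain D where D: "q = pfun D" using pq(2) poly2_iff by auto
  have "q y * g y = p y" for y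
  proof -
    define L where "L t = (fst y + t * (fst x - fst y), snd y + t * (snd x - snd y))" for t
    define R where "R = ev (\<lambda>r. [:r:]) D [:fst y, fst x - fst y:] [:snd y, snd x - snd y:]"
    have R: "poly R t = q (L t)" for t
      unfolding R_def using rhom_ev_comp[OF rhom_poly[of t] rhom_const_poly, of D]
      by (simp add: D pfun_def L_def)
    have "poly R 1 \<noteq> 0" using pq(3) by (simp add: R L_def)
    then have "R \<noteq> 0" by auto
    then have "finite {t. poly R t = 0}" by (rule poly_roots_finite)
    then have "\<not> 0 islimpt {t. poly R t = 0}" by (simp add: islimpt_finite)
    then have "eventually (\<lambda>t. q (L t) \<noteq> 0) (at 0)" by (simp add: islimpt_iff_eventually R)
    then have ev0: "eventually (\<lambda>t. q (L t) * g (L t) - p (L t) = 0) (at 0)"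
      by (rule eventually_mono) (simp add: pq(4))
    have L0: "L 0 = y" by (simp add: L_def)
    have cL: "isCont L 0" unfolding L_def by (intro continuous_intros)
    have "isCont (\<lambda>t. q (L t) * g (L t) - p (L t)) 0"
      using isCont_o2[OF cL, of q] isCont_o2[OF cL, of g] isCont_o2[OF cL, of p] poly2_isCont pq(1,2) cont
      by (intro continuous_intros) auto
    then have "((\<lambda>t. q (L t) * g (L t) - p (L t)) \<longlongrightarrow> q y * g y - p y) (at 0)" by (simp add: isCont_def L0)
    moreover have "((\<lambda>t. q (L t) * g (L t) - p (L t)) \<longlongrightarrow> 0) (at 0)" using ev0 by (rule tendsto_eventually)
    ultimately have "q y * g y - p y = 0" using tendsto_unique[OF trivial_limit_at] by blast
    then show ?thesis by simp
  qed
  then show ?thesis using pq by blast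
qed

text \<open>A member of a countable basis that meets \<open>S\<close> in one isolated point only
  identifies this point.\<close>

lemma countable_isolated_points:
  fixes S :: "'a::second_countable_topology set"
  shows "countable {x \<in> S. \<not> x islimpt S}"
proof -
  obtain B :: "'a set set" where B: "countable B" "topological_basis B" using ex_countable_basis by blast
  define X where "X = {x \<in> S. \<not> x islimpt S}"
  have "\<forall>x\<in>X. \<exists>b. b \<in> B \<and> b \<inter> S = {x}"
  proof
    fix x assume "x \<in> X"
    then have x: "x \<in> S" "\<not> x islimpt S" by (simp_all add: X_def)
    obtain T where T: "x \<in> T" "open T" "\<And>y. y \<in> S \<Longrightarrow> y \<in> T \<Longrightarrow> y = x"
      using x(2) unfolding islimpt_def by blast
    obtain b where "b \<in> B" "x \<in> b" "b \<subseteq> T" by (rule topological_basisE[OF B(2) T(2,1)])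
    then have "b \<in> B \<and> b \<inter> S = {x}" using T(3) x(1) by blast
    then show "\<exists>b. b \<in> B \<and> b \<inter> S = {x}" ..
  qed
  from bchoice[OF this] obtain \<beta> where \<beta>: "\<forall>x\<in>X. \<beta> x \<in> B \<and> \<beta> x \<inter> S = {x}" ..
  have inj: "inj_on \<beta> X"
  proof (rule inj_onI)
    fix x y assume "x \<in> X" "y \<in> X" "\<beta> x = \<beta> y"
    then have "{x} = {y}" using bspec[OF \<beta>, of x] bspec[OF \<beta>, of y] by (simp only:)
    then show "x = y" by simp
  qed
  have "\<beta> ` X \<subseteq> B" using \<beta> by blast
  then have "countable (\<beta> ` X)" using B(1) by (rule countable_subset)
  then have "countable X" using inj by (rule countable_image_inj_on)
  then show ?thesis by (simp only: X_def)
qed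

section \<open>Sums of squares and maximal cones\<close>

inductive_set sos :: "'a::comm_ring_1 set \<Rightarrow> 'a set" for A where
  sos_zero: "0 \<in> sos A"
| sos_square: "a \<in> A \<Longrightarrow> s \<in> sos A \<Longrightarrow> a * a + s \<in> sos A"

lemma sos_add: "s \<in> sos A \<Longrightarrow> t \<in> sos A \<Longrightarrow> s + t \<in> sos A"
  by (induction rule: sos.induct) (auto simp: add.assoc intro: sos.intros)

lemma sos_mult_square:
  assumes "\<And>a b. a \<in> A \<Longrightarrow> b \<in> A \<Longrightarrow> a * b \<in> A" "s \<in> sos A" "a \<in> A"
  shows "a * a * s \<in> sos A"
  using assms(2)
proof induction
  case (sos_square b s)
  have "(a * b) * (a * b) + a * a * s \<in> sos A" using assms sos_square by (intro sos.sos_square) auto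
  then show ?case by (simp add: algebra_simps)
qed (simp add: sos.sos_zero)

lemma sos_mult:
  assumes "\<And>a b. a \<in> A \<Longrightarrow> b \<in> A \<Longrightarrow> a * b \<in> A" "s \<in> sos A" "t \<in> sos A"
  shows "s * t \<in> sos A"
  using assms(2)
proof induction
  case (sos_square a s)
  then show ?case
    using sos_add[OF sos_mult_square[OF assms(1,3) sos_square(1)] sos_square(3)] by (simp add: distrib_right)
qed (simp add: sos.sos_zero)

lemma sos_subset:
  assumes "0 \<in> A" "\<And>a b. a \<in> A \<Longrightarrow> b \<in> A \<Longrightarrow> a * b \<in> A" "\<And>a b. a \<in> A \<Longrightarrow> b \<in> A \<Longrightarrow> a + b \<in> A"
  shows "sos A \<subseteq> A"
proof
  fix s assume "s \<in> sos A" then show "s \<in> A" by induction (use assms in auto)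
qed

lemma sos_eq_sum:
  assumes "s \<in> sos A" shows "\<exists>(p::nat) b. (\<forall>i<p. b i \<in> A) \<and> s = (\<Sum>i<p. b i * b i)"
  using assms
proof induction
  case sos_zero then show ?case by (intro exI[of _ 0]) auto
next
  case (sos_square a s)
  then obtain p :: nat and b where b: "\<forall>i<p. b i \<in> A" "s = (\<Sum>i<p. b i * b i)" by blast
  have "(\<Sum>i<Suc p. (b(p := a)) i * (b(p := a)) i) = a * a + s" by (simp add: b(2) add.commute)
  then show ?case using b(1) sos_square(1) by (intro exI[of _ "Suc p"] exI[of _ "b(p := a)"]) (auto simp: less_Suc_eq)
qed

text \<open>The ring is a subset \<open>A\<close> of a type, which suits rings of functions. The
  last assumption places \<open>f\<close> outside the real radical of \<open>I\<close>.\<close>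

locale formally_real_pair =
  fixes A I :: "'a::comm_ring_1 set" and f :: 'a
  assumes A: "0 \<in> A" "1 \<in> A" "\<And>a b. a \<in> A \<Longrightarrow> b \<in> A \<Longrightarrow> a + b \<in> A" "\<And>a b. a \<in> A \<Longrightarrow> b \<in> A \<Longrightarrow> a * b \<in> A"
      "\<And>a. a \<in> A \<Longrightarrow> - a \<in> A"
    and I: "0 \<in> I" "I \<subseteq> A" "\<And>a b. a \<in> I \<Longrightarrow> b \<in> I \<Longrightarrow> a + b \<in> I" "\<And>a b. a \<in> A \<Longrightarrow> b \<in> I \<Longrightarrow> a * b \<in> I"
    and f: "f \<in> A" "\<And>m s. s \<in> sos A \<Longrightarrow> f ^ (2 * m) + s \<notin> I"
begin

text \<open>Excluding every \<open>- (f ^ (2 * m))\<close>, and not only \<open>- 1\<close> (the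
  case \<open>m = 0\<close>), keeps \<open>f\<close> out of the support; the excluded family is
  stable under products up to sign.\<close>

definition cones :: "'a set set" where
  "cones = {Q. Q \<subseteq> A \<and> (\<forall>a\<in>A. a * a \<in> Q) \<and> I \<subseteq> Q \<and> (\<forall>a\<in>Q. \<forall>b\<in>Q. a + b \<in> Q \<and> a * b \<in> Q) \<and>
     (\<forall>m. - (f ^ (2 * m)) \<notin> Q)}"

lemma conesD:
  assumes "Q \<in> cones"
  shows "a \<in> Q \<Longrightarrow> a \<in> A" "a \<in> A \<Longrightarrow> a * a \<in> Q" "a \<in> I \<Longrightarrow> a \<in> Q" "a \<in> Q \<Longrightarrow> b \<in> Q \<Longrightarrow> a + b \<in> Q"
    "a \<in> Q \<Longrightarrow> b \<in> Q \<Longrightarrow> a * b \<in> Q" "- (f ^ (2 * m)) \<notin> Q" "0 \<in> Q" "1 \<in> Q" "f ^ (2 * m) \<in> Q"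
proof -
  show "a \<in> Q \<Longrightarrow> a \<in> A" "a \<in> A \<Longrightarrow> a * a \<in> Q" "a \<in> I \<Longrightarrow> a \<in> Q" "a \<in> Q \<Longrightarrow> b \<in> Q \<Longrightarrow> a + b \<in> Q"
    "a \<in> Q \<Longrightarrow> b \<in> Q \<Longrightarrow> a * b \<in> Q" "- (f ^ (2 * m)) \<notin> Q" using assms by (auto simp: cones_def)
  have sq: "\<And>a. a \<in> A \<Longrightarrow> a * a \<in> Q" using assms by (auto simp: cones_def)
  show "0 \<in> Q" using sq[OF A(1)] by simp
  show "1 \<in> Q" using sq[OF A(2)] by simp
  have "f ^ m \<in> A" by (induction m) (auto simp: A f)
  then show "f ^ (2 * m) \<in> Q" using sq by (simp add: mult_2 power_add)
qed

lemma conesI: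
  assumes "Q \<subseteq> A" "\<And>a. a \<in> A \<Longrightarrow> a * a \<in> Q" "I \<subseteq> Q"
    "\<And>a b. a \<in> Q \<Longrightarrow> b \<in> Q \<Longrightarrow> a + b \<in> Q \<and> a * b \<in> Q" "\<And>m. - (f ^ (2 * m)) \<notin> Q"
  shows "Q \<in> cones"
  using assms by (simp add: cones_def)

lemma initial_cone: "{s + i |s i. s \<in> sos A \<and> i \<in> I} \<in> cones"
proof -
  let ?Q = "{s + i |s i. s \<in> sos A \<and> i \<in> I}"
  have sA: "sos A \<subseteq> A" using sos_subset A by blast
  have Im: "- i \<in> I" if "i \<in> I" for i using I(4)[OF A(5)[OF A(2)] that] by simp
  have "?Q \<subseteq> A" using sA I(2) A(3) by blast
  moreover have "a * a \<in> ?Q" if "a \<in> A" for a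
    using sos.sos_square[OF that sos.sos_zero] I(1) by force
  moreover have "I \<subseteq> ?Q" using sos.sos_zero by force
  moreover have "x + y \<in> ?Q \<and> x * y \<in> ?Q" if xy: "x \<in> ?Q" "y \<in> ?Q" for x y
  proof -
    obtain s i where x: "x = s + i" "s \<in> sos A" "i \<in> I" using xy(1) by blast
    obtain t j where y: "y = t + j" "t \<in> sos A" "j \<in> I" using xy(2) by blast
    have "x + y = (s + t) + (i + j)" by (simp add: x y algebra_simps)
    moreover have "x * y = s * t + (s * j + t * i + i * j)" by (simp add: x y algebra_simps)
    moreover have "s * j + t * i + i * j \<in> I" using x y I sA by (intro I(3) I(4)) auto
    moreover have "s + t \<in> sos A" "s * t \<in> sos A" "i + j \<in> I"
      using x y sos_add[of s A t] sos_mult[OF A(4), of s t] I(3)[of i j] by auto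
    ultimately show ?thesis by blast
  qed
  moreover have "- (f ^ (2 * m)) \<notin> ?Q" for m
  proof
    assume "- (f ^ (2 * m)) \<in> ?Q"
    then obtain s i where si: "- (f ^ (2 * m)) = s + i" "s \<in> sos A" "i \<in> I" by blast
    have "f ^ (2 * m) + s = - (- (f ^ (2 * m)) - s)" by simp
    also have "\<dots> = - i" unfolding si(1) by simp
    finally show False using f(2)[OF si(2), of m] Im[OF si(3)] by simp
  qed
  ultimately show ?thesis by (rule conesI)
qed

lemma maximal_cone: "\<exists>Q\<in>cones. \<forall>Q'\<in>cones. Q \<subseteq> Q' \<longrightarrow> Q' = Q"
proof (rule subset_Zorn_nonempty)
  show "cones \<noteq> {}" using initial_cone by blast
  fix C assume C: "C \<noteq> {}" "subset.chain cones C"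
  then have CQ: "\<And>Q. Q \<in> C \<Longrightarrow> Q \<in> cones" by (auto simp: subset.chain_def)
  have two: "\<exists>Q\<in>C. a \<in> Q \<and> b \<in> Q" if "a \<in> \<Union>C" "b \<in> \<Union>C" for a b
    using that C(2) unfolding subset_chain_def by blast
  obtain Q0 where Q0: "Q0 \<in> C" using C(1) by blast
  have "\<Union>C \<subseteq> A"
  proof (rule Union_least)
    fix Q assume "Q \<in> C" then show "Q \<subseteq> A" using CQ[of Q] by (simp add: cones_def)
  qed
  moreover have "a * a \<in> \<Union>C" if "a \<in> A" for a using Q0 conesD(2)[OF CQ[OF Q0] that] by blast
  moreover have "I \<subseteq> \<Union>C" using Q0 conesD(3)[OF CQ[OF Q0]] by blast
  moreover have "a + b \<in> \<Union>C \<and> a * b \<in> \<Union>C" if ab: "a \<in> \<Union>C" "b \<in> \<Union>C" for a b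
  proof -
    obtain Q where Q: "Q \<in> C" "a \<in> Q" "b \<in> Q" using two[OF ab] by blast
    then show ?thesis using conesD(4,5)[OF CQ[OF Q(1)] Q(2,3)] by blast
  qed
  moreover have "- (f ^ (2 * m)) \<notin> \<Union>C" for m
  proof
    assume "- (f ^ (2 * m)) \<in> \<Union>C"
    then obtain Q where "Q \<in> C" "- (f ^ (2 * m)) \<in> Q" by blast
    then show False using conesD(6)[OF CQ[of Q]] by simp
  qed
  ultimately show "\<Union>C \<in> cones" by (rule conesI)
qed

text \<open>\<open>Q + a * Q\<close> is closed under products because \<open>a * a\<close> lies in
  \<open>Q\<close>. It is strictly larger than the maximal \<open>Q\<close>, so it must contain a
  forbidden element.\<close>

lemma maximal_cone_extension:
  assumes Q: "Q \<in> cones" "\<And>Q'. Q' \<in> cones \<Longrightarrow> Q \<subseteq> Q' \<Longrightarrow> Q' = Q" and a: "a \<in> A" "a \<notin> Q"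
  shows "\<exists>m. \<exists>q\<in>Q. \<exists>r\<in>Q. - (f ^ (2 * m)) = q + a * r"
proof (rule ccontr)
  assume n: "\<not> ?thesis"
  note cD = conesD[OF Q(1)]
  define Q' where "Q' = {q + a * r |q r. q \<in> Q \<and> r \<in> Q}"
  have sub: "Q \<subseteq> Q'" unfolding Q'_def using cD(7) by force
  have "a \<in> Q'" unfolding Q'_def using cD(7,8) by force
  have "Q' \<subseteq> A" unfolding Q'_def using A(3,4) a(1) cD(1) by blast
  moreover have "x * x \<in> Q'" if "x \<in> A" for x using sub cD(2)[OF that] by blast
  moreover have "I \<subseteq> Q'" using sub cD(3) by blast
  moreover have "x + y \<in> Q' \<and> x * y \<in> Q'" if xy: "x \<in> Q'" "y \<in> Q'" for x y
  proof -
    obtain q r where x: "x = q + a * r" "q \<in> Q" "r \<in> Q" using xy(1) by (auto simp: Q'_def)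
    obtain q' r' where y: "y = q' + a * r'" "q' \<in> Q" "r' \<in> Q" using xy(2) by (auto simp: Q'_def)
    have "x + y = (q + q') + a * (r + r')" by (simp add: x y algebra_simps)
    moreover have "x * y = (q * q' + (a * a) * (r * r')) + a * (q * r' + q' * r)" by (simp add: x y algebra_simps)
    moreover have "q + q' \<in> Q" "r + r' \<in> Q" "q * q' + (a * a) * (r * r') \<in> Q" "q * r' + q' * r \<in> Q"
      using x y cD(4,5) cD(2)[OF a(1)] by simp_all
    ultimately show ?thesis unfolding Q'_def by blast
  qed
  moreover have "- (f ^ (2 * m)) \<notin> Q'" for m
  proof
    assume "- (f ^ (2 * m)) \<in> Q'"
    then obtain q r where "q \<in> Q" "r \<in> Q" "- (f ^ (2 * m)) = q + a * r" unfolding Q'_def by blast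
    then show False using n by blast
  qed
  ultimately have "Q' \<in> cones" by (rule conesI)
  then have "Q' = Q" using Q(2) sub by blast
  then show False using \<open>a \<in> Q'\<close> a(2) by simp
qed

lemma prime_cone_exists:
  "\<exists>Q\<in>cones. (\<forall>a\<in>A. a \<in> Q \<or> - a \<in> Q) \<and>
    (\<forall>a\<in>A. \<forall>b\<in>A. a * b \<in> support Q \<longrightarrow> a \<in> support Q \<or> b \<in> support Q)"
proof -
  obtain Q where Q: "Q \<in> cones" "\<And>Q'. Q' \<in> cones \<Longrightarrow> Q \<subseteq> Q' \<Longrightarrow> Q' = Q" using maximal_cone by blast
  note cD = conesD[OF Q(1)]
  \<comment> \<open>The relations saying that neither \<open>c\<close> nor \<open>d\<close> can be
    adjoined are multiplied; with \<open>- (c * d)\<close> in \<open>Q\<close> the product puts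
    \<open>- (f ^ (2 * (m + n)))\<close> into \<open>Q\<close>. Totality is the case
    \<open>d = - c\<close>, primality that of suitably signed \<open>a\<close> and
    \<open>b\<close>.\<close>
  have key: False if cd: "c \<in> A" "d \<in> A" "c \<notin> Q" "d \<notin> Q" "- (c * d) \<in> Q" for c d
  proof -
    obtain m q1 q2 where 1: "q1 \<in> Q" "q2 \<in> Q" "- (f ^ (2 * m)) = q1 + c * q2"
      using maximal_cone_extension[OF Q cd(1,3)] by blast
    obtain n q3 q4 where 2: "q3 \<in> Q" "q4 \<in> Q" "- (f ^ (2 * n)) = q3 + d * q4"
      using maximal_cone_extension[OF Q cd(2,4)] by blast
    define F where "F = - (f ^ (2 * m))" define G where "G = - (f ^ (2 * n))"
    have FG: "- F \<in> Q" "- G \<in> Q" using cD(9) by (auto simp: F_def G_def)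
    have "(F - q1) * (G - q3) = (c * q2) * (d * q4)"
      using 1(3) 2(3) unfolding F_def[symmetric] G_def[symmetric] by simp
    then have "- (F * G) = - (c * d) * (q2 * q4) + - F * q3 + q1 * - G + q1 * q3"
      by (simp add: algebra_simps)
    also have "\<dots> \<in> Q" using 1 2 FG cd(5) by (intro cD(4,5))
    also have "F * G = f ^ (2 * (m + n))" by (simp add: F_def G_def power_add distrib_left)
    finally show ?thesis using cD(6) by blast
  qed
  have "a \<in> Q \<or> - a \<in> Q" if a: "a \<in> A" for a
  proof (rule ccontr)
    assume n: "\<not> ?thesis"
    have "- (a * - a) \<in> Q" using cD(2)[OF a] by simp
    then show False using key[of a "- a"] n a A(5) by blast
  qed
  moreover have "a \<in> support Q \<or> b \<in> support Q" if ab: "a \<in> A" "b \<in> A" "a * b \<in> support Q" for a b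
  proof (rule ccontr)
    assume n: "\<not> ?thesis"
    have "\<exists>c. c \<in> A \<and> c \<notin> Q \<and> (c = a \<or> c = - a)" using n ab(1) A(5) by (auto simp: support_def)
    then obtain c where c: "c \<in> A" "c \<notin> Q" "c = a \<or> c = - a" by blast
    have "\<exists>d. d \<in> A \<and> d \<notin> Q \<and> (d = b \<or> d = - b)" using n ab(2) A(5) by (auto simp: support_def)
    then obtain d where d: "d \<in> A" "d \<notin> Q" "d = b \<or> d = - b" by blast
    have "- (c * d) \<in> Q" using ab(3) c(3) d(3) by (auto simp: support_def)
    then show False using key[OF c(1) d(1) c(2) d(2)] by blast
  qed
  ultimately show ?thesis using Q(1) by blast
qed

end

section \<open>The real Nullstellensatz\<close>

lemma power_fun_apply: "(f ^ n) x = f x ^ n"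
  by (induction n) simp_all

lemma sum_fun_apply: "(\<Sum>i\<in>S. F i) x = (\<Sum>i\<in>S. F i x)"
  by (induction S rule: infinite_finite_induct) simp_all

lemma pfun_hom: "pfun (D + E) = pfun D + pfun E" "pfun (D * E) = pfun D * pfun E" "pfun (- D) = - pfun D"
  by (simp_all add: fun_eq_iff pfun_simps)

lemma pfun_Rkl: "pfun D \<in> Rkl k l"
  by (intro poly2_Rkl poly2I[of _ D]) (rule refl)

lemma poly2_point_expansion:
  assumes "poly2 p"
  shows "\<exists>p1 p2. poly2 p1 \<and> poly2 p2 \<and> (\<forall>z. p z = (fst z - a) * p1 z + (snd z - b) * p2 z + p (a, b))"
proof -
  have "poly2 (\<lambda>z. p (a, snd z))" by (rule poly2_comp[OF assms poly2_const poly2_snd])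
  then have "poly2 (\<lambda>z. p z - p (a, snd z))" "poly2 (\<lambda>z. p (a, snd z) - p (a, b))"
    using assms poly2_diff poly2_const by blast+
  note d = this
  have "infinite {y. p (a, y) - p (a, snd (a, y)) = 0}" "infinite {x::real. p (a, snd (x, b)) - p (a, b) = 0}"
    by (simp_all add: infinite_UNIV_char_0)
  note d = poly2_div_fst[OF d(1) this(1)] poly2_div_snd[OF d(2) this(2)]
  obtain p1 where p1: "poly2 p1" "\<And>z. p z - p (a, snd z) = (fst z - a) * p1 z" using d(1) by blast
  obtain p2 where p2: "poly2 p2" "\<And>z. p (a, snd z) - p (a, b) = (snd z - b) * p2 z" using d(2) by blast
  have "p z = (fst z - a) * p1 z + (snd z - b) * p2 z + p (a, b)" for z
    using p1(2)[of z] p2(2)[of z] by linarith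
  then show ?thesis using p1(1) p2(1) by blast
qed

locale Rkl_ideal =
  fixes k l :: nat and I :: "(real \<times> real \<Rightarrow> real) set"
  assumes Rkl_add: "\<And>f g. f \<in> Rkl k l \<Longrightarrow> g \<in> Rkl k l \<Longrightarrow> f + g \<in> Rkl k l"
    and Rkl_mult: "\<And>f g. f \<in> Rkl k l \<Longrightarrow> g \<in> Rkl k l \<Longrightarrow> f * g \<in> Rkl k l"
    and I: "0 \<in> I" "I \<subseteq> Rkl k l" "\<And>f g. f \<in> I \<Longrightarrow> g \<in> I \<Longrightarrow> f + g \<in> I"
      "\<And>f g. f \<in> Rkl k l \<Longrightarrow> g \<in> I \<Longrightarrow> f * g \<in> I"
begin

lemma Rkl_const: "(\<lambda>_. r) \<in> Rkl k l"
  by (intro poly2_Rkl poly2_const)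

lemma Rkl_uminus: assumes "f \<in> Rkl k l" shows "- f \<in> Rkl k l"
proof -
  have "- f = (\<lambda>_. - 1) * f" by (simp add: fun_eq_iff)
  then show ?thesis using Rkl_mult[OF Rkl_const assms, of "- 1"] by simp
qed

lemma Rkl_one: "1 \<in> Rkl k l" and Rkl_zero: "0 \<in> Rkl k l"
  using Rkl_const[of 1] Rkl_const[of 0] by (simp_all add: one_fun_def zero_fun_def)

lemma I_uminus: assumes "g \<in> I" shows "- g \<in> I"
  using I(4)[OF Rkl_uminus[OF Rkl_one] assms] by simp

text \<open>\<open>g\<close> is nonzero on a nonempty open set, which is infinite and so contains a
  regular point \<open>x\<close>. Multiplication by a denominator at \<open>x\<close> gives a
  polynomial that does not vanish at \<open>x\<close>.\<close>

lemma I_contains_polynomial: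
  assumes "g \<in> I" "g \<noteq> 0" shows "\<exists>D. D \<noteq> 0 \<and> pfun D \<in> I"
proof -
  have g: "g \<in> Rkl k l" using I(2) assms(1) by blast
  have "open {x. g x \<noteq> 0}"
    using RklD(4)[OF g] by (intro open_Collect_neq) (auto simp: continuous_on_eq_continuous_at)
  moreover have "{x. g x \<noteq> 0} \<noteq> {}" using assms(2) by (auto simp: fun_eq_iff)
  ultimately have "infinite {x. g x \<noteq> 0}" using finite_imp_not_open by blast
  then have "infinite ({x. g x \<noteq> 0} - {x. \<not> regular_at g x})" using RklD(2)[OF g] by (rule Diff_infinite_finite[rotated])
  then have "{x. g x \<noteq> 0} - {x. \<not> regular_at g x} \<noteq> {}" by (metis finite.emptyI)
  then obtain x where x: "g x \<noteq> 0" "regular_at g x" by blast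
  obtain p q where pq: "poly2 p" "poly2 q" "q x \<noteq> 0" "\<And>y. q y * g y = p y"
    using regular_denominator[OF RklD(4)[OF g] x(2)] by blast
  obtain D where D: "p = pfun D" using pq(1) poly2_iff by auto
  have "q * g = p" by (rule ext) (simp add: pq(4))
  then have "pfun D \<in> I" using I(4)[OF poly2_Rkl[OF pq(2)] assms(1)] D by simp
  moreover have "p x \<noteq> 0" using pq(3) pq(4)[of x] x(1) by (metis mult_eq_0_iff)
  then have "D \<noteq> 0" using D by (auto simp: pfun_simps)
  ultimately show ?thesis by blast
qed

end

locale Rkl_prime = Rkl_ideal +
  fixes P :: "(real \<times> real \<Rightarrow> real) set"
  assumes P: "P \<subseteq> Rkl k l" "1 \<notin> P" "\<And>f g. f \<in> P \<Longrightarrow> g \<in> P \<Longrightarrow> f + g \<in> P"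
      "\<And>f g. f \<in> Rkl k l \<Longrightarrow> g \<in> P \<Longrightarrow> f * g \<in> P"
      "\<And>f g. f \<in> Rkl k l \<Longrightarrow> g \<in> Rkl k l \<Longrightarrow> f * g \<in> P \<Longrightarrow> f \<in> P \<or> g \<in> P"
    and IP: "I \<subseteq> P"
begin

lemma const_notin_P: assumes "r \<noteq> 0" shows "(\<lambda>_. r) \<notin> P"
proof
  assume "(\<lambda>_. r) \<in> P"
  then have "(\<lambda>_. inverse r) * (\<lambda>_. r) \<in> P" using P(4) Rkl_const by blast
  moreover have "(\<lambda>_. inverse r) * (\<lambda>_. r) = (1 :: real \<times> real \<Rightarrow> real)" using assms by (simp add: fun_eq_iff)
  ultimately show False using P(2) by simp
qed

lemma P_power: assumes "f \<in> Rkl k l" "f ^ N \<in> P" shows "f \<in> P"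
  using assms(2)
proof (induction N)
  case 0
  then have "1 \<in> P" by (simp only: power_0)
  then show ?case using P(2) by blast
next
  case (Suc N)
  have "f ^ N \<in> Rkl k l" by (induction N) (simp_all only: power_0 power_Suc Rkl_one Rkl_mult assms(1))
  moreover have "f * f ^ N \<in> P" using Suc.prems by (simp only: power_Suc)
  ultimately have "f \<in> P \<or> f ^ N \<in> P" by (rule P(5)[OF assms(1)])
  then show ?case using Suc.IH by blast
qed

lemma P_point:
  assumes ab: "(\<lambda>z. fst z - a) \<in> P" "(\<lambda>z. snd z - b) \<in> P" and f: "f \<in> Rkl k l" "f (a, b) = 0"
  shows "f \<in> P"
proof -
  have polyP: "p \<in> P" if p: "poly2 p" "p (a, b) = 0" for p
  proof -
    obtain p1 p2 where e: "poly2 p1" "poly2 p2" "\<And>z. p z = (fst z - a) * p1 z + (snd z - b) * p2 z + p (a, b)"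
      using poly2_point_expansion[OF p(1)] by blast
    have "p = p1 * (\<lambda>z. fst z - a) + p2 * (\<lambda>z. snd z - b)"
      by (rule ext) (subst e(3), simp add: p(2) mult.commute)
    then show ?thesis using P(3,4) ab poly2_Rkl[OF e(1)] poly2_Rkl[OF e(2)] by metis
  qed
  show ?thesis
  proof (cases "regular_at f (a, b)")
    case True
    obtain p q where pq: "poly2 p" "poly2 q" "q (a, b) \<noteq> 0" "\<And>y. q y * f y = p y"
      using regular_denominator[OF RklD(4)[OF f(1)] True] by blast
    have "p (a, b) = 0" using pq(4)[of "(a, b)"] f(2) by simp
    then have "p \<in> P" using polyP pq(1) by blast
    moreover have "q * f = p" by (rule ext) (simp add: pq(4))
    \<comment> \<open>\<open>q\<close> differs from the nonzero constant \<open>q (a, b)\<close> by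
      an element of \<open>P\<close>, and nonzero constants are units.\<close>
    moreover have "q \<notin> P"
    proof
      assume q: "q \<in> P"
      have "(\<lambda>z. q (a, b) - q z) \<in> P" using pq(2) by (intro polyP poly2_intros) auto
      then have "(\<lambda>z. q (a, b) - q z) + q \<in> P" using q by (rule P(3))
      moreover have "(\<lambda>z. q (a, b) - q z) + q = (\<lambda>_. q (a, b))" by (simp add: fun_eq_iff)
      ultimately show False using const_notin_P[OF pq(3)] by simp
    qed
    ultimately show ?thesis using P(5)[OF poly2_Rkl[OF pq(2)] f(1)] by simp
  next
    case False
    obtain N h where h: "h \<in> Rkl k l" "\<And>z. f z ^ N = sqdist (a, b) z * h z"
      using Rkl_divide_sqdist[OF f False] by blast
    have "sqdist (a, b) \<in> P" by (intro polyP poly2_sqdist sqdist_self)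
    then have "h * sqdist (a, b) \<in> P" using P(4) h(1) by blast
    moreover have "h * sqdist (a, b) = f ^ N" by (rule ext) (simp add: power_fun_apply h(2))
    ultimately show ?thesis using P_power[OF f(1)] by simp
  qed
qed

lemma point_in_zero_set:
  assumes ab: "(\<lambda>z. fst z - a) \<in> P" "(\<lambda>z. snd z - b) \<in> P"
  shows "(a, b) \<in> zero_set I"
  unfolding zero_set_def
proof (intro CollectI ballI)
  fix g assume g: "g \<in> I"
  define r where "r = g (a, b)"
  have gA: "g \<in> Rkl k l" using g I(2) by blast
  have "(\<lambda>_. r) + - g \<in> Rkl k l" using Rkl_add Rkl_const Rkl_uminus[OF gA] by blast
  then have "(\<lambda>_. r) + - g \<in> P" by (rule P_point[OF ab]) (simp add: r_def)
  moreover have "g \<in> P" using IP g by blast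
  ultimately have "((\<lambda>_. r) + - g) + g \<in> P" by (rule P(3))
  moreover have "((\<lambda>_. r) + - g) + g = (\<lambda>_. r)" by (simp add: fun_eq_iff)
  ultimately show "g (a, b) = 0" using const_notin_P[of r] by (auto simp: r_def)
qed

lemma P_curve:
  assumes D: "prime_elem D" "\<And>F. pfun F \<in> P \<longleftrightarrow> D dvd F" "uncountable {(x, y). pe D x y = 0}"
    and f: "f \<in> Rkl k l" "\<And>x. x \<in> zero_set I \<Longrightarrow> f x = 0"
  shows "f \<in> P"
proof -
  define S where "S = {(x, y). pe D x y = 0}"
  define S' where "S' = {x \<in> S. x islimpt S}"
  have PS: "pfun F z = 0" if "pfun F \<in> P" "z \<in> S" for F z
  proof -
    have "D dvd F" using D(2) that(1) by blast
    then obtain K where "F = D * K" by blast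
    then have "pfun F z = pfun D z * pfun K z" by (simp only: pfun_simps)
    moreover have "pfun D z = 0" using that(2) by (auto simp: S_def pfun_def)
    ultimately show ?thesis by simp
  qed
  \<comment> \<open>Isolated zeros cannot be reached by continuity, but there are only countably
    many of them.\<close>
  have "S' = S - {x \<in> S. \<not> x islimpt S}" by (auto simp: S'_def)
  then have "uncountable S'" using D(3) countable_isolated_points[of S] by (simp add: uncountable_minus_countable S_def)
  then have inf: "infinite S'" using countable_finite by blast
  have "x \<in> zero_set I" if x: "x \<in> S'" for x
    unfolding zero_set_def
  proof (intro CollectI ballI)
    fix g assume g: "g \<in> I"
    have gA: "g \<in> Rkl k l" using g I(2) by blast
    define F where "F = {x. \<not> regular_at g x}"
    have fF: "finite F" using RklD(2)[OF gA] by (simp add: F_def)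
    have g0: "g y = 0" if y: "y \<in> S - F" for y
    proof -
      have "regular_at g y" using y by (simp add: F_def)
      then obtain p q where pq: "poly2 p" "poly2 q" "q y \<noteq> 0" "\<And>y. q y * g y = p y"
        using regular_denominator[OF RklD(4)[OF gA]] by blast
      have "q * g = p" by (rule ext) (simp add: pq(4))
      then have "p \<in> P" using P(4)[OF poly2_Rkl[OF pq(2)]] IP g by blast
      moreover obtain E where "p = pfun E" using pq(1) poly2_iff by auto
      ultimately have "p y = 0" using PS y by blast
      then show ?thesis using pq(3) pq(4)[of y] by (metis mult_eq_0_iff)
    qed
    \<comment> \<open>Discarding the finite set of non-regular points does not affect limit
      points.\<close>
    have "x islimpt ((S - F) \<union> F)" using x by (auto simp: S'_def intro: islimpt_subset)
    then have "x islimpt (S - F)" unfolding islimpt_Un using fF islimpt_finite by blast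
    then have "x islimpt {y. g y = 0}" by (rule islimpt_subset) (use g0 in blast)
    moreover have "closed {y. g y = 0}"
      using RklD(4)[OF gA] by (intro closed_Collect_eq) (auto simp: continuous_on_eq_continuous_at)
    ultimately show "g x = 0" by (simp add: closed_limpt)
  qed
  then have f0: "f x = 0" if "x \<in> S'" for x using f(2) that by blast
  have "infinite (S' - {x. \<not> regular_at f x})" using RklD(2)[OF f(1)] inf by (rule Diff_infinite_finite)
  then have "S' - {x. \<not> regular_at f x} \<noteq> {}" by (metis finite.emptyI)
  then obtain x where x: "x \<in> S'" "regular_at f x" by blast
  obtain p q where pq: "poly2 p" "poly2 q" "q x \<noteq> 0" "\<And>y. q y * f y = p y"
    using regular_denominator[OF RklD(4)[OF f(1)] x(2)] by blast
  obtain E G where E: "p = pfun E" and G: "q = pfun G" using pq(1,2) poly2_iff by auto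
  \<comment> \<open>The numerator of \<open>f\<close> vanishes on the infinite set
    \<open>S'\<close>, whereas a polynomial not divisible by \<open>D\<close> meets the curve in
    finitely many points.\<close>
  have "D dvd E"
  proof (rule ccontr)
    assume "\<not> D dvd E"
    then have "finite {(x, y). pe D x y = 0 \<and> pe E x y = 0}" by (rule finite_common_zeros[OF D(1)])
    moreover have "S' \<subseteq> {(x, y). pe D x y = 0 \<and> pe E x y = 0}"
    proof
      fix z assume z: "z \<in> S'"
      have "pfun E z = 0" using pq(4)[of z] f0[OF z] by (simp add: E)
      then show "z \<in> {(x, y). pe D x y = 0 \<and> pe E x y = 0}"
        using z by (auto simp: S'_def S_def pfun_def)
    qed
    ultimately show False using inf finite_subset by blast
  qed
  then have "p \<in> P" using D(2) E by simp
  moreover have "q * f = p" by (rule ext) (simp add: pq(4))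
  moreover have "q \<notin> P" using PS[of G x] x(1) pq(3) G by (auto simp: S'_def)
  ultimately show ?thesis using P(5)[OF poly2_Rkl[OF pq(2)] f(1)] by simp
qed

end

context Rkl_ideal begin

theorem vanishing_imp_real_radical:
  assumes fA: "f \<in> Rkl k l" and fZ: "\<And>x. x \<in> zero_set I \<Longrightarrow> f x = 0"
  shows "\<exists>m. \<exists>s\<in>sos (Rkl k l). f ^ (2 * m) + s \<in> I"
proof (rule ccontr)
  assume n: "\<not> ?thesis"
  interpret formally_real_pair "Rkl k l" I f
    by unfold_locales (use n fA Rkl_one Rkl_zero Rkl_add Rkl_mult Rkl_uminus I in auto)
  obtain Q where Q: "Q \<in> cones" "\<And>a. a \<in> Rkl k l \<Longrightarrow> a \<in> Q \<or> - a \<in> Q"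
    "\<And>a b. a \<in> Rkl k l \<Longrightarrow> b \<in> Rkl k l \<Longrightarrow> a * b \<in> support Q \<Longrightarrow> a \<in> support Q \<or> b \<in> support Q"
    using prime_cone_exists by blast
  note cD = conesD[OF Q(1)]
  define P where "P = support Q"
  have m1: "- 1 \<notin> Q" using cD(6)[of 0] by simp
  interpret Rkl_prime k l I P
  proof
    show "P \<subseteq> Rkl k l" using cD(1) by (auto simp: P_def support_def)
    show "1 \<notin> P" using m1 by (auto simp: P_def support_def)
    show "f + g \<in> P" if "f \<in> P" "g \<in> P" for f g
      using that cD(4)[of f g] cD(4)[of "- f" "- g"] by (simp add: P_def support_def add.commute)
    show "f * g \<in> P" if "f \<in> Rkl k l" "g \<in> P" for f g
      using Q(2)[OF that(1)] that(2) cD(5)[of f g] cD(5)[of f "- g"] cD(5)[of "- f" g] cD(5)[of "- f" "- g"]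
      by (auto simp: P_def support_def)
    show "f \<in> P \<or> g \<in> P" if "f \<in> Rkl k l" "g \<in> Rkl k l" "f * g \<in> P" for f g
      using Q(3) that by (simp add: P_def)
    show "I \<subseteq> P" using cD(3) I_uminus by (auto simp: P_def support_def)
  qed
  have fP: "f \<notin> P"
  proof
    assume "f \<in> P"
    then have "f * f \<in> P" using P(4) fA by blast
    then show False using cD(6)[of 1] by (simp add: P_def support_def power2_eq_square)
  qed
  \<comment> \<open>The cone pulled back to polynomials; its support is the prime formed by the
    polynomials in \<open>P\<close>.\<close>
  define Q0 where "Q0 = {D. pfun D \<in> Q}"
  have supp: "D \<in> support Q0 \<longleftrightarrow> pfun D \<in> P" for D by (simp add: support_def Q0_def P_def pfun_hom)
  have "prime_cone Q0"
    unfolding prime_cone_def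
  proof (intro conjI ballI allI impI)
    fix a b assume "a \<in> Q0" "b \<in> Q0"
    then show "a + b \<in> Q0" "a * b \<in> Q0" using cD(4,5) by (auto simp: Q0_def pfun_hom)
  next
    fix a show "a \<in> Q0 \<or> - a \<in> Q0" using Q(2)[OF pfun_Rkl] by (simp add: Q0_def pfun_hom)
  next
    have "pfun (- 1) = - 1" by (simp add: fun_eq_iff pfun_simps)
    then show "- 1 \<notin> Q0" using m1 by (simp add: Q0_def)
  next
    fix a b assume "a * b \<in> support Q0"
    then show "a \<in> support Q0 \<or> b \<in> support Q0" using P(5)[OF pfun_Rkl pfun_Rkl] by (simp add: supp pfun_hom)
  qed
  from prime_cone_dichotomy[OF this, unfolded cone_dichotomy_def]
  consider (zero) "support Q0 = {0}"
    | (point) a b where "[:[:- a, 1:]:] \<in> support Q0" "[:[:- b:], 1:] \<in> support Q0"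
    | (curve) D where "prime_elem D" "support Q0 = {f. D dvd f}" "uncountable {(x, y). pe D x y = 0}"
    by (elim disjE exE conjE) simp_all
  then show False
  proof cases
    case zero
    \<comment> \<open>A nonzero element of \<open>I\<close> would put a nonzero polynomial into
      \<open>I\<close> and hence into the support. With \<open>I\<close> zero its zero set is the
      plane, so \<open>f\<close> is 0.\<close>
    have "I = {0}"
    proof (rule ccontr)
      assume "I \<noteq> {0}"
      then obtain g where "g \<in> I" "g \<noteq> 0" using I(1) by blast
      then obtain D where "D \<noteq> 0" "pfun D \<in> I" using I_contains_polynomial by blast
      then show False using zero IP supp[of D] by auto
    qed
    then have "f = 0" using fZ by (auto simp: zero_set_def fun_eq_iff)
    then have "f ^ (2 * 1) + 0 \<in> I" using I(1) by simp
    then show False using n sos_zero by blast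
  next
    case (point a b)
    have "pfun [:[:- a, 1:]:] = (\<lambda>z. fst z - a)" "pfun [:[:- b:], 1:] = (\<lambda>z. snd z - b)"
      by (simp_all add: fun_eq_iff pfun_def ev_inner[OF rhom_id] ev_pCons[OF rhom_id] ev_zero[OF rhom_id])
    then have ab: "(\<lambda>z. fst z - a) \<in> P" "(\<lambda>z. snd z - b) \<in> P" using point supp by metis+
    then show False using fP P_point[OF ab fA] fZ[OF point_in_zero_set[OF ab]] by blast
  next
    case (curve D)
    have "pfun F \<in> P \<longleftrightarrow> D dvd F" for F using curve(2) supp[of F] by auto
    then show False using fP P_curve[OF curve(1) _ curve(3) fA fZ] by blast
  qed
qed

end

lemma Rkl_ring_simps:
  "carrier (Rkl_ring k l) = Rkl k l" "\<one>\<^bsub>Rkl_ring k l\<^esub> = 1" "\<zero>\<^bsub>Rkl_ring k l\<^esub> = 0"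
  "f \<otimes>\<^bsub>Rkl_ring k l\<^esub> g = f * g" "f \<oplus>\<^bsub>Rkl_ring k l\<^esub> g = f + g"
  by (simp_all add: Rkl_ring_def fun_eq_iff)

theorem theorem5p12:
  fixes k l :: nat and I :: "(real \<times> real \<Rightarrow> real) set"
  assumes "ideal I (Rkl_ring k l)"
  shows "real_radical (Rkl_ring k l) I = vanishing_ideal k l (zero_set I)
    \<and> (real_ideal (Rkl_ring k l) I \<longrightarrow>
         ring_radical (Rkl_ring k l) I = vanishing_ideal k l (zero_set I))"
proof -
  let ?R = "Rkl_ring k l"
  interpret ideal I ?R by (fact assms)
  \<comment> \<open>Closure of the set under these operations is part of the assumption that
    \<open>I\<close> is an ideal of the ring \<open>Rkl_ring k l\<close>.\<close>
  have add: "f + g \<in> Rkl k l" and mult: "f * g \<in> Rkl k l" if "f \<in> Rkl k l" "g \<in> Rkl k l" for f g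
    using that a_closed[of f g] m_closed[of f g] by (simp_all add: Rkl_ring_simps)
  interpret J: Rkl_ideal k l I
  proof
    note sub = additive_subgroup_axioms
    show "0 \<in> I" using additive_subgroup.zero_closed[OF sub] by (simp add: Rkl_ring_simps)
    show "I \<subseteq> Rkl k l" using additive_subgroup.a_subset[OF sub] by (simp add: Rkl_ring_simps)
    show "f + g \<in> I" if "f \<in> I" "g \<in> I" for f g
      using additive_subgroup.a_closed[OF sub that] by (simp add: Rkl_ring_simps)
    show "f * g \<in> I" if "f \<in> Rkl k l" "g \<in> I" for f g using I_l_closed[of g f] that by (simp add: Rkl_ring_simps)
  qed (use add mult in auto)
  have pow: "a [^]\<^bsub>?R\<^esub> n = a ^ n" for a and n :: nat
    by (induction n) (simp_all add: Rkl_ring_simps mult.commute)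
  have fsum: "(\<Oplus>\<^bsub>?R\<^esub>i\<in>{..<p}. b i \<otimes>\<^bsub>?R\<^esub> b i) = (\<Sum>i<p. b i * b i)"
    if "\<forall>i<p. b i \<in> carrier ?R" for p :: nat and b
    using that
  proof (induction p)
    case (Suc p)
    have b: "(\<lambda>i. b i \<otimes>\<^bsub>?R\<^esub> b i) \<in> {..<p} \<rightarrow> carrier ?R" "b p \<otimes>\<^bsub>?R\<^esub> b p \<in> carrier ?R"
      using Suc.prems m_closed by auto
    have "(\<Oplus>\<^bsub>?R\<^esub>i\<in>{..<Suc p}. b i \<otimes>\<^bsub>?R\<^esub> b i)
      = b p \<otimes>\<^bsub>?R\<^esub> b p \<oplus>\<^bsub>?R\<^esub> (\<Oplus>\<^bsub>?R\<^esub>i\<in>{..<p}. b i \<otimes>\<^bsub>?R\<^esub> b i)"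
      unfolding lessThan_Suc by (rule finsum_insert[OF _ _ b]) simp_all
    also have "(\<Oplus>\<^bsub>?R\<^esub>i\<in>{..<p}. b i \<otimes>\<^bsub>?R\<^esub> b i) = (\<Sum>i<p. b i * b i)"
      using Suc.prems by (intro Suc.IH) simp
    finally show ?case by (simp only: Rkl_ring_simps sum.lessThan_Suc add.commute)
  qed (simp add: Rkl_ring_simps)
  \<comment> \<open>At a zero of \<open>I\<close> both nonnegative summands vanish. Exponent 0 would
    contribute the summand 1, so it can occur only when the zero set is empty.\<close>
  have pos: "a x = 0 \<and> m \<noteq> 0" if "a ^ m + s \<in> I" "even m" "s x \<ge> 0" "x \<in> zero_set I" for a s x m
  proof -
    have "(a ^ m + s) x = 0" using that(1,4) unfolding zero_set_def by blast
    then have "a x ^ m + s x = 0" by (simp add: power_fun_apply)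
    moreover have "a x ^ m \<ge> 0" using that(2) by (rule zero_le_even_power)
    ultimately have "a x ^ m = 0" using that(3) by linarith
    then show ?thesis by (simp add: power_eq_0_iff)
  qed
  have ge: "real_radical ?R I \<subseteq> vanishing_ideal k l (zero_set I)"
  proof
    fix a assume "a \<in> real_radical ?R I"
    then have a: "a \<in> Rkl k l" and "\<exists>(m::nat) (p::nat) b. (\<forall>i<p. b i \<in> carrier ?R) \<and>
        a [^]\<^bsub>?R\<^esub> (2 * m) \<oplus>\<^bsub>?R\<^esub> (\<Oplus>\<^bsub>?R\<^esub>i\<in>{..<p}. b i \<otimes>\<^bsub>?R\<^esub> b i) \<in> I"
      unfolding real_radical_def Rkl_ring_simps(1) by blast+
    then obtain m p :: nat and b where b: "\<forall>i<p. b i \<in> carrier ?R"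
      and h: "a [^]\<^bsub>?R\<^esub> (2 * m) \<oplus>\<^bsub>?R\<^esub> (\<Oplus>\<^bsub>?R\<^esub>i\<in>{..<p}. b i \<otimes>\<^bsub>?R\<^esub> b i) \<in> I" by blast
    have s: "a ^ (2 * m) + (\<Sum>i<p. b i * b i) \<in> I" using h unfolding fsum[OF b] pow Rkl_ring_simps(5) .
    have "a x = 0" if "x \<in> zero_set I" for x
      using pos[OF s _ _ that] by (simp add: sum_fun_apply sum_nonneg)
    then show "a \<in> vanishing_ideal k l (zero_set I)" using a by (simp add: vanishing_ideal_def)
  qed
  have sums: "\<exists>m p b. (\<forall>i<p. b i \<in> carrier ?R) \<and> f ^ (2 * m) + (\<Sum>i<(p::nat). b i * b i) \<in> I"
    if f: "f \<in> vanishing_ideal k l (zero_set I)" for f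
  proof -
    have "f \<in> Rkl k l" "\<And>x. x \<in> zero_set I \<Longrightarrow> f x = 0" using f unfolding vanishing_ideal_def by blast+
    then obtain m s where ms: "s \<in> sos (Rkl k l)" "f ^ (2 * m) + s \<in> I"
      using J.vanishing_imp_real_radical by blast
    obtain p b where b: "\<forall>i<p. b i \<in> Rkl k l" "s = (\<Sum>i<(p::nat). b i * b i)" using sos_eq_sum[OF ms(1)] by blast
    show ?thesis
      using ms(2) b unfolding Rkl_ring_simps(1) by (intro exI[of _ m] exI[of _ p] exI[of _ b]) simp
  qed
  have le: "vanishing_ideal k l (zero_set I) \<subseteq> real_radical ?R I"
  proof
    fix f assume f: "f \<in> vanishing_ideal k l (zero_set I)"
    from sums[OF f] obtain m p b
      where b: "\<forall>i<p. b i \<in> carrier ?R" "f ^ (2 * m) + (\<Sum>i<(p::nat). b i * b i) \<in> I"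
      by (elim exE conjE)
    have "f [^]\<^bsub>?R\<^esub> (2 * m) \<oplus>\<^bsub>?R\<^esub> (\<Oplus>\<^bsub>?R\<^esub>i\<in>{..<p}. b i \<otimes>\<^bsub>?R\<^esub> b i) \<in> I"
      unfolding fsum[OF b(1)] pow Rkl_ring_simps(5) by (rule b(2))
    moreover have "f \<in> carrier ?R" using f by (simp add: vanishing_ideal_def Rkl_ring_simps)
    ultimately show "f \<in> real_radical ?R I" unfolding real_radical_def using b(1)
      by (intro CollectI conjI exI[of _ m] exI[of _ p] exI[of _ b])
  qed
  have "ring_radical ?R I = vanishing_ideal k l (zero_set I)" if real: "real_ideal ?R I"
  proof (intro equalityI subsetI)
    fix f assume "f \<in> ring_radical ?R I"
    then obtain n where f: "f \<in> Rkl k l" "f ^ n \<in> I" unfolding ring_radical_def by (auto simp: pow Rkl_ring_simps)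
    have "f x = 0" if "x \<in> zero_set I" for x
    proof -
      have "(f ^ n) x = 0" using f(2) that unfolding zero_set_def by blast
      then show ?thesis by (simp add: power_fun_apply power_eq_0_iff)
    qed
    then show "f \<in> vanishing_ideal k l (zero_set I)" using f(1) by (simp add: vanishing_ideal_def)
  next
    fix f assume f: "f \<in> vanishing_ideal k l (zero_set I)"
    from sums[OF f] obtain m p b
      where b: "\<forall>i<p. b i \<in> carrier ?R" "f ^ (2 * m) + (\<Sum>i<(p::nat). b i * b i) \<in> I"
      by (elim exE conjE)
    have fA: "f \<in> Rkl k l" using f by (simp add: vanishing_ideal_def)
    have fm: "f ^ m \<in> Rkl k l" by (induction m) (simp_all only: power_0 power_Suc J.Rkl_one mult fA)
    \<comment> \<open>\<open>f ^ m\<close> joins the family at index \<open>p\<close>, so the whole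
      expression is a sum of squares; reality of \<open>I\<close> then puts each member, in
      particular \<open>f ^ m\<close>, into \<open>I\<close>.\<close>
    define c where "c = b(p := f ^ m)"
    have c: "\<forall>i<Suc p. c i \<in> carrier ?R" using b(1) fm by (auto simp: c_def less_Suc_eq Rkl_ring_simps)
    have "(\<Sum>i<p. c i * c i) = (\<Sum>i<p. b i * b i)" by (rule sum.cong) (auto simp: c_def)
    moreover have "c p * c p = f ^ (2 * m)" by (simp only: c_def fun_upd_same mult_2 power_add)
    ultimately have "(\<Sum>i<Suc p. c i * c i) = f ^ (2 * m) + (\<Sum>i<p. b i * b i)"
      by (simp only: sum.lessThan_Suc add.commute)
    then have "(\<Oplus>\<^bsub>?R\<^esub>i\<in>{..<Suc p}. c i \<otimes>\<^bsub>?R\<^esub> c i) \<in> I" using b(2) by (simp only: fsum[OF c])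
    then have "\<forall>i<Suc p. c i \<in> I" using real c unfolding real_ideal_def by blast
    then have "c p \<in> I" by simp
    then have "f ^ m \<in> I" by (simp only: c_def fun_upd_same)
    then show "f \<in> ring_radical ?R I" unfolding ring_radical_def using fA by (auto simp: pow Rkl_ring_simps)
  qed
  then show ?thesis using ge le by blast
qed

end
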